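(* Let $G$ be a finite simple graph on $[n]$ without isolated vertices whose vertex set $V(G)$ is the disjoint union of the maximal cliques of $G$ which admit a free vertex. Let $\ell$ be a positive integer with $\ell\le\delta(G)$ and let $\mathbf{k}=(k_1,\ldots,k_n)$ with $k_i=\deg_G(i)+1-\ell$. Then the following statements hold. (a) $S/\mathrm{NI}_{\mathbf{k}}(G)$ is Cohen-Macaulay. (b) $\operatorname{reg}(S/\mathrm{NI}_{\mathbf{k}}(G))=n-r(\ell+1)$, where $r$ is the number of maximal cliques of $G$ admitting a free vertex. (c) All minimal $(\ell+1)$-tuple dominating sets of $G$ have the same cardinality. In particular, if $\mathbf{k}$ is the degree-vector of $G$ (i.e. $k_i=\deg_G(i)$ for all $i$), then $S/\mathrm{NI}_{\mathbf{k}}(G)$ is Cohen-Macaulay and $\operatorname{reg}(S/\mathrm{NI}_{\mathbf{k}}(G))=n-2r$.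
   Context: $K$ is a field and $S=K[x_1,\ldots,x_n]$. $N_G[i]$ is the closed neighborhood of $i$; $\mathbf{x}_W=\prod_{j\in W}x_j$. For $\mathbf{k}=(k_1,\ldots,k_n)$ with $1\le k_i\le\deg_G(i)+1$, the $\mathbf{k}$-neighborhood ideal is $\mathrm{NI}_{\mathbf{k}}(G)=\sum_{i=1}^n(\mathbf{x}_W: W\subseteq N_G[i],\ |W|=k_i)\subseteq S$. A vertex is called a free vertex of $G$ if it belongs to exactly one maximal clique of $G$; a maximal clique admits a free vertex if it contains one. $\delta(G)$ is the minimum degree of a vertex in $G$. A subset $D\subseteq[n]$ is an $h$-tuple dominating set of $G$ if $|N_G[i]\cap D|\ge h$ for all $i\in[n]$; minimality is with respect to inclusion. $\operatorname{reg}$ is Castelnuovo-Mumford regularity. *)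

theory Defs
  imports
    "HOL-Library.Poly_Mapping"
    "HOL-Library.Extended_Nat"
    "HOL-Library.Disjoint_Sets"
    "HOL-Library.Cardinality"
    "Jordan_Normal_Form.Matrix_Kernel"
begin

section \<open>Finite simple graphs\<close>

text \<open>
  The vertex set is the whole of a finite type \<open>'v\<close>, so \<open>n = CARD('v)\<close>; a graph is given by
  its adjacency relation.
\<close>

definition simple_graph :: "('v \<Rightarrow> 'v \<Rightarrow> bool) \<Rightarrow> bool" where
  "simple_graph E \<longleftrightarrow> symp E \<and> irreflp E"

definition closed_neighborhood :: "('v \<Rightarrow> 'v \<Rightarrow> bool) \<Rightarrow> 'v \<Rightarrow> 'v set" where
  "closed_neighborhood E i = insert i {j. E i j}"

definition vertex_degree :: "('v \<Rightarrow> 'v \<Rightarrow> bool) \<Rightarrow> 'v \<Rightarrow> nat" where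
  "vertex_degree E i = card {j. E i j}"

definition min_degree :: "('v::finite \<Rightarrow> 'v \<Rightarrow> bool) \<Rightarrow> nat" where
  "min_degree E = Min (range (vertex_degree E))"

definition no_isolated_vertices :: "('v \<Rightarrow> 'v \<Rightarrow> bool) \<Rightarrow> bool" where
  "no_isolated_vertices E \<longleftrightarrow> (\<forall>i. \<exists>j. E i j)"

definition clique :: "('v \<Rightarrow> 'v \<Rightarrow> bool) \<Rightarrow> 'v set \<Rightarrow> bool" where
  "clique E C \<longleftrightarrow> (\<forall>u\<in>C. \<forall>v\<in>C. u \<noteq> v \<longrightarrow> E u v)"

definition maximal_clique :: "('v \<Rightarrow> 'v \<Rightarrow> bool) \<Rightarrow> 'v set \<Rightarrow> bool" where
  "maximal_clique E C \<longleftrightarrow> clique E C \<and> (\<forall>C'. clique E C' \<and> C \<subseteq> C' \<longrightarrow> C' = C)"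

definition free_vertex :: "('v \<Rightarrow> 'v \<Rightarrow> bool) \<Rightarrow> 'v \<Rightarrow> bool" where
  "free_vertex E v \<longleftrightarrow> (\<exists>!C. maximal_clique E C \<and> v \<in> C)"

definition maximal_cliques_with_free_vertex :: "('v \<Rightarrow> 'v \<Rightarrow> bool) \<Rightarrow> 'v set set" where
  "maximal_cliques_with_free_vertex E = {C. maximal_clique E C \<and> (\<exists>v\<in>C. free_vertex E v)}"

definition tuple_dominating :: "('v \<Rightarrow> 'v \<Rightarrow> bool) \<Rightarrow> nat \<Rightarrow> 'v set \<Rightarrow> bool" where
  "tuple_dominating E h D \<longleftrightarrow> (\<forall>i. h \<le> card (closed_neighborhood E i \<inter> D))"

definition minimal_tuple_dominating :: "('v \<Rightarrow> 'v \<Rightarrow> bool) \<Rightarrow> nat \<Rightarrow> 'v set \<Rightarrow> bool" where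
  "minimal_tuple_dominating E h D \<longleftrightarrow>
     tuple_dominating E h D \<and> (\<forall>D'. D' \<subset> D \<longrightarrow> \<not> tuple_dominating E h D')"


section \<open>The polynomial ring and its ideals\<close>

text \<open>The polynomial ring \<open>S\<close> over \<open>'k\<close>, with one variable for every element of \<open>'v\<close>.\<close>

type_synonym ('v, 'k) mpoly = "('v \<Rightarrow>\<^sub>0 nat) \<Rightarrow>\<^sub>0 'k"

definition var :: "'v \<Rightarrow> ('v, 'k::comm_ring_1) mpoly" where
  "var i = Poly_Mapping.single (Poly_Mapping.single i 1) 1"

definition monomial_degree :: "('v::finite \<Rightarrow>\<^sub>0 nat) \<Rightarrow> nat" where
  "monomial_degree m = (\<Sum>i\<in>UNIV. Poly_Mapping.lookup m i)"

text \<open>Zero is homogeneous of every degree, and it is the only polynomial of negative degree.\<close>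

definition homogeneous_of_degree :: "int \<Rightarrow> ('v::finite, 'k::zero) mpoly \<Rightarrow> bool" where
  "homogeneous_of_degree d p \<longleftrightarrow> (\<forall>m\<in>Poly_Mapping.keys p. int (monomial_degree m) = d)"

text \<open>Ideals of a commutative ring are the submodules of the ring over itself.\<close>

definition is_ideal :: "'a::comm_ring_1 set \<Rightarrow> bool" where
  "is_ideal I \<longleftrightarrow> Modules.module.subspace (*) I"

definition ideal_generated :: "'a::comm_ring_1 set \<Rightarrow> 'a set" where
  "ideal_generated B = Modules.module.span (*) B"

definition prime_ideal :: "'a::comm_ring_1 set \<Rightarrow> bool" where
  "prime_ideal P \<longleftrightarrow> is_ideal P \<and> P \<noteq> UNIV \<and> (\<forall>a b. a * b \<in> P \<longrightarrow> a \<in> P \<or> b \<in> P)"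

definition graded_maximal_ideal :: "('v, 'k::comm_ring_1) mpoly set" where
  "graded_maximal_ideal = ideal_generated (range var)"

text \<open>The sum of the ideals in the definition is the ideal generated by all their generators.\<close>

definition neighborhood_ideal ::
  "('v::finite \<Rightarrow> 'v \<Rightarrow> bool) \<Rightarrow> ('v \<Rightarrow> nat) \<Rightarrow> ('v, 'k::field) mpoly set" where
  "neighborhood_ideal E k =
     ideal_generated (\<Union>i. {\<Prod>j\<in>W. var j | W. W \<subseteq> closed_neighborhood E i \<and> card W = k i})"


section \<open>Cohen-Macaulayness of \<open>S / I\<close>\<close>

text \<open>
  Quotients are described by the ideal \<open>I\<close>. The prime ideals of \<open>S / I\<close> are those of \<open>S\<close>
  containing \<open>I\<close>.
\<close>

definition krull_dim_quotient :: "'a::comm_ring_1 set \<Rightarrow> enat" where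
  "krull_dim_quotient I =
     Sup {enat m | m. \<exists>P :: nat \<Rightarrow> 'a set.
       (\<forall>i\<le>m. prime_ideal (P i) \<and> I \<subseteq> P i) \<and> (\<forall>i<m. P i \<subset> P (Suc i))}"

text \<open>
  \<open>f\<^sub>1, \<dots>, f\<^sub>s\<close> is \<open>S/I\<close>-regular: each \<open>f\<^sub>i\<close> is a nonzerodivisor on
  \<open>S/(I + (f\<^sub>1, \<dots>, f\<^bsub>i-1\<^esub>))\<close>, and \<open>S/(I + (f\<^sub>1, \<dots>, f\<^sub>s))\<close> is not zero.
\<close>

definition regular_sequence_on_quotient :: "'a::comm_ring_1 set \<Rightarrow> 'a list \<Rightarrow> bool" where
  "regular_sequence_on_quotient I fs \<longleftrightarrow>
     (\<forall>i<length fs. \<forall>g. fs ! i * g \<in> ideal_generated (I \<union> set (take i fs)) \<longrightarrow>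
        g \<in> ideal_generated (I \<union> set (take i fs))) \<and>
     ideal_generated (I \<union> set fs) \<noteq> UNIV"

definition depth_quotient :: "('v, 'k::field) mpoly set \<Rightarrow> enat" where
  "depth_quotient I =
     Sup {enat (length fs) | fs.
       set fs \<subseteq> graded_maximal_ideal \<and> regular_sequence_on_quotient I fs}"

text \<open>
  The graded notion, for a homogeneous ideal \<open>I\<close>: depth with respect to the graded maximal
  ideal equals Krull dimension.
\<close>

definition cohen_macaulay_quotient :: "('v, 'k::field) mpoly set \<Rightarrow> bool" where
  "cohen_macaulay_quotient I \<longleftrightarrow> depth_quotient I = krull_dim_quotient I"


section \<open>Graded free resolutions and regularity of \<open>S / I\<close>\<close>

text \<open>
  A graded free module \<open>F = \<Oplus>\<^sub>a S(-d\<^sub>a)\<close> of finite rank is given by the list \<open>d\<close> of the degrees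
  of its basis elements; its elements are column vectors over \<open>S\<close>. In a resolution
  \<open>\<dots> \<rightarrow> F\<^sub>2 \<rightarrow> F\<^sub>1 \<rightarrow> F\<^sub>0 \<rightarrow> S/I \<rightarrow> 0\<close> with \<open>F\<^sub>i\<close> given by the list \<open>d i\<close>, the matrix \<open>\<phi> i\<close> represents
  \<open>F\<^bsub>i+1\<^esub> \<rightarrow> F\<^sub>i\<close>, and the augmentation \<open>F\<^sub>0 \<rightarrow> S/I\<close> sends \<open>v\<close> to the class of \<open>\<epsilon> \<bullet> v\<close>.
  The conditions on entries say that all maps have degree 0.
\<close>

definition graded_free_resolution ::
  "('v::finite, 'k::field) mpoly set \<Rightarrow> (nat \<Rightarrow> int list) \<Rightarrow>
   ('v, 'k) mpoly vec \<Rightarrow> (nat \<Rightarrow> ('v, 'k) mpoly mat) \<Rightarrow> bool" where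
  "graded_free_resolution I d \<epsilon> \<phi> \<longleftrightarrow>
     \<epsilon> \<in> carrier_vec (length (d 0)) \<and>
     (\<forall>a<length (d 0). homogeneous_of_degree (d 0 ! a) (\<epsilon> $ a)) \<and>
     (\<forall>i. \<phi> i \<in> carrier_mat (length (d i)) (length (d (Suc i)))) \<and>
     (\<forall>i. \<forall>a<length (d i). \<forall>b<length (d (Suc i)).
        homogeneous_of_degree (d (Suc i) ! b - d i ! a) (\<phi> i $$ (a, b))) \<and>
     (\<forall>p. \<exists>v\<in>carrier_vec (length (d 0)). p - \<epsilon> \<bullet> v \<in> I) \<and>
     {v \<in> carrier_vec (length (d 0)). \<epsilon> \<bullet> v \<in> I} =
       (\<lambda>w. \<phi> 0 *\<^sub>v w) ` carrier_vec (length (d 1)) \<and>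
     (\<forall>i. mat_kernel (\<phi> i) =
       (\<lambda>w. \<phi> (Suc i) *\<^sub>v w) ` carrier_vec (length (d (Suc (Suc i)))))"

definition minimal_graded_free_resolution ::
  "('v::finite, 'k::field) mpoly set \<Rightarrow> (nat \<Rightarrow> int list) \<Rightarrow>
   ('v, 'k) mpoly vec \<Rightarrow> (nat \<Rightarrow> ('v, 'k) mpoly mat) \<Rightarrow> bool" where
  "minimal_graded_free_resolution I d \<epsilon> \<phi> \<longleftrightarrow>
     graded_free_resolution I d \<epsilon> \<phi> \<and>
     (\<forall>i. \<forall>a<length (d i). \<forall>b<length (d (Suc i)). \<phi> i $$ (a, b) \<in> graded_maximal_ideal)"

text \<open>
  The number of summands \<open>S(-j)\<close> of \<open>F\<^sub>i\<close> in a minimal graded free resolution of \<open>S/I\<close>. For a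
  homogeneous ideal \<open>I\<close> minimal graded free resolutions exist and are unique up to isomorphism,
  and only finitely many graded Betti numbers are nonzero.
\<close>

definition graded_betti :: "('v::finite, 'k::field) mpoly set \<Rightarrow> nat \<Rightarrow> int \<Rightarrow> nat" where
  "graded_betti I i j =
     (THE b. \<exists>d \<epsilon> \<phi>. minimal_graded_free_resolution I d \<epsilon> \<phi> \<and> count_list (d i) j = b)"

definition regularity_quotient :: "('v::finite, 'k::field) mpoly set \<Rightarrow> int" where
  "regularity_quotient I = Max {j - int i | i j. graded_betti I i j \<noteq> 0}"

end

theory Submission
  imports Defs
begin

text \<open>
  Let \<open>C\<close> be a maximal clique with a free vertex \<open>f\<close>. Then \<open>C = N[f]\<close>, and \<open>C \<subseteq> N[i]\<close> for every
  \<open>i \<in> C\<close>. A set of \<open>|N[i]| - l\<close> elements of \<open>N[i]\<close> leaves out only \<open>l\<close> of them, so it contains at least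
  \<open>|C| - l\<close> elements of \<open>C\<close>; its monomial is therefore a multiple of a generator that comes from \<open>f\<close>.
  As the cliques \<open>C\<close> partition the vertices, \<open>NI\<^bsub>k\<^esub>(G)\<close> is the Stanley-Reisner ideal of the complex
  \<open>\<Delta>\<close> of all \<open>F\<close> with \<open>|F \<inter> C| \<le> q\<^sub>C\<close> for every \<open>C\<close>, where \<open>q\<^sub>C = |C| - l - 1\<close>
  (\<open>neighborhood_ideal_eq\<close>). This \<open>\<Delta>\<close> is the independence complex of a partition matroid of rank
  \<open>q = \<Sum>\<^sub>C q\<^sub>C = n - r(l + 1)\<close>. In the same way a set is \<open>h\<close>-tuple dominating iff it contains at least \<open>h\<close>
  elements of each \<open>C\<close>, so that a minimal one contains exactly \<open>h\<close> of each
  (\<open>card_minimal_tuple_dominating\<close>).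

  For Cohen-Macaulayness, a regular sequence and a strictly increasing chain of primes both provide
  polynomials \<open>f\<^sub>1, \<dots>, f\<^sub>s\<close> and growing proper ideals \<open>A\<^sub>0 \<subseteq> A\<^sub>1 \<subseteq> \<dots>\<close> such that \<open>f\<^sub>i \<in> A\<^sub>i\<close> is a
  nonzerodivisor modulo \<open>A\<^bsub>i-1\<^esub>\<close>. Such \<open>f\<^sub>i\<close> are algebraically independent modulo the ideal, and
  comparing the number of their power products with the number of monomials supported on faces gives
  \<open>s \<le> q\<close> (\<open>nzd_chain_length_le\<close>); this bounds depth and dimension at once. The coordinate primes
  of the subsets of a facet give dimension at least \<open>q\<close>. For the depth, the elementary symmetric polynomials
  \<open>e\<^sub>q, \<dots>, e\<^sub>1\<close> in all the variables form a regular sequence on \<open>S/I\<^sub>\<Delta>\<close> for every vertex decomposable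
  \<open>\<Delta>\<close> with facets of size \<open>q\<close> (\<open>regular_on_esyms\<close>), over any field, and matroid complexes are vertex
  decomposable.

  For the regularity, add the minimal nonfaces of \<open>\<Delta>\<close> one at a time, clique by clique; each colon ideal is then
  generated by variables of the current clique and by the ideals of the previous cliques. Iterated
  mapping cones (\<open>mapping_cone\<close>) thus produce a multigraded free resolution of \<open>S/I\<^sub>\<Delta>\<close>. In it the
  homological degree of a generator is a function of its multidegree \<open>m\<close>, namely
  \<open>\<Sum>\<^sub>C max 0 (deg\<^sub>C m - q\<^sub>C)\<close> (\<open>resolvable_partition_complex\<close>). No entry of a differential
  can therefore be a unit, so the resolution is minimal; and the degree minus the homological degree of a
  generator is \<open>\<Sum>\<^sub>C min (deg\<^sub>C m) q\<^sub>C\<close>, with maximum \<open>q\<close>. That these generators compute the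
  graded Betti numbers is the uniqueness of minimal resolutions (\<open>graded_betti_eq\<close>).
\<close>

section \<open>Ideals\<close>

lemma module_times: "Modules.module ((*) :: 'a::comm_ring_1 \<Rightarrow> 'a \<Rightarrow> 'a)"
  by unfold_locales (simp_all add: algebra_simps)

lemma is_ideal_iff:
  "is_ideal I \<longleftrightarrow> 0 \<in> I \<and> (\<forall>a\<in>I. \<forall>b\<in>I. a + b \<in> I) \<and> (\<forall>c. \<forall>a\<in>I. c * a \<in> I)"
  unfolding is_ideal_def Modules.module.subspace_def[OF module_times] by simp

lemma is_ideal_add: "is_ideal I \<Longrightarrow> a \<in> I \<Longrightarrow> b \<in> I \<Longrightarrow> a + b \<in> I"
  and is_ideal_mult: "is_ideal I \<Longrightarrow> a \<in> I \<Longrightarrow> c * a \<in> I"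
  and is_ideal_zero: "is_ideal I \<Longrightarrow> 0 \<in> I"
  by (simp_all add: is_ideal_iff)

lemma is_ideal_uminus: "is_ideal I \<Longrightarrow> a \<in> I \<Longrightarrow> - a \<in> I"
  using is_ideal_mult[of I a "-1"] by simp

lemma is_ideal_diff: "is_ideal I \<Longrightarrow> a \<in> I \<Longrightarrow> b \<in> I \<Longrightarrow> a - b \<in> I"
  using is_ideal_add[of I a "- b"] is_ideal_uminus[of I b] by simp

lemma is_ideal_sum: "is_ideal I \<Longrightarrow> (\<And>x. x \<in> X \<Longrightarrow> f x \<in> I) \<Longrightarrow> sum f X \<in> I"
  by (induction X rule: infinite_finite_induct) (auto intro: is_ideal_add is_ideal_zero)

lemma is_ideal_generated: "is_ideal (ideal_generated B)"
  unfolding is_ideal_def ideal_generated_def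
  by (rule Modules.module.subspace_span[OF module_times])

lemma ideal_generated_superset: "B \<subseteq> ideal_generated B"
  unfolding ideal_generated_def by (rule Modules.module.span_superset[OF module_times])

lemma ideal_generated_least: "is_ideal I \<Longrightarrow> B \<subseteq> I \<Longrightarrow> ideal_generated B \<subseteq> I"
  unfolding ideal_generated_def is_ideal_def by (rule Modules.module.span_minimal[OF module_times])

lemma ideal_generated_ideal: "is_ideal I \<Longrightarrow> ideal_generated I = I"
  by (simp add: ideal_generated_least ideal_generated_superset subset_antisym)

lemma ideal_generated_mono: "A \<subseteq> B \<Longrightarrow> ideal_generated A \<subseteq> ideal_generated B"
  by (meson ideal_generated_least is_ideal_generated ideal_generated_superset order_trans)

definition ideal_add :: "'a::comm_ring_1 set \<Rightarrow> 'a \<Rightarrow> 'a set" where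
  "ideal_add I f = {a + f * g | a g. a \<in> I}"

definition colon :: "'a::comm_ring_1 set \<Rightarrow> 'a \<Rightarrow> 'a set" where
  "colon I f = {g. f * g \<in> I}"

lemma is_ideal_ideal_add: 
  assumes "is_ideal I" shows "is_ideal (ideal_add I f)"
  unfolding is_ideal_iff
proof (intro conjI ballI allI)
  show "0 \<in> ideal_add I f"
    using is_ideal_zero[OF assms] unfolding ideal_add_def by (intro CollectI exI[of _ 0]) auto
next
  fix x y assume "x \<in> ideal_add I f" "y \<in> ideal_add I f"
  then obtain a g b h where "x = a + f * g" "y = b + f * h" "a \<in> I" "b \<in> I"
    unfolding ideal_add_def by auto
  then show "x + y \<in> ideal_add I f"
    using is_ideal_add[OF assms] unfolding ideal_add_def
    by (intro CollectI exI[of _ "a + b"] exI[of _ "g + h"]) (auto simp: algebra_simps)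
next
  fix c x assume "x \<in> ideal_add I f"
  then obtain a g where "x = a + f * g" "a \<in> I" unfolding ideal_add_def by auto
  then show "c * x \<in> ideal_add I f"
    using is_ideal_mult[OF assms] unfolding ideal_add_def
    by (intro CollectI exI[of _ "c * a"] exI[of _ "c * g"]) (auto simp: algebra_simps)
qed

lemma ideal_add_superset: "I \<subseteq> ideal_add I f"
proof
  fix a assume "a \<in> I"
  then show "a \<in> ideal_add I f"
    unfolding ideal_add_def by (intro CollectI exI[of _ a] exI[of _ 0]) simp
qed

lemma ideal_add_self: "is_ideal I \<Longrightarrow> f \<in> ideal_add I f"
  unfolding ideal_add_def by (intro CollectI exI[of _ 0] exI[of _ 1]) (simp add: is_ideal_zero)

lemma ideal_add_eq:
  assumes "is_ideal I"
  shows "ideal_add I f = ideal_generated (insert f I)"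
proof
  have "a + f * g \<in> ideal_generated (insert f I)" if "a \<in> I" for a g
  proof -
    have "a \<in> ideal_generated (insert f I)" "f \<in> ideal_generated (insert f I)"
      using that ideal_generated_superset by blast+
    then show ?thesis
      using is_ideal_add is_ideal_mult is_ideal_generated by (metis mult.commute)
  qed
  then show "ideal_add I f \<subseteq> ideal_generated (insert f I)" unfolding ideal_add_def by auto
  show "ideal_generated (insert f I) \<subseteq> ideal_add I f"
    using ideal_add_superset[of I f] ideal_add_self[OF assms]
    by (intro ideal_generated_least is_ideal_ideal_add assms) auto
qed

lemma ideal_generated_Un:
  "ideal_generated (ideal_generated A \<union> B) = ideal_generated (A \<union> B)"
proof
  show "ideal_generated (ideal_generated A \<union> B) \<subseteq> ideal_generated (A \<union> B)"
    using ideal_generated_mono[of A "A \<union> B"] ideal_generated_superset[of "A \<union> B"]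
    by (intro ideal_generated_least is_ideal_generated) auto
  show "ideal_generated (A \<union> B) \<subseteq> ideal_generated (ideal_generated A \<union> B)"
    using ideal_generated_superset[of A] by (intro ideal_generated_mono) auto
qed

section \<open>Monomials and Stanley-Reisner ideals\<close>

lift_definition filter_terms :: "('a \<Rightarrow> bool) \<Rightarrow> ('a \<Rightarrow>\<^sub>0 'b::zero) \<Rightarrow> ('a \<Rightarrow>\<^sub>0 'b)"
  is "\<lambda>Q f x. if Q x then f x else 0"
  by (rule finite_subset[rotated]) auto

lemma lookup_filter_terms: "Poly_Mapping.lookup (filter_terms Q p) m = (if Q m then Poly_Mapping.lookup p m else 0)"
  by transfer simp

lemma keys_filter_terms: "Poly_Mapping.keys (filter_terms Q p) = {m \<in> Poly_Mapping.keys p. Q m}"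
  by (auto simp: in_keys_iff lookup_filter_terms split: if_splits)

lemma filter_terms_add: "filter_terms Q (p + q) = filter_terms Q p + filter_terms Q q"
  by (rule poly_mapping_eqI) (simp add: lookup_filter_terms lookup_add)

lemma filter_terms_zero [simp]: "filter_terms Q 0 = 0"
  by (rule poly_mapping_eqI) (simp add: lookup_filter_terms)

lemma filter_terms_sum: "filter_terms Q (sum f X) = (\<Sum>x\<in>X. filter_terms Q (f x))"
  by (induction X rule: infinite_finite_induct) (auto simp: filter_terms_add)

lemma filter_terms_id: "(\<And>m. m \<in> Poly_Mapping.keys p \<Longrightarrow> Q m) \<Longrightarrow> filter_terms Q p = p"
  by (rule poly_mapping_eqI) (auto simp: lookup_filter_terms in_keys_iff)

lemma filter_terms_none: "(\<And>m. m \<in> Poly_Mapping.keys p \<Longrightarrow> \<not> Q m) \<Longrightarrow> filter_terms Q p = 0"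
  by (rule poly_mapping_eqI) (auto simp: lookup_filter_terms in_keys_iff)

lemma filter_terms_split: "(p :: _ \<Rightarrow>\<^sub>0 'b::monoid_add) = filter_terms Q p + filter_terms (\<lambda>m. \<not> Q m) p"
  by (rule poly_mapping_eqI) (simp add: lookup_filter_terms lookup_add)

text \<open>
  A homogeneous component of \<open>p * q\<close> with \<open>p\<close> homogeneous is \<open>p\<close> times a homogeneous component of \<open>q\<close>.
  The predicates \<open>Q\<close> and \<open>Q'\<close> stand for "has the given degree".
\<close>

lemma filter_terms_mult:
  fixes p q :: "'a::comm_monoid_add \<Rightarrow>\<^sub>0 'b::comm_ring_1"
  assumes "\<And>m m'. m \<in> Poly_Mapping.keys p \<Longrightarrow> Q (m + m') \<longleftrightarrow> Q' m'"
  shows "filter_terms Q (p * q) = p * filter_terms Q' q"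
proof -
  have "filter_terms Q (p * filter_terms Q' q) = p * filter_terms Q' q"
    using keys_mult[of p "filter_terms Q' q"] assms
    by (intro filter_terms_id) (auto simp: keys_filter_terms)
  moreover have "filter_terms Q (p * filter_terms (\<lambda>m. \<not> Q' m) q) = 0"
    using keys_mult[of p "filter_terms (\<lambda>m. \<not> Q' m) q"] assms
    by (intro filter_terms_none) (auto simp: keys_filter_terms)
  ultimately show ?thesis
    by (subst filter_terms_split[of q Q']) (simp add: distrib_left filter_terms_add)
qed

lemma sum_single_lookup: "(\<Sum>m\<in>Poly_Mapping.keys p. Poly_Mapping.single m (Poly_Mapping.lookup p m)) = p"
proof (rule poly_mapping_eqI)
  fix k
  show "Poly_Mapping.lookup (\<Sum>m\<in>Poly_Mapping.keys p. Poly_Mapping.single m (Poly_Mapping.lookup p m)) k = Poly_Mapping.lookup p k"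
    by (cases "k \<in> Poly_Mapping.keys p")
      (auto simp: lookup_sum lookup_single when_def sum.delta in_keys_iff)
qed

lemma single_mult_eq_sum:
  fixes p :: "'a::comm_monoid_add \<Rightarrow>\<^sub>0 'b::comm_ring_1"
  shows "Poly_Mapping.single u c * p = (\<Sum>m\<in>Poly_Mapping.keys p. Poly_Mapping.single (u + m) (c * Poly_Mapping.lookup p m))"
  by (subst sum_single_lookup[of p, symmetric]) (simp only: sum_distrib_left mult_single)

lemma lookup_single_mult:
  fixes p :: "'a::cancel_comm_monoid_add \<Rightarrow>\<^sub>0 'b::comm_ring_1"
  shows "Poly_Mapping.lookup (Poly_Mapping.single u c * p) (u + m) = c * Poly_Mapping.lookup p m"
  by (cases "m \<in> Poly_Mapping.keys p")
    (auto simp: single_mult_eq_sum lookup_sum lookup_single when_def sum.delta in_keys_iff)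

lemma keys_single_mult:
  fixes p :: "'a::cancel_comm_monoid_add \<Rightarrow>\<^sub>0 'b::idom"
  assumes "c \<noteq> 0"
  shows "Poly_Mapping.keys (Poly_Mapping.single u c * p) = (+) u ` Poly_Mapping.keys p"
proof
  show "Poly_Mapping.keys (Poly_Mapping.single u c * p) \<subseteq> (+) u ` Poly_Mapping.keys p"
    using keys_mult[of "Poly_Mapping.single u c" p] assms by auto
  show "(+) u ` Poly_Mapping.keys p \<subseteq> Poly_Mapping.keys (Poly_Mapping.single u c * p)"
    using assms by (auto simp: in_keys_iff lookup_single_mult)
qed

definition sqfree :: "'v::finite set \<Rightarrow> 'v \<Rightarrow>\<^sub>0 nat" where
  "sqfree U = (\<Sum>v\<in>U. Poly_Mapping.single v 1)"

abbreviation xmon :: "'v::finite set \<Rightarrow> ('v, 'k::comm_ring_1) mpoly" where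
  "xmon U \<equiv> Poly_Mapping.single (sqfree U) 1"

lemma lookup_sqfree: "Poly_Mapping.lookup (sqfree U) v = (if v \<in> U then 1 else 0)"
  by (auto simp: sqfree_def lookup_sum lookup_single when_def sum.delta)

lemma prod_var_eq: "(\<Prod>j\<in>W. var j) = xmon W"
proof (induction W rule: finite_induct[OF finite])
  case 1 then show ?case by (simp add: sqfree_def)
next
  case (2 x F) then show ?case by (simp add: sqfree_def var_def mult_single)
qed

lemma keys_add_nat: "Poly_Mapping.keys (m + m' :: 'v \<Rightarrow>\<^sub>0 nat) = Poly_Mapping.keys m \<union> Poly_Mapping.keys m'"
  by (auto simp: in_keys_iff lookup_add)

lemma keys_sqfree: "Poly_Mapping.keys (sqfree U) = U"
  by (auto simp: in_keys_iff lookup_sqfree split: if_splits)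

lemma sqfree_divides:
  assumes "U \<subseteq> Poly_Mapping.keys m" shows "\<exists>m'. m = sqfree U + m'"
proof
  show "m = sqfree U + (m - sqfree U)"
  proof (rule poly_mapping_eqI)
    fix v show "Poly_Mapping.lookup m v = Poly_Mapping.lookup (sqfree U + (m - sqfree U)) v"
      using assms in_keys_iff[of v m] by (auto simp: lookup_add lookup_minus lookup_sqfree)
  qed
qed

definition down_closed :: "'v set set \<Rightarrow> bool" where
  "down_closed \<Delta> \<longleftrightarrow> (\<forall>F\<in>\<Delta>. \<forall>G. G \<subseteq> F \<longrightarrow> G \<in> \<Delta>)"

text \<open>
  The ideal is described by the supports of its monomials and not by generators, because colon ideals by
  monomials and sums with monomials then become operations on the set \<open>\<Delta>\<close> of faces.
\<close>

definition stanley_reisner :: "'v::finite set set \<Rightarrow> ('v, 'k::field) mpoly set" where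
  "stanley_reisner \<Delta> = {p. \<forall>m\<in>Poly_Mapping.keys p. Poly_Mapping.keys m \<notin> \<Delta>}"

lemma is_ideal_stanley_reisner:
  assumes "down_closed \<Delta>" shows "is_ideal (stanley_reisner \<Delta>)"
  unfolding is_ideal_iff stanley_reisner_def
proof (intro conjI ballI allI CollectI, goal_cases)
  case (2 a b m) then show ?case using Poly_Mapping.keys_add[of a b] by auto
next
  case (3 c a m)
  then obtain m1 m2 where "m = m1 + m2" "m2 \<in> Poly_Mapping.keys a" using keys_mult[of c a] by blast
  with 3 have "Poly_Mapping.keys m2 \<notin> \<Delta>" "Poly_Mapping.keys m2 \<subseteq> Poly_Mapping.keys m"
    by (auto simp: keys_add_nat)
  with assms show ?case unfolding down_closed_def by blast
qed auto

text \<open>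
  The new complex is the star of \<open>U\<close>, on the same vertex set, rather than its link. All complexes
  below live on all of \<open>'v\<close>, which keeps a single polynomial ring.
\<close>

lemma colon_stanley_reisner:
  "colon (stanley_reisner \<Delta>) (xmon U) = stanley_reisner {F. F \<union> U \<in> \<Delta>}"
  by (auto simp: colon_def stanley_reisner_def keys_single_mult keys_add_nat keys_sqfree Un_commute)

text \<open>
  The nontrivial inclusion holds monomial by monomial: a monomial whose support is not in the
  new complex has its support outside \<open>\<Delta>\<close> or is divisible by the monomial of \<open>U\<close>.
\<close>

lemma ideal_add_stanley_reisner:
  assumes "down_closed \<Delta>"
  shows "ideal_add (stanley_reisner \<Delta>) (xmon U) = (stanley_reisner {F \<in> \<Delta>. \<not> U \<subseteq> F} :: ('v::finite, 'k::field) mpoly set)"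
    (is "?L = ?R")
proof
  have dc: "down_closed {F \<in> \<Delta>. \<not> U \<subseteq> F}" using assms unfolding down_closed_def by blast
  have "insert (xmon U) (stanley_reisner \<Delta>) \<subseteq> ?R"
    by (auto simp: stanley_reisner_def keys_sqfree)
  then show "?L \<subseteq> ?R"
    by (simp add: ideal_add_eq is_ideal_stanley_reisner assms dc ideal_generated_least)
  show "?R \<subseteq> ?L"
  proof
    fix p :: "('v, 'k) mpoly" assume p: "p \<in> ?R"
    let ?I = "ideal_add (stanley_reisner \<Delta>) (xmon U) :: ('v, 'k) mpoly set"
    have I: "is_ideal ?I" by (intro is_ideal_ideal_add is_ideal_stanley_reisner assms)
    have "Poly_Mapping.single m c \<in> ?I" if "m \<in> Poly_Mapping.keys p" for m c
    proof (cases "U \<subseteq> Poly_Mapping.keys m")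
      case True
      then obtain m' where m': "m = sqfree U + m'" using sqfree_divides by blast
      then have "Poly_Mapping.single m c = Poly_Mapping.single m' c * xmon U" 
        by (simp add: mult_single add.commute)
      then show ?thesis using I is_ideal_mult ideal_add_self is_ideal_stanley_reisner assms by metis
    next
      case False
      with that p have "Poly_Mapping.single m c \<in> (stanley_reisner \<Delta> :: ('v, 'k) mpoly set)"
        by (auto simp: stanley_reisner_def split: if_splits)
      then show ?thesis using ideal_add_superset by blast
    qed
    then have "(\<Sum>m\<in>Poly_Mapping.keys p. Poly_Mapping.single m (Poly_Mapping.lookup p m)) \<in> ?I"
      by (intro is_ideal_sum I) 
    then show "p \<in> ?L" by (simp add: sum_single_lookup)
  qed
qed

lemma stanley_reisner_ne_UNIV: "{} \<in> \<Delta> \<Longrightarrow> stanley_reisner \<Delta> \<noteq> (UNIV :: ('v::finite, 'k::field) mpoly set)"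
proof -
  assume "{} \<in> \<Delta>"
  then have "1 \<notin> (stanley_reisner \<Delta> :: ('v, 'k) mpoly set)" by (simp add: stanley_reisner_def)
  then show ?thesis by blast
qed

lemma graded_maximal_ideal_iff:
  "(p :: ('v::finite, 'k::field) mpoly) \<in> graded_maximal_ideal \<longleftrightarrow> Poly_Mapping.lookup p 0 = 0"
proof
  have var: "var i = xmon {i}" for i :: 'v by (simp add: var_def sqfree_def)
  have eq: "stanley_reisner {{}} = {p :: ('v, 'k) mpoly. Poly_Mapping.lookup p 0 = 0}"
    by (auto simp: stanley_reisner_def in_keys_iff)
  have I: "is_ideal (stanley_reisner {{}} :: ('v, 'k) mpoly set)"
    by (rule is_ideal_stanley_reisner) (simp add: down_closed_def)
  have "range var \<subseteq> (stanley_reisner {{}} :: ('v, 'k) mpoly set)"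
    by (auto simp: var stanley_reisner_def keys_sqfree simp flip: keys_eq_empty)
  then have "graded_maximal_ideal \<subseteq> (stanley_reisner {{}} :: ('v, 'k) mpoly set)"
    unfolding graded_maximal_ideal_def by (intro ideal_generated_least I)
  then show "p \<in> graded_maximal_ideal \<Longrightarrow> Poly_Mapping.lookup p 0 = 0" using eq by auto
  assume p: "Poly_Mapping.lookup p 0 = 0"
  have "Poly_Mapping.single m c \<in> (graded_maximal_ideal :: ('v, 'k) mpoly set)" if m: "m \<in> Poly_Mapping.keys p" for m c
  proof -
    from m p have "m \<noteq> 0" by (auto simp: in_keys_iff)
    then have "Poly_Mapping.keys m \<noteq> {}" by simp
    then obtain v where "{v} \<subseteq> Poly_Mapping.keys m" by blast
    then obtain m' where m': "m = sqfree {v} + m'" using sqfree_divides by blast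
    then have "Poly_Mapping.single m c = Poly_Mapping.single m' c * var v" 
      by (simp add: mult_single add.commute var)
    moreover have "var v \<in> (graded_maximal_ideal :: ('v, 'k) mpoly set)"
      unfolding graded_maximal_ideal_def using ideal_generated_superset by blast
    ultimately show ?thesis
      unfolding graded_maximal_ideal_def by (simp only: is_ideal_mult[OF is_ideal_generated])
  qed
  then have "(\<Sum>m\<in>Poly_Mapping.keys p. Poly_Mapping.single m (Poly_Mapping.lookup p m)) \<in> graded_maximal_ideal"
    unfolding graded_maximal_ideal_def by (intro is_ideal_sum is_ideal_generated)
  then show "p \<in> graded_maximal_ideal" by (simp add: sum_single_lookup)
qed

section \<open>Regular sequences\<close>

text \<open>
  Quotients are taken one element at a time, which makes induction on the sequence possible.
\<close>

fun regular_on :: "'a::comm_ring_1 set \<Rightarrow> 'a list \<Rightarrow> bool" where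
  "regular_on I [] \<longleftrightarrow> I \<noteq> UNIV"
| "regular_on I (f # fs) \<longleftrightarrow> (\<forall>g. f * g \<in> I \<longrightarrow> g \<in> I) \<and> regular_on (ideal_add I f) fs"

lemma regular_sequence_on_quotient_iff:
  assumes "is_ideal I"
  shows "regular_sequence_on_quotient I fs \<longleftrightarrow> regular_on I fs"
  using assms
proof (induction fs arbitrary: I)
  case Nil
  then show ?case by (simp add: regular_sequence_on_quotient_def ideal_generated_ideal)
next
  case (Cons f fs)
  have gen: "ideal_generated (insert f (I \<union> B)) = ideal_generated (ideal_add I f \<union> B)" for B
    by (simp add: ideal_add_eq Cons.prems ideal_generated_Un)
  show ?case
    using Cons.IH[OF is_ideal_ideal_add[OF Cons.prems]] Cons.prems
    by (simp add: regular_sequence_on_quotient_def All_less_Suc2 gen ideal_generated_ideal conj_assoc)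
qed

lemma ideal_add_commute: "ideal_add (ideal_add I f) u = ideal_add (ideal_add I u) f"
proof -
  have "ideal_add (ideal_add I f) u \<subseteq> ideal_add (ideal_add I u) f" for f u :: 'a
  proof
    fix x assume "x \<in> ideal_add (ideal_add I f) u"
    then obtain a g h where "x = (a + f * g) + u * h" "a \<in> I" by (auto simp: ideal_add_def)
    then have "x = (a + u * h) + f * g" "a + u * h \<in> ideal_add I u"
      by (auto simp: ideal_add_def algebra_simps)
    then show "x \<in> ideal_add (ideal_add I u) f" unfolding ideal_add_def[of "ideal_add I u"] by blast
  qed
  then show ?thesis by blast
qed

lemma ideal_add_cong:
  assumes "is_ideal I" "f - f' \<in> I"
  shows "ideal_add I f = ideal_add I f'"
proof -
  have *: "ideal_add I f \<subseteq> ideal_add I f'" if "f - f' \<in> I" for f f'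
  proof -
    have "f' + (f - f') \<in> ideal_add I f'"
      using that ideal_add_superset ideal_add_self assms(1)
      by (intro is_ideal_add is_ideal_ideal_add) blast+
    then show ?thesis
      unfolding ideal_add_eq[OF assms(1), of f] using ideal_add_superset
      by (intro ideal_generated_least is_ideal_ideal_add assms) auto
  qed
  moreover have "f' - f \<in> I" using is_ideal_uminus[OF assms] by simp
  ultimately show ?thesis using assms(2) by blast
qed

text \<open>
  The exact sequence \<open>0 \<rightarrow> S/(I : u) \<rightarrow> S/I \<rightarrow> S/(I + (u)) \<rightarrow> 0\<close> at work: a sequence that is regular on
  both ends is regular in the middle. The first element \<open>f\<close> of the sequence is a nonzerodivisor on
  \<open>S/(I + (u))\<close>, so the sequence stays exact modulo \<open>f\<close>, that is, \<open>(I + (f)) : u = (I : u) + (f)\<close>.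
\<close>

lemma regular_on_colon_add:
  assumes "is_ideal I" "regular_on (colon I u) fs" "regular_on (ideal_add I u) fs"
  shows "regular_on I fs"
  using assms
proof (induction fs arbitrary: I)
  case Nil
  then show ?case using ideal_add_superset[of I u] by auto
next
  case (Cons f fs)
  note I = Cons.prems(1)
  have colon: "f * g \<in> colon I u \<Longrightarrow> g \<in> colon I u" for g using Cons.prems by simp
  have add: "f * g \<in> ideal_add I u \<Longrightarrow> g \<in> ideal_add I u" for g using Cons.prems by simp
  have nzd: "g \<in> I" if "f * g \<in> I" for g
  proof -
    have "g \<in> ideal_add I u" using add[of g] that ideal_add_superset[of I u] by blast
    then obtain a c where g: "g = a + u * c" "a \<in> I" unfolding ideal_add_def by auto
    have "u * (f * c) = f * g - f * a" using g by (simp add: algebra_simps)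
    also have "\<dots> \<in> I" by (rule is_ideal_diff[OF I that is_ideal_mult[OF I g(2)]])
    finally have "c \<in> colon I u" using colon[of c] by (simp add: colon_def)
    then show ?thesis using g I is_ideal_add by (simp add: colon_def)
  qed
  have eq: "colon (ideal_add I f) u = ideal_add (colon I u) f"
  proof
    show "ideal_add (colon I u) f \<subseteq> colon (ideal_add I f) u"
    proof
      fix x assume "x \<in> ideal_add (colon I u) f"
      then obtain a g where "x = a + f * g" "u * a \<in> I" by (auto simp: ideal_add_def colon_def)
      then have "u * x = u * a + f * (u * g)" "u * a \<in> I" by (auto simp: algebra_simps)
      then show "x \<in> colon (ideal_add I f) u" unfolding ideal_add_def colon_def by blast
    qed
    show "colon (ideal_add I f) u \<subseteq> ideal_add (colon I u) f"
    proof
      fix g assume "g \<in> colon (ideal_add I f) u"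
      then obtain a b where ab: "u * g = a + f * b" "a \<in> I" by (auto simp: colon_def ideal_add_def)
      have "f * b = - a + u * g" "- a \<in> I" using ab is_ideal_uminus[OF I] by simp_all
      then have "f * b \<in> ideal_add I u" unfolding ideal_add_def by blast
      then have "b \<in> ideal_add I u" by (rule add)
      then obtain a' c where b: "b = a' + u * c" "a' \<in> I" by (auto simp: ideal_add_def)
      have "u * (g - f * c) = a + f * a'" using ab b by (simp add: algebra_simps)
      then have "g - f * c \<in> colon I u"
        using ab b I by (simp add: colon_def is_ideal_add is_ideal_mult)
      then show "g \<in> ideal_add (colon I u) f"
        unfolding ideal_add_def by (intro CollectI exI[of _ "g - f * c"] exI[of _ c]) simp
    qed
  qed
  have "regular_on (ideal_add I f) fs"
  proof (rule Cons.IH)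
    show "is_ideal (ideal_add I f)" by (rule is_ideal_ideal_add[OF I])
    show "regular_on (colon (ideal_add I f) u) fs" using Cons.prems(2) by (simp add: eq)
    show "regular_on (ideal_add (ideal_add I f) u) fs"
      using Cons.prems(3) by (simp add: ideal_add_commute[of I f u])
  qed
  then show ?case using nzd by simp
qed

section \<open>Vertex decomposable complexes and matroids\<close>

text \<open>
  The sets \<open>{F. insert v F \<in> \<Delta>}\<close> and \<open>{F \<in> \<Delta>. v \<notin> F}\<close> are the star and the deletion of \<open>v\<close>. The star
  is a cone over the link, and using it instead of the link keeps the size \<open>D\<close> of the facets.
\<close>

inductive vertex_decomposable :: "nat \<Rightarrow> 'v set set \<Rightarrow> bool" where
  simplex: "card F = D \<Longrightarrow> vertex_decomposable D (Pow F)"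
| shed: "down_closed \<Delta> \<Longrightarrow> vertex_decomposable D {F. insert v F \<in> \<Delta>} \<Longrightarrow>
    vertex_decomposable D {F \<in> \<Delta>. v \<notin> F} \<Longrightarrow> vertex_decomposable D \<Delta>"

definition matroid_complex :: "'v set set \<Rightarrow> bool" where
  "matroid_complex \<Delta> \<longleftrightarrow> down_closed \<Delta> \<and> 
     (\<forall>F\<in>\<Delta>. \<forall>G\<in>\<Delta>. card F < card G \<longrightarrow> (\<exists>v\<in>G - F. insert v F \<in> \<Delta>))"

lemma matroid_extend:
  fixes \<Delta> :: "'v::finite set set"
  assumes "matroid_complex \<Delta>" "P \<in> \<Delta>" "F \<in> \<Delta>" "card F \<le> card P"
  shows "\<exists>Q\<in>\<Delta>. F \<subseteq> Q \<and> Q \<subseteq> F \<union> P \<and> card Q = card P"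
  using assms(3,4)
proof (induction "card P - card F" arbitrary: F)
  case 0 then show ?case by auto
next
  case (Suc n)
  then have "card F < card P" by simp
  then obtain v where v: "v \<in> P - F" "insert v F \<in> \<Delta>"
    using assms(1,2) Suc.prems unfolding matroid_complex_def by blast
  with Suc.hyps(2) have "n = card P - card (insert v F)" "card (insert v F) \<le> card P" by simp_all
  with Suc.hyps(1) v obtain Q where "Q \<in> \<Delta>" "insert v F \<subseteq> Q" "Q \<subseteq> insert v F \<union> P" "card Q = card P"
    by blast
  then show ?case using v by blast
qed

text \<open>
  Contract a set \<open>B\<close> and delete a set \<open>A\<close>, keeping a facet that contains \<open>B\<close> and avoids \<open>A\<close>. If an
  undecided vertex lies in some of these facets but not in all of them, it is shed. Otherwise it is
  a coloop or a loop, and since every face extends to a facet by augmentation, contracting or deleting it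
  does not change the complex. When all vertices are decided, the simplex on \<open>B\<close> remains.
\<close>

lemma matroid_vertex_decomposable:
  fixes \<Delta> :: "'v::finite set set"
  assumes mat: "matroid_complex \<Delta>" and rank: "\<And>F. F \<in> \<Delta> \<Longrightarrow> card F \<le> D"
    and facet: "P \<in> \<Delta>" "card P = D"
  shows "vertex_decomposable D \<Delta>"
proof -
  have dc: "G \<in> \<Delta>" if "F \<in> \<Delta>" "G \<subseteq> F" for F G
    using mat that unfolding matroid_complex_def down_closed_def by blast
  \<comment> \<open>The star of \<open>B\<close> in the deletion of \<open>A\<close>.\<close>
  define M where "M A B = {F. F \<inter> A = {} \<and> F \<union> B \<in> \<Delta>}" for A B
  have "vertex_decomposable D (M A B)"
    if "A \<inter> B = {}" "P \<in> \<Delta>" "card P = D" "B \<subseteq> P" "P \<inter> A = {}" for A B P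
    using that
  proof (induction "card (- (A \<union> B))" arbitrary: A B P)
    case 0
    then have AB: "A = - B" by (auto simp: card_eq_0_iff)
    with 0 have "P = B" by blast
    moreover have "M A B = Pow B" 
      using AB \<open>P = B\<close> 0 by (auto simp: M_def Un_absorb1)
    ultimately show ?case using 0 simplex by metis
  next
    case (Suc n)
    then have "- (A \<union> B) \<noteq> {}" by (metis card.empty nat.distinct(1))
    then obtain v where v: "v \<notin> A" "v \<notin> B" by blast
    have n: "n = card (- (insert v A \<union> B))" "n = card (- (A \<union> insert v B))"
    proof -
      have "- (insert v A \<union> B) = - (A \<union> B) - {v}" "- (A \<union> insert v B) = - (A \<union> B) - {v}" by auto
      then show "n = card (- (insert v A \<union> B))" "n = card (- (A \<union> insert v B))"
        using Suc.hyps(2) v by simp_all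
    qed
    let ?facet = "\<lambda>Q. Q \<in> \<Delta> \<and> card Q = D \<and> B \<subseteq> Q \<and> Q \<inter> A = {}"
    have extend: "\<exists>Q. ?facet Q \<and> F \<subseteq> Q" if F: "F \<in> M A B" for F
    proof -
      have "F \<union> B \<in> \<Delta>" "F \<inter> A = {}" using F by (auto simp: M_def)
      then obtain Q where "Q \<in> \<Delta>" "F \<union> B \<subseteq> Q" "Q \<subseteq> F \<union> B \<union> P" "card Q = card P"
        using matroid_extend[OF mat Suc.prems(2)] rank Suc.prems(3) by metis
      then show ?thesis using Suc.prems \<open>F \<inter> A = {}\<close> by (intro exI[of _ Q]) auto
    qed
    have star: "{F. insert v F \<in> M A B} = M A (insert v B)" using v by (auto simp: M_def)
    have del: "{F \<in> M A B. v \<notin> F} = M (insert v A) B" by (auto simp: M_def)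
    have vd_star: "vertex_decomposable D (M A (insert v B))" if "?facet Q" "v \<in> Q" for Q
      using that v Suc.prems by (intro Suc.hyps(1)[of _ _ Q] n) auto
    have vd_del: "vertex_decomposable D (M (insert v A) B)" if "?facet Q" "v \<notin> Q" for Q
      using that v Suc.prems by (intro Suc.hyps(1)[of _ _ Q] n) auto
    consider Q Q' where "?facet Q" "v \<in> Q" "?facet Q'" "v \<notin> Q'"
      | "\<And>Q. ?facet Q \<Longrightarrow> v \<in> Q" | "\<And>Q. ?facet Q \<Longrightarrow> v \<notin> Q" by blast
    then show ?case
    proof cases
      case 1
      have "down_closed (M A B)"
        unfolding down_closed_def
      proof (intro ballI allI impI)
        fix F G assume "F \<in> M A B" "G \<subseteq> F"
        then have "F \<union> B \<in> \<Delta>" "G \<union> B \<subseteq> F \<union> B" "G \<inter> A = {}" unfolding M_def by auto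
        then show "G \<in> M A B" using dc[of "F \<union> B" "G \<union> B"] unfolding M_def by simp
      qed
      then show ?thesis
        using shed[of "M A B" D v] vd_star[OF 1(1,2)] vd_del[OF 1(3,4)] by (simp add: star del)
    next
      case 2
      have "M A B \<subseteq> M A (insert v B)"
      proof
        fix F assume F: "F \<in> M A B"
        then obtain Q where Q: "?facet Q" "F \<subseteq> Q" using extend by blast
        with 2 have "F \<union> insert v B \<subseteq> Q" by blast
        then show "F \<in> M A (insert v B)" using F Q dc by (auto simp: M_def)
      qed
      moreover have "M A (insert v B) \<subseteq> M A B"
        using dc[of "F \<union> insert v B" "F \<union> B" for F] unfolding M_def by blast
      ultimately have "M A B = M A (insert v B)" by (rule subset_antisym)
      then show ?thesis using vd_star[of P] 2[of P] Suc.prems by simp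
    next
      case 3
      have "M A B \<subseteq> M (insert v A) B"
      proof
        fix F assume F: "F \<in> M A B"
        then obtain Q where "?facet Q" "F \<subseteq> Q" using extend by blast
        with 3 have "v \<notin> F" by blast
        then show "F \<in> M (insert v A) B" using F by (simp add: M_def)
      qed
      moreover have "M (insert v A) B \<subseteq> M A B" unfolding M_def by auto
      ultimately have "M A B = M (insert v A) B" by (rule subset_antisym)
      then show ?thesis using vd_del[of P] 3[of P] Suc.prems by simp
    qed
  qed
  from this[of "{}" "{}" P] facet have "vertex_decomposable D (M {} {})" by simp
  then show ?thesis by (simp add: M_def)
qed

text \<open>
  The boundary of a simplex is a uniform matroid.
\<close>

lemma boundary_vertex_decomposable:
  fixes F :: "'v::finite set"
  assumes "card F = Suc D"
  shows "vertex_decomposable D {G. G \<subset> F}"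
proof -
  have "F \<noteq> {}" using assms by auto
  then obtain v where "v \<in> F" by blast
  have dc: "down_closed {G. G \<subset> F}" unfolding down_closed_def by blast
  have aug: "\<exists>v\<in>H - G. insert v G \<in> {G. G \<subset> F}" if GH: "G \<subset> F" "H \<subset> F" "card G < card H" for G H
  proof -
    have "\<not> H \<subseteq> G" using GH(3) card_mono[OF finite, of H G] by linarith
    then obtain w where w: "w \<in> H - G" by blast
    have "card (insert w G) = Suc (card G)" using w by (intro card_insert_disjoint) auto
    moreover have "card H < card F" by (rule psubset_card_mono[OF finite GH(2)])
    ultimately have "card (insert w G) \<noteq> card F" using GH(3) by linarith
    then have "insert w G \<noteq> F" by (rule contrapos_nn) (rule arg_cong)
    moreover have "insert w G \<subseteq> F" using w GH by blast
    ultimately have "insert w G \<in> {G. G \<subset> F}" by blast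
    then show ?thesis using w by (intro bexI)
  qed
  show ?thesis
  proof (rule matroid_vertex_decomposable[of _ _ "F - {v}"])
    show "matroid_complex {G. G \<subset> F}"
      unfolding matroid_complex_def using dc aug by blast
    show "card G \<le> D" if "G \<in> {G. G \<subset> F}" for G
      using that psubset_card_mono[OF finite, of G F] assms by simp
    show "F - {v} \<in> {G. G \<subset> F}" using \<open>v \<in> F\<close> by blast
    show "card (F - {v}) = D" using \<open>v \<in> F\<close> assms by simp
  qed
qed

section \<open>A universal regular sequence\<close>

text \<open>
  The elementary symmetric polynomial of degree \<open>i\<close>. Linear forms would not suffice for a regular
  sequence of length \<open>D\<close> when the field is small: on the complex of all pairs among four vertices,
  any two linear forms over \<open>F\<^sub>2\<close> restrict to linearly dependent forms on some pair.
\<close>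

definition esym :: "nat \<Rightarrow> ('v::finite, 'k::field) mpoly" where
  "esym i = (\<Sum>W | card W = i. xmon W)"

text \<open>
  The highest degree comes first; \<open>regular_on_esyms\<close> relies on this order.
\<close>

primrec esyms :: "nat \<Rightarrow> ('v::finite, 'k::field) mpoly list" where
  "esyms 0 = []"
| "esyms (Suc D) = esym (Suc D) # esyms D"

lemma length_esyms: "length (esyms D) = D" by (induction D) auto

lemma esyms_subset: "set (esyms D) \<subseteq> (graded_maximal_ideal :: ('v::finite, 'k::field) mpoly set)"
proof -
  have "esym (Suc i) \<in> (graded_maximal_ideal :: ('v, 'k) mpoly set)" for i
    unfolding esym_def graded_maximal_ideal_iff lookup_sum
  proof (intro sum.neutral ballI)
    fix W :: "'v set" assume "W \<in> {W. card W = Suc i}"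
    then have "Poly_Mapping.keys (sqfree W) \<noteq> {}" by (auto simp: keys_sqfree)
    then have "sqfree W \<noteq> 0" by (metis keys_zero)
    then show "Poly_Mapping.lookup (xmon W) 0 = (0 :: 'k)" by (simp add: lookup_single)
  qed
  then show ?thesis by (induction D) auto
qed

text \<open>
  Shedding a vertex is the exact sequence of \<open>regular_on_colon_add\<close>. On a simplex with vertex set \<open>F\<close> and
  \<open>Suc D\<close> vertices, the polynomial of degree \<open>Suc D\<close> becomes the monomial \<open>x\<^sub>F\<close>, a
  nonzerodivisor, and dividing it out leaves the boundary of the simplex. That boundary is vertex
  decomposable with facets of size \<open>D\<close>, so the remaining polynomials are regular on it by induction.
\<close>

lemma regular_on_esyms:
  assumes "vertex_decomposable D \<Delta>"
  shows "regular_on (stanley_reisner \<Delta> :: ('v::finite, 'k::field) mpoly set) (esyms D)"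
  using assms
proof (induction D arbitrary: \<Delta>)
  case 0
  have "{} \<in> \<Delta>" using 0
  proof (induction "0::nat" \<Delta> rule: vertex_decomposable.induct)
    case (shed \<Delta> v) then show ?case by blast
  qed auto
  then show ?case by (simp add: stanley_reisner_ne_UNIV)
next
  case (Suc D)
  note IH = Suc.IH
  define n where "n = Suc D"
  from Suc.prems have "vertex_decomposable n \<Delta>" by (simp add: n_def)
  then have "n = Suc D \<Longrightarrow> regular_on (stanley_reisner \<Delta> :: ('v, 'k) mpoly set) (esyms (Suc D))"
  proof (induction n \<Delta> rule: vertex_decomposable.induct)
    case (simplex F n)
    let ?P = "stanley_reisner (Pow F) :: ('v, 'k) mpoly set"
    have dc: "down_closed (Pow F)" by (auto simp: down_closed_def)
    have I: "is_ideal ?P" by (rule is_ideal_stanley_reisner[OF dc])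
    have "esym (Suc D) - xmon F = (\<Sum>W\<in>{W. card W = Suc D} - {F}. xmon W :: ('v, 'k) mpoly)"
      unfolding esym_def using simplex by (simp add: sum_diff1)
    also have "\<dots> \<in> ?P"
    proof (intro is_ideal_sum I)
      fix W assume "W \<in> {W. card W = Suc D} - {F}"
      then have "card W = card F" "W \<noteq> F" using simplex by simp_all
      then have "\<not> W \<subseteq> F" using card_subset_eq[OF finite, of W F] by blast
      then show "xmon W \<in> ?P" by (simp add: stanley_reisner_def keys_sqfree)
    qed
    finally have diff: "esym (Suc D) - xmon F \<in> ?P" .
    have "g \<in> ?P" if g: "esym (Suc D) * g \<in> ?P" for g
    proof -
      have "esym (Suc D) * g - g * (esym (Suc D) - xmon F) \<in> ?P"
        by (rule is_ideal_diff[OF I g is_ideal_mult[OF I diff]])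
      moreover have "esym (Suc D) * g - g * (esym (Suc D) - xmon F) = xmon F * g"
        by (simp add: right_diff_distrib mult.commute)
      ultimately have "g \<in> colon ?P (xmon F)" by (simp only: colon_def mem_Collect_eq)
      then show ?thesis unfolding colon_stanley_reisner by (simp add: Pow_def)
    qed
    moreover have "{G \<in> Pow F. \<not> F \<subseteq> G} = {G. G \<subset> F}" by auto
    then have "ideal_add ?P (esym (Suc D)) = stanley_reisner {G. G \<subset> F}"
      unfolding ideal_add_cong[OF I diff] ideal_add_stanley_reisner[OF dc] by simp
    moreover have "regular_on (stanley_reisner {G. G \<subset> F} :: ('v, 'k) mpoly set) (esyms D)"
      using simplex by (intro IH boundary_vertex_decomposable) simp
    ultimately show ?case by simp
  next
    case (shed \<Delta> n v)
    then have "regular_on (colon (stanley_reisner \<Delta>) (xmon {v}) :: ('v, 'k) mpoly set) (esyms (Suc D))"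
      "regular_on (ideal_add (stanley_reisner \<Delta>) (xmon {v}) :: ('v, 'k) mpoly set) (esyms (Suc D))"
      unfolding colon_stanley_reisner ideal_add_stanley_reisner[OF shed(1)] by simp_all
    then show ?case
      by (rule regular_on_colon_add[OF is_ideal_stanley_reisner[OF shed(1)]])
  qed
  then show ?case by (simp add: n_def)
qed

section \<open>Upper bound for depth and dimension\<close>

text \<open>
  The part that regular sequences and chains of primes have in common: each element is a nonzerodivisor
  modulo an ideal and lies in the next, larger one, and the last ideal is proper.
\<close>

inductive nzd_chain :: "'a::comm_ring_1 set \<Rightarrow> 'a list \<Rightarrow> bool" where
  Nil: "is_ideal A \<Longrightarrow> 1 \<notin> A \<Longrightarrow> nzd_chain A []"
| Cons: "is_ideal A \<Longrightarrow> (\<And>g. f * g \<in> A \<Longrightarrow> g \<in> A) \<Longrightarrow> A \<subseteq> B \<Longrightarrow> f \<in> B \<Longrightarrow> is_ideal B \<Longrightarrow>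
    nzd_chain B fs \<Longrightarrow> nzd_chain A (f # fs)"

definition power_product :: "'a::comm_ring_1 list \<Rightarrow> nat list \<Rightarrow> 'a" where
  "power_product fs a = prod_list (map2 (^) fs a)"

lemma power_product_simps [simp]:
  "power_product [] a = 1"
  "power_product (f # fs) (k # a) = f ^ k * power_product fs a"
  by (simp_all add: power_product_def)

text \<open>
  The list \<open>a\<close> is an exponent vector and \<open>c\<close> gives the coefficients of a polynomial in the elements \<open>fs\<close>.
  From a relation modulo \<open>A\<close>, divide by the largest possible power of the first element \<open>f\<close>, which is a
  nonzerodivisor modulo \<open>A\<close>; then set \<open>f\<close> to zero, as \<open>f \<in> B\<close>. What is left is a nonzero relation
  among fewer elements modulo \<open>B\<close>, and in the end a nonzero constant would lie in a proper ideal.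
\<close>

lemma nzd_chain_independent:
  fixes fs :: "('v, 'k::field) mpoly list" and c :: "nat list \<Rightarrow> 'k"
  assumes "nzd_chain A fs" "finite X" "\<And>a. a \<in> X \<Longrightarrow> length a = length fs"
    and "(\<Sum>a\<in>X. Poly_Mapping.single 0 (c a) * power_product fs a) \<in> A"
  shows "\<forall>a\<in>X. c a = 0"
  using assms
proof (induction A fs arbitrary: X c rule: nzd_chain.induct)
  case (Nil A)
  show ?case
  proof
    fix a assume "a \<in> X"
    with Nil have "X = {[]}" "a = []" by fastforce+
    with Nil have in_A: "Poly_Mapping.single 0 (c []) \<in> A" by simp
    show "c a = 0"
    proof (rule ccontr)
      assume "c a \<noteq> 0"
      then have "Poly_Mapping.single 0 (inverse (c [])) * Poly_Mapping.single 0 (c []) = (1 :: ('v, 'k) mpoly)"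
        using \<open>a = []\<close> by (simp add: mult_single)
      with is_ideal_mult[OF Nil(1) in_A] Nil(2) show False by metis
    qed
  qed
next
  case (Cons A f B fs)
  define X' where "X' = {a \<in> X. c a \<noteq> 0}"
  have "X' = {}"
  proof (rule ccontr)
    assume ne: "X' \<noteq> {}"
    have fin: "finite X'" using Cons.prems by (simp add: X'_def)
    \<comment> \<open>The exponent of the largest power of \<open>f\<close> dividing all terms with a nonzero coefficient.\<close>
    define k where "k = Min (hd ` X')"
    have k_le: "k \<le> hd a" if "a \<in> X'" for a using that fin by (simp add: k_def)
    have "k \<in> hd ` X'" unfolding k_def using fin ne by (intro Min_in) auto
    then obtain a0 where a0: "a0 \<in> X'" "hd a0 = k" by blast
    have shape: "a = hd a # tl a \<and> length (tl a) = length fs" if "a \<in> X'" for a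
      using that Cons.prems(2)[of a] by (cases a) (auto simp: X'_def)
    have pow: "g \<in> A" if "f ^ j * g \<in> A" for j g
      using that
    proof (induction j)
      case (Suc j)
      then have "f * (f ^ j * g) \<in> A" by (simp add: mult.assoc)
      then have "f ^ j * g \<in> A" by (rule Cons.hyps(2))
      then show ?case by (rule Suc.IH)
    qed simp
    let ?t = "\<lambda>a. Poly_Mapping.single 0 (c a) * power_product fs (tl a)"
    have pp: "power_product (f # fs) a = f ^ hd a * power_product fs (tl a)" if "a \<in> X'" for a
      using shape[OF that] power_product_simps(2) by metis
    have "(\<Sum>a\<in>X. Poly_Mapping.single 0 (c a) * power_product (f # fs) a)
      = (\<Sum>a\<in>X'. Poly_Mapping.single 0 (c a) * power_product (f # fs) a)"
      using Cons.prems(1) by (intro sum.mono_neutral_right) (auto simp: X'_def)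
    also have "\<dots> = (\<Sum>a\<in>X'. f ^ k * (f ^ (hd a - k) * ?t a))"
    proof (rule sum.cong)
      fix a assume a: "a \<in> X'"
      have "f ^ hd a = f ^ k * f ^ (hd a - k)" using k_le[OF a] by (simp flip: power_add)
      then show "Poly_Mapping.single 0 (c a) * power_product (f # fs) a = f ^ k * (f ^ (hd a - k) * ?t a)"
        by (simp add: pp[OF a] mult_ac)
    qed simp
    also have "\<dots> = f ^ k * (\<Sum>a\<in>X'. f ^ (hd a - k) * ?t a)" by (simp add: sum_distrib_left)
    finally have "(\<Sum>a\<in>X'. f ^ (hd a - k) * ?t a) \<in> A" using Cons.prems(3) pow by simp
    then have "(\<Sum>a\<in>X'. f ^ (hd a - k) * ?t a) \<in> B" using Cons.hyps(3) by blast
    moreover have "(\<Sum>a\<in>X' - {a \<in> X'. hd a = k}. f ^ (hd a - k) * ?t a) \<in> B"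
    proof (intro is_ideal_sum Cons.hyps(5))
      fix a assume "a \<in> X' - {a \<in> X'. hd a = k}"
      then have "hd a - k = Suc (hd a - k - 1)" using k_le[of a] by auto
      then have "f ^ (hd a - k) = f ^ (hd a - k - 1) * f" by (metis power_Suc2)
      then have "f ^ (hd a - k) * ?t a = (f ^ (hd a - k - 1) * ?t a) * f" by (simp add: mult_ac)
      then show "f ^ (hd a - k) * ?t a \<in> B"
        using is_ideal_mult[OF Cons.hyps(5,4)] by simp
    qed
    moreover have "(\<Sum>a\<in>X'. f ^ (hd a - k) * ?t a) = 
      (\<Sum>a\<in>X' - {a \<in> X'. hd a = k}. f ^ (hd a - k) * ?t a) + (\<Sum>a | a \<in> X' \<and> hd a = k. f ^ (hd a - k) * ?t a)"
      using fin by (intro sum.subset_diff) auto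
    ultimately have "(\<Sum>a | a \<in> X' \<and> hd a = k. f ^ (hd a - k) * ?t a) \<in> B"
      using is_ideal_diff[OF Cons.hyps(5), of "s + t" s for s t] by simp
    also have "(\<Sum>a | a \<in> X' \<and> hd a = k. f ^ (hd a - k) * ?t a) =
      (\<Sum>a | a \<in> X' \<and> hd a = k. Poly_Mapping.single 0 (c (k # tl a)) * power_product fs (tl a))"
    proof (intro sum.cong refl)
      fix a assume a: "a \<in> {a \<in> X'. hd a = k}"
      then have "k # tl a = a" using shape[of a] by simp
      then show "f ^ (hd a - k) * ?t a = Poly_Mapping.single 0 (c (k # tl a)) * power_product fs (tl a)"
        using a by simp
    qed
    also have "\<dots> = (\<Sum>b\<in>tl ` {a \<in> X'. hd a = k}. Poly_Mapping.single 0 (c (k # b)) * power_product fs b)"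
    proof (rule sum.reindex[symmetric, unfolded o_def])
      show "inj_on tl {a \<in> X'. hd a = k}"
      proof (rule inj_onI)
        fix a b assume "a \<in> {a \<in> X'. hd a = k}" "b \<in> {a \<in> X'. hd a = k}" "tl a = tl b"
        then show "a = b" using shape[of a] shape[of b] by simp
      qed
    qed
    finally have "\<forall>b\<in>tl ` {a \<in> X'. hd a = k}. c (k # b) = 0"
      using fin shape by (intro Cons.IH) auto
    then have "c (k # tl a0) = 0" using a0 by blast
    moreover have "k # tl a0 = a0" using a0 shape by metis
    ultimately show False using a0 by (simp add: X'_def)
  qed
  then show ?case by (auto simp: X'_def)
qed

text \<open>
  Gaussian elimination of one equation \<open>b\<close> against one unknown \<open>a0\<close>.
\<close>

lemma exists_nontrivial_relation:
  fixes M :: "'a \<Rightarrow> 'b \<Rightarrow> 'k::field"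
  assumes "finite B" "finite A" "card B < card A"
  shows "\<exists>c. (\<exists>a\<in>A. c a \<noteq> 0) \<and> (\<forall>b\<in>B. (\<Sum>a\<in>A. c a * M a b) = 0)"
  using assms
proof (induction B arbitrary: A M rule: finite_induct)
  case empty
  then obtain a where "a \<in> A" by fastforce
  then show ?case by (intro exI[of _ "\<lambda>_. 1"]) auto
next
  case (insert b B)
  show ?case
  proof (cases "\<forall>a\<in>A. M a b = 0")
    case True
    then show ?thesis using insert.IH[of A M] insert by auto
  next
    case False
    then obtain a0 where a0: "a0 \<in> A" "M a0 b \<noteq> 0" by blast
    \<comment> \<open>The system after \<open>a0\<close> has been eliminated by means of equation \<open>b\<close>.\<close>
    define M' where "M' a b' = M a b' - M a b / M a0 b * M a0 b'" for a b'
    have "card B < card (A - {a0})" using insert a0 by simp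
    then obtain c where c: "\<exists>a\<in>A - {a0}. c a \<noteq> 0" "\<And>b'. b' \<in> B \<Longrightarrow> (\<Sum>a\<in>A - {a0}. c a * M' a b') = 0"
      using insert.IH[of "A - {a0}" M'] insert.prems by auto
    define c' where "c' a = (if a = a0 then - (\<Sum>a\<in>A - {a0}. c a * M a b) / M a0 b else c a)" for a
    have sum: "(\<Sum>a\<in>A. c' a * M a b') = (\<Sum>a\<in>A - {a0}. c a * M' a b')" for b'
    proof -
      have "(\<Sum>a\<in>A. c' a * M a b') = c' a0 * M a0 b' + (\<Sum>a\<in>A - {a0}. c' a * M a b')"
        using insert.prems a0 by (simp add: sum.remove)
      also have "(\<Sum>a\<in>A - {a0}. c' a * M a b') = (\<Sum>a\<in>A - {a0}. c a * M a b')"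
        by (intro sum.cong) (auto simp: c'_def)
      finally show ?thesis
        by (simp add: c'_def M'_def right_diff_distrib sum_subtractf sum_distrib_right sum_divide_distrib mult.assoc)
    qed
    have "M' a b = 0" for a using a0 by (simp add: M'_def)
    then have "(\<Sum>a\<in>A. c' a * M a b') = 0" if "b' \<in> insert b B" for b'
      using that c(2) by (auto simp: sum)
    moreover have "\<exists>a\<in>A. c' a \<noteq> 0" using c(1) by (auto simp: c'_def)
    ultimately show ?thesis by blast
  qed
qed

definition exps_le :: "nat \<Rightarrow> ('v, 'k::zero) mpoly \<Rightarrow> bool" where
  "exps_le e p \<longleftrightarrow> (\<forall>m\<in>Poly_Mapping.keys p. \<forall>v. Poly_Mapping.lookup m v \<le> e)"

lemma exps_le_mult: 
  assumes "exps_le d p" "exps_le e q" shows "exps_le (d + e) (p * q)"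
  unfolding exps_le_def
proof (intro ballI allI)
  fix m v assume "m \<in> Poly_Mapping.keys (p * q)"
  then obtain m1 m2 where "m = m1 + m2" "m1 \<in> Poly_Mapping.keys p" "m2 \<in> Poly_Mapping.keys q"
    using keys_mult[of p q] by blast
  then show "Poly_Mapping.lookup m v \<le> d + e"
    using assms unfolding exps_le_def by (auto simp: lookup_add intro: add_mono)
qed

lemma exps_le_mono: "exps_le d p \<Longrightarrow> d \<le> e \<Longrightarrow> exps_le e p"
  unfolding exps_le_def by (meson order_trans)

lemma exps_le_power: "exps_le e p \<Longrightarrow> exps_le (k * e) (p ^ k)"
proof (induction k)
  case 0 then show ?case by (simp add: exps_le_def)
next
  case (Suc k) then show ?case using exps_le_mult[of e p "k * e" "p ^ k"] by simp
qed

lemma exps_le_power_product: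
  assumes "\<And>f. f \<in> set fs \<Longrightarrow> exps_le e f" "\<And>k. k \<in> set a \<Longrightarrow> k \<le> N" "length a = length fs"
  shows "exps_le (length fs * (N * e)) (power_product fs a)"
  using assms(3,1,2)
proof (induction a fs rule: list_induct2)
  case Nil then show ?case by (simp add: exps_le_def)
next
  case (Cons k a f fs)
  have "exps_le (N * e) (f ^ k)"
    using Cons.prems exps_le_power[of e f k] by (auto elim: exps_le_mono)
  then show ?case using Cons exps_le_mult by fastforce
qed

lemma exps_le_exists: "\<exists>e. exps_le e (p :: ('v::finite, 'k::zero) mpoly)"
proof -
  let ?S = "(\<lambda>(m, v). Poly_Mapping.lookup m v) ` (Poly_Mapping.keys p \<times> (UNIV :: 'v set))"
  have "finite ?S" by simp
  then have "exps_le (Max ?S) p" unfolding exps_le_def by (auto intro!: Max_ge)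
  then show ?thesis ..
qed

lemma exps_le_exists_list: "\<exists>e. \<forall>f\<in>set fs. exps_le e (f :: ('v::finite, 'k::zero) mpoly)"
proof (induction fs)
  case (Cons f fs)
  then obtain e where "\<forall>f\<in>set fs. exps_le e f" by blast
  moreover obtain d where "exps_le d f" using exps_le_exists by blast
  ultimately have "\<forall>g\<in>set (f # fs). exps_le (max d e) g"
    unfolding exps_le_def by (simp add: le_max_iff_disj)
  then show ?case ..
qed simp

lemma card_bounded_monomials:
  fixes \<Delta> :: "'v::finite set set" and L :: nat
  assumes "\<And>F. F \<in> \<Delta> \<Longrightarrow> card F \<le> D"
  defines "Y \<equiv> {m :: 'v \<Rightarrow>\<^sub>0 nat. Poly_Mapping.keys m \<in> \<Delta> \<and> (\<forall>v. Poly_Mapping.lookup m v \<le> L)}"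
  shows "finite Y" "card Y \<le> card \<Delta> * Suc L ^ D"
proof -
  define Z where "Z F = {m :: 'v \<Rightarrow>\<^sub>0 nat. Poly_Mapping.keys m \<subseteq> F \<and> (\<forall>v. Poly_Mapping.lookup m v \<le> L)}" for F
  have Z: "finite (Z F) \<and> card (Z F) \<le> Suc L ^ card F" for F
  proof -
    let ?r = "\<lambda>m :: 'v \<Rightarrow>\<^sub>0 nat. restrict (Poly_Mapping.lookup m) F"
    have inj: "inj_on ?r (Z F)"
    proof (rule inj_onI, rule poly_mapping_eqI)
      fix m m' v assume *: "m \<in> Z F" "m' \<in> Z F" "?r m = ?r m'"
      show "Poly_Mapping.lookup m v = Poly_Mapping.lookup m' v"
      proof (cases "v \<in> F")
        case True then show ?thesis using fun_cong[OF *(3), of v] by simp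
      next
        case False
        with * have "v \<notin> Poly_Mapping.keys m" "v \<notin> Poly_Mapping.keys m'" by (auto simp: Z_def)
        then show ?thesis by (simp add: in_keys_iff)
      qed
    qed
    have sub: "?r ` Z F \<subseteq> (\<Pi>\<^sub>E v\<in>F. {..L})" by (auto simp: Z_def)
    have fin: "finite (\<Pi>\<^sub>E v\<in>F. {..L})" by (simp add: finite_PiE)
    have "card (Z F) \<le> card (\<Pi>\<^sub>E v\<in>F. {..L})" using card_inj_on_le[OF inj sub fin] .
    then show ?thesis using inj_on_finite[OF inj sub fin] by (simp add: card_PiE)
  qed
  have Y: "Y \<subseteq> (\<Union>F\<in>\<Delta>. Z F)" by (auto simp: Y_def Z_def)
  then show "finite Y" using Z by (auto intro: finite_subset)
  have "card Y \<le> card (\<Union>F\<in>\<Delta>. Z F)" using Y Z by (intro card_mono) auto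
  also have "\<dots> \<le> (\<Sum>F\<in>\<Delta>. card (Z F))" by (rule card_UN_le) simp
  also have "\<dots> \<le> (\<Sum>F\<in>\<Delta>. Suc L ^ D)"
  proof (rule sum_mono)
    fix F assume "F \<in> \<Delta>"
    then have "Suc L ^ card F \<le> Suc L ^ D" using assms(1) by (intro power_increasing) auto
    then show "card (Z F) \<le> Suc L ^ D" using Z[of F] by linarith
  qed
  finally show "card Y \<le> card \<Delta> * Suc L ^ D" by simp
qed

lemma lookup_const_mult:
  "Poly_Mapping.lookup (Poly_Mapping.single 0 c * p) m = c * Poly_Mapping.lookup (p :: ('v, 'k::field) mpoly) m"
  using lookup_single_mult[of 0 c p m] by simp

text \<open>
  For exponents up to \<open>N\<close> there are \<open>(N + 1)\<^bsup>n\<^esup>\<close> power products of the \<open>n\<close> elements of the chain, but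
  modulo the ideal they live in a space spanned by \<open>O(N\<^bsup>D\<^esup>)\<close> monomials. If \<open>n > D\<close>, they are dependent for
  large \<open>N\<close>, contrary to \<open>nzd_chain_independent\<close>.
\<close>

lemma nzd_chain_length_le:
  fixes fs :: "('v::finite, 'k::field) mpoly list"
  assumes chain: "nzd_chain A fs" and sub: "stanley_reisner \<Delta> \<subseteq> A"
    and rank: "\<And>F. F \<in> \<Delta> \<Longrightarrow> card F \<le> D"
  shows "length fs \<le> D"
proof (rule ccontr)
  define n where "n = length fs"
  assume "\<not> length fs \<le> D"
  then have D: "Suc D \<le> n" by (simp add: n_def)
  obtain e where e: "\<And>f. f \<in> set fs \<Longrightarrow> exps_le e f" using exps_le_exists_list[of fs] by blast
  \<comment> \<open>With \<open>L = n * N * e\<close> there are at most \<open>card \<Delta> * (L + 1)\<^bsup>D\<^esup>\<close> monomials, and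
    \<open>L + 1 \<le> (n * e + 1) * (N + 1)\<close>; so \<open>N\<close> is chosen to make this at most \<open>N * (N + 1)\<^bsup>D\<^esup>\<close>.\<close>
  define N where "N = card \<Delta> * Suc (n * e) ^ D"
  define L where "L = n * (N * e)"
  define X where "X = {a :: nat list. set a \<subseteq> {..N} \<and> length a = n}"
  define Y where "Y = {m :: 'v \<Rightarrow>\<^sub>0 nat. Poly_Mapping.keys m \<in> \<Delta> \<and> (\<forall>v. Poly_Mapping.lookup m v \<le> L)}"
  have X: "finite X" "card X = Suc N ^ n"
    using finite_lists_length_eq[of "{..N}" n] card_lists_length_eq[of "{..N}" n] by (simp_all add: X_def)
  note Y = card_bounded_monomials[OF rank, of \<Delta> L, folded Y_def]
  have "Suc L \<le> Suc (n * e) * Suc N" by (simp add: L_def algebra_simps)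
  then have "card \<Delta> * Suc L ^ D \<le> card \<Delta> * (Suc (n * e) * Suc N) ^ D"
    by (intro mult_le_mono2 power_mono) auto
  also have "\<dots> = N * Suc N ^ D" unfolding power_mult_distrib by (simp only: N_def mult.assoc)
  also have "\<dots> < Suc N ^ Suc D" by simp
  also have "\<dots> \<le> Suc N ^ n" using D by (intro power_increasing) auto
  finally have "card Y < card X" using Y X by simp
  then obtain c where c: "\<exists>a\<in>X. c a \<noteq> 0"
    "\<And>m. m \<in> Y \<Longrightarrow> (\<Sum>a\<in>X. c a * Poly_Mapping.lookup (power_product fs a) m) = 0"
    using exists_nontrivial_relation[of Y X "\<lambda>a. Poly_Mapping.lookup (power_product fs a)"] X Y by blast
  let ?p = "\<Sum>a\<in>X. Poly_Mapping.single 0 (c a) * power_product fs a"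
  have lookup: "Poly_Mapping.lookup ?p m = (\<Sum>a\<in>X. c a * Poly_Mapping.lookup (power_product fs a) m)" for m
    by (simp add: lookup_sum lookup_const_mult)
  have "?p \<in> stanley_reisner \<Delta>"
    unfolding stanley_reisner_def
  proof (intro CollectI ballI notI)
    fix m assume m: "m \<in> Poly_Mapping.keys ?p" "Poly_Mapping.keys m \<in> \<Delta>"
    then obtain a where a: "a \<in> X" "Poly_Mapping.lookup (power_product fs a) m \<noteq> 0"
      unfolding in_keys_iff lookup by (metis (no_types, lifting) mult_zero_right sum.neutral)
    have "exps_le L (power_product fs a)"
      unfolding L_def n_def using a(1) e by (intro exps_le_power_product) (auto simp: X_def n_def)
    then have "m \<in> Y" using a(2) m(2) by (auto simp: Y_def exps_le_def in_keys_iff)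
    then show False using c(2) m(1) by (simp add: in_keys_iff lookup)
  qed
  then have "\<forall>a\<in>X. c a = 0"
    using sub X by (intro nzd_chain_independent[OF chain]) (auto simp: X_def n_def)
  then show False using c(1) by blast
qed

lemma regular_on_imp_nzd_chain:
  assumes "is_ideal I" "regular_on I fs" shows "nzd_chain I fs"
  using assms
proof (induction fs arbitrary: I)
  case Nil
  then have "1 \<notin> I" using is_ideal_mult[of I 1] by force
  then show ?case using Nil by (intro nzd_chain.Nil) auto
next
  case (Cons f fs)
  show ?case
  proof (rule nzd_chain.Cons)
    show "nzd_chain (ideal_add I f) fs" using Cons by (simp add: is_ideal_ideal_add)
  qed (use Cons in \<open>auto simp: is_ideal_ideal_add ideal_add_self subsetD[OF ideal_add_superset]\<close>)
qed

lemma prime_chain_imp_nzd_chain: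
  fixes P :: "nat \<Rightarrow> 'a::comm_ring_1 set"
  assumes "\<And>i. i \<le> m \<Longrightarrow> prime_ideal (P i)" "\<And>i. i < m \<Longrightarrow> P i \<subset> P (Suc i)"
  shows "\<exists>fs. length fs = m \<and> nzd_chain (P 0) fs"
  using assms
proof (induction m arbitrary: P)
  case 0
  then have "is_ideal (P 0)" "P 0 \<noteq> UNIV" by (auto simp: prime_ideal_def)
  then have "nzd_chain (P 0) []" using is_ideal_mult[of "P 0" 1] by (intro nzd_chain.Nil) force+
  then show ?case by auto
next
  case (Suc m)
  have "\<exists>fs. length fs = m \<and> nzd_chain (P (Suc 0)) fs"
    using Suc.IH[of "\<lambda>i. P (Suc i)"] Suc.prems by simp
  then obtain fs where fs: "length fs = m" "nzd_chain (P (Suc 0)) fs" by blast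
  obtain f where f: "f \<in> P (Suc 0)" "f \<notin> P 0" using Suc.prems(2)[of 0] by blast
  have "nzd_chain (P 0) (f # fs)"
  proof (rule nzd_chain.Cons)
    show "nzd_chain (P (Suc 0)) fs" by fact
    show "P 0 \<subseteq> P (Suc 0)" using Suc.prems(2)[of 0] by blast
    show "\<And>g. f * g \<in> P 0 \<Longrightarrow> g \<in> P 0" using Suc.prems(1)[of 0] f unfolding prime_ideal_def by blast
  qed (use Suc.prems(1)[of 0] Suc.prems(1)[of 1] f in \<open>auto simp: prime_ideal_def\<close>)
  then show ?case using fs by (intro exI[of _ "f # fs"]) simp
qed

section \<open>Coordinate primes\<close>

text \<open>
  Among the monomials of \<open>p\<close> and of \<open>q\<close> supported on \<open>F\<close>, the product of the two largest ones cannot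
  cancel. The comparison uses the monomial order on \<open>nat \<Rightarrow>\<^sub>0 nat\<close>, into which \<open>\<iota>\<close> embeds the monomials
  by numbering the variables.
\<close>

lemma prime_ideal_face:
  fixes F :: "'v::finite set"
  shows "prime_ideal (stanley_reisner (Pow F) :: ('v, 'k::field) mpoly set)"
  unfolding prime_ideal_def
proof (intro conjI allI impI)
  let ?P = "stanley_reisner (Pow F) :: ('v, 'k) mpoly set"
  show "is_ideal ?P" by (rule is_ideal_stanley_reisner) (auto simp: down_closed_def)
  show "?P \<noteq> UNIV" by (rule stanley_reisner_ne_UNIV) simp
  fix p q :: "('v, 'k) mpoly"
  assume pq: "p * q \<in> ?P"
  obtain g :: "'v \<Rightarrow> nat" where g: "inj g"
    using finite_imp_inj_to_nat_seg[of "UNIV :: 'v set"] by auto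
  define \<iota> :: "('v \<Rightarrow>\<^sub>0 nat) \<Rightarrow> (nat \<Rightarrow>\<^sub>0 nat)" where
    "\<iota> m = (\<Sum>v\<in>UNIV. Poly_Mapping.single (g v) (Poly_Mapping.lookup m v))" for m
  have \<iota>_add: "\<iota> (m + m') = \<iota> m + \<iota> m'" for m m'
    by (simp add: \<iota>_def lookup_add single_add sum.distrib)
  have "Poly_Mapping.lookup (\<iota> m) (g v) = Poly_Mapping.lookup m v" for m v
    using g by (simp add: \<iota>_def lookup_sum lookup_single when_def inj_eq sum.delta)
  then have \<iota>_inj: "m = m'" if "\<iota> m = \<iota> m'" for m m'
    using that by (metis poly_mapping_eqI)
  show "p \<in> ?P \<or> q \<in> ?P"
  proof (rule ccontr)
    assume not: "\<not> (p \<in> ?P \<or> q \<in> ?P)"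
    define K where "K p = {m \<in> Poly_Mapping.keys p. Poly_Mapping.keys m \<subseteq> F}" for p :: "('v, 'k) mpoly"
    have lead: "\<exists>a\<in>K r. \<forall>m\<in>K r. \<iota> m \<le> \<iota> a" if "r \<notin> ?P" for r
    proof -
      have "finite (\<iota> ` K r)" "\<iota> ` K r \<noteq> {}" using that by (auto simp: K_def stanley_reisner_def)
      then have "Max (\<iota> ` K r) \<in> \<iota> ` K r" "\<forall>m\<in>K r. \<iota> m \<le> Max (\<iota> ` K r)" by (auto intro: Max_in)
      then show ?thesis by (metis (no_types, lifting) imageE)
    qed
    obtain a where a: "a \<in> K p" "\<And>m. m \<in> K p \<Longrightarrow> \<iota> m \<le> \<iota> a" using lead not by blast
    obtain b where b: "b \<in> K q" "\<And>m. m \<in> K q \<Longrightarrow> \<iota> m \<le> \<iota> b" using lead not by blast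
    have keys_ab: "Poly_Mapping.keys (a + b) \<subseteq> F" using a b by (auto simp: K_def keys_add_nat)
    have unique: "m = a \<and> m' = b"
      if "m \<in> Poly_Mapping.keys p" "m' \<in> Poly_Mapping.keys q" "m + m' = a + b" for m m'
    proof -
      have "Poly_Mapping.keys (m + m') \<subseteq> F" using keys_ab that by simp
      then have "m \<in> K p" "m' \<in> K q"
        using that(1,2) unfolding K_def keys_add_nat by simp_all
      then have le: "\<iota> m \<le> \<iota> a" "\<iota> m' \<le> \<iota> b" using a b by auto
      have "\<iota> m + \<iota> m' = \<iota> a + \<iota> b" using that \<iota>_add by metis
      then have "\<iota> m = \<iota> a" "\<iota> m' = \<iota> b"
        using le by (metis add_less_le_mono less_irrefl order_le_less, metis add_le_less_mono less_irrefl order_le_less)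
      then show ?thesis using \<iota>_inj by blast
    qed
    have "p * q = (\<Sum>m\<in>Poly_Mapping.keys p. Poly_Mapping.single m (Poly_Mapping.lookup p m) * q)"
      by (subst sum_single_lookup[of p, symmetric]) (simp only: sum_distrib_right)
    then have "Poly_Mapping.lookup (p * q) (a + b) = 
      (\<Sum>m\<in>Poly_Mapping.keys p. Poly_Mapping.lookup (Poly_Mapping.single m (Poly_Mapping.lookup p m) * q) (a + b))"
      by (simp add: lookup_sum)
    also have "\<dots> = (\<Sum>m\<in>Poly_Mapping.keys p. if m = a then Poly_Mapping.lookup p a * Poly_Mapping.lookup q b else 0)"
    proof (rule sum.cong)
      fix m assume m: "m \<in> Poly_Mapping.keys p"
      show "Poly_Mapping.lookup (Poly_Mapping.single m (Poly_Mapping.lookup p m) * q) (a + b)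
        = (if m = a then Poly_Mapping.lookup p a * Poly_Mapping.lookup q b else 0)"
      proof (cases "m = a")
        case True then show ?thesis by (simp add: lookup_single_mult)
      next
        case False
        then have "a + b \<notin> (+) m ` Poly_Mapping.keys q" using unique m by (auto simp: eq_commute)
        moreover have "Poly_Mapping.keys (Poly_Mapping.single m (Poly_Mapping.lookup p m) * q) = (+) m ` Poly_Mapping.keys q"
          using m by (intro keys_single_mult) (simp add: in_keys_iff)
        ultimately have "a + b \<notin> Poly_Mapping.keys (Poly_Mapping.single m (Poly_Mapping.lookup p m) * q)" by simp
        then show ?thesis using False by (simp add: in_keys_iff)
      qed
    qed simp
    also have "\<dots> \<noteq> 0" using a b by (simp add: sum.delta K_def in_keys_iff)
    finally have "a + b \<in> Poly_Mapping.keys (p * q)" by (simp add: in_keys_iff)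
    then show False using pq keys_ab by (auto simp: stanley_reisner_def)
  qed
qed

text \<open>
  Drop the vertices of \<open>F\<close> one after another.
\<close>

lemma coordinate_prime_chain:
  fixes \<Delta> :: "'v::finite set set"
  assumes "down_closed \<Delta>" "F \<in> \<Delta>"
  shows "\<exists>P :: nat \<Rightarrow> ('v, 'k::field) mpoly set.
    (\<forall>i\<le>card F. prime_ideal (P i) \<and> stanley_reisner \<Delta> \<subseteq> P i) \<and> (\<forall>i<card F. P i \<subset> P (Suc i))"
proof -
  obtain h where h: "bij_betw h {..<card F} F"
    using ex_bij_betw_nat_finite[OF finite, of F] by (auto simp: atLeast0LessThan)
  define G where "G i = h ` {i..<card F}" for i
  define P where "P i = (stanley_reisner (Pow (G i)) :: ('v, 'k) mpoly set)" for i
  have G: "G i \<subseteq> F" for i using h by (auto simp: G_def bij_betw_def)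
  have "P i \<subset> P (Suc i)" if i: "i < card F" for i
  proof -
    have "G (Suc i) \<subseteq> G i" by (auto simp: G_def)
    moreover have "h i \<in> G i" using i by (simp add: G_def)
    moreover have "h i \<notin> G (Suc i)"
    proof
      assume "h i \<in> G (Suc i)"
      then obtain j where "h i = h j" "Suc i \<le> j" "j < card F" by (auto simp: G_def)
      then show False using inj_onD[OF bij_betw_imp_inj_on[OF h], of i j] i by auto
    qed
    ultimately have "xmon (G i) \<in> P (Suc i)" "xmon (G i) \<notin> P i" "P i \<subseteq> P (Suc i)"
      by (auto simp: P_def stanley_reisner_def keys_sqfree)
    then show ?thesis by blast
  qed
  moreover have "stanley_reisner \<Delta> \<subseteq> P i" for i
    using assms G[of i] unfolding P_def stanley_reisner_def down_closed_def by blast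
  moreover have "prime_ideal (P i)" for i unfolding P_def by (rule prime_ideal_face)
  ultimately show ?thesis by blast
qed

lemma Sup_enat_eq: "Q D \<Longrightarrow> (\<And>m. Q m \<Longrightarrow> m \<le> D) \<Longrightarrow> Sup {enat m | m. Q m} = enat D"
  by (intro antisym Sup_least Sup_upper) auto

theorem matroid_cohen_macaulay:
  fixes \<Delta> :: "'v::finite set set"
  assumes "matroid_complex \<Delta>" and rank: "\<And>F. F \<in> \<Delta> \<Longrightarrow> card F \<le> D"
    and facet: "P \<in> \<Delta>" "card P = D"
  shows "cohen_macaulay_quotient (stanley_reisner \<Delta> :: ('v, 'k::field) mpoly set)"
proof -
  let ?I = "stanley_reisner \<Delta> :: ('v, 'k) mpoly set"
  have dc: "down_closed \<Delta>" using assms by (simp add: matroid_complex_def)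
  have I: "is_ideal ?I" by (rule is_ideal_stanley_reisner[OF dc])
  have "krull_dim_quotient ?I = enat D"
    unfolding krull_dim_quotient_def
  proof (rule Sup_enat_eq)
    show "\<exists>P :: nat \<Rightarrow> ('v, 'k) mpoly set.
      (\<forall>i\<le>D. prime_ideal (P i) \<and> ?I \<subseteq> P i) \<and> (\<forall>i<D. P i \<subset> P (Suc i))"
      using coordinate_prime_chain[OF dc facet(1)] facet(2) by simp
    fix m
    assume "\<exists>P :: nat \<Rightarrow> ('v, 'k) mpoly set.
      (\<forall>i\<le>m. prime_ideal (P i) \<and> ?I \<subseteq> P i) \<and> (\<forall>i<m. P i \<subset> P (Suc i))"
    then obtain P :: "nat \<Rightarrow> ('v, 'k) mpoly set" where
      P: "\<forall>i\<le>m. prime_ideal (P i) \<and> ?I \<subseteq> P i" "\<forall>i<m. P i \<subset> P (Suc i)" by blast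
    then obtain fs where "length fs = m" "nzd_chain (P 0) fs"
      using prime_chain_imp_nzd_chain[of m P] by blast
    then show "m \<le> D" using nzd_chain_length_le[of "P 0" fs \<Delta> D] P(1) rank by auto
  qed
  moreover have "depth_quotient ?I = enat D"
  proof -
    have "depth_quotient ?I = Sup {enat m | m. \<exists>fs. length fs = m \<and>
       set fs \<subseteq> graded_maximal_ideal \<and> regular_sequence_on_quotient ?I fs}"
      unfolding depth_quotient_def by (rule arg_cong[of _ _ Sup]) blast
    also have "\<dots> = enat D"
    proof (rule Sup_enat_eq)
      show "\<exists>fs. length fs = D \<and> set fs \<subseteq> graded_maximal_ideal \<and> regular_sequence_on_quotient ?I fs"
        using regular_on_esyms[OF matroid_vertex_decomposable[OF assms]] esyms_subset length_esyms
        unfolding regular_sequence_on_quotient_iff[OF I] by blast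
      fix m assume "\<exists>fs. length fs = m \<and> set fs \<subseteq> graded_maximal_ideal \<and> regular_sequence_on_quotient ?I fs"
      then obtain fs where "length fs = m" "regular_on ?I fs"
        unfolding regular_sequence_on_quotient_iff[OF I] by blast
      then show "m \<le> D"
        using nzd_chain_length_le[OF regular_on_imp_nzd_chain[OF I] order_refl rank] by blast
    qed
    finally show ?thesis .
  qed
  ultimately show ?thesis by (simp add: cohen_macaulay_quotient_def)
qed

section \<open>Graded matrices and lifting\<close>

text \<open>
  The weight \<open>w\<close> is the total degree when Betti numbers are compared, and the identity, i.e. the
  multidegree, when a resolution is constructed. Writing \<open>w m + e = f\<close> instead of \<open>w m = f - e\<close> allows
  multidegrees, which have no negatives.
\<close>

definition homogeneous_entry :: "('m \<Rightarrow> 'g::cancel_comm_monoid_add) \<Rightarrow> 'g \<Rightarrow> 'g \<Rightarrow> ('m \<Rightarrow>\<^sub>0 'k::zero) \<Rightarrow> bool" where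
  "homogeneous_entry w e f p \<longleftrightarrow> (\<forall>m\<in>Poly_Mapping.keys p. w m + e = f)"

definition graded_mat :: "('m \<Rightarrow> 'g::cancel_comm_monoid_add) \<Rightarrow> 'g list \<Rightarrow> 'g list \<Rightarrow> ('m \<Rightarrow>\<^sub>0 'k::zero) mat \<Rightarrow> bool" where
  "graded_mat w es fs M \<longleftrightarrow> M \<in> carrier_mat (length es) (length fs) \<and>
     (\<forall>a<length es. \<forall>b<length fs. homogeneous_entry w (es ! a) (fs ! b) (M $$ (a, b)))"

lemma graded_mat_carrier: "graded_mat w es fs M \<Longrightarrow> M \<in> carrier_mat (length es) (length fs)"
  by (simp add: graded_mat_def)

lemma mult_mat_entry:
  assumes "A \<in> carrier_mat n k" "B \<in> carrier_mat k c" "i < n" "j < c"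
  shows "(A * B) $$ (i, j) = (\<Sum>b<k. A $$ (i, b) * B $$ (b, j))"
  using assms by (auto simp: scalar_prod_def atLeast0LessThan intro!: sum.cong)

lemma mat_unit_vec_col:
  fixes A :: "'r::comm_ring_1 mat"
  assumes "A \<in> carrier_mat n k" "j < k"
  shows "A *\<^sub>v unit_vec k j = col A j"
  using col_mult2[OF assms(1) one_carrier_mat assms(2)] assms by simp

lemma lift_mat:
  assumes \<phi>: "\<phi> \<in> carrier_mat n k" and M: "M \<in> carrier_mat n c"
    and image: "\<And>j. j < c \<Longrightarrow> col M j \<in> (\<lambda>v. \<phi> *\<^sub>v v) ` carrier_vec k"
  shows "\<exists>X\<in>carrier_mat k c. M = \<phi> * X"
proof -
  have "\<forall>j. \<exists>v. j < c \<longrightarrow> v \<in> carrier_vec k \<and> col M j = \<phi> *\<^sub>v v" using image by blast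
  then obtain v where v: "\<And>j. j < c \<Longrightarrow> v j \<in> carrier_vec k" "\<And>j. j < c \<Longrightarrow> col M j = \<phi> *\<^sub>v v j"
    by metis
  define X where "X = mat_of_cols k (map v [0..<c])"
  have X: "X \<in> carrier_mat k c" by (simp add: X_def carrier_matI)
  have colX: "col X j = v j" if "j < c" for j
    using that v(1)[OF that] unfolding X_def by (subst col_mat_of_cols) simp_all
  have "M = \<phi> * X"
  proof (rule mat_col_eqI)
    fix j assume "j < dim_col (\<phi> * X)"
    then have j: "j < c" using X by simp
    show "col M j = col (\<phi> * X) j"
      using col_mult2[OF \<phi> X j] v(2)[OF j] colX[OF j] by simp
  qed (use \<phi> M X in simp_all)
  then show ?thesis using X by blast
qed

text \<open>
  Lift the columns arbitrarily and keep only the component of the right degree in each entry.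
\<close>

lemma lift_graded_mat:
  fixes \<phi> M :: "('m::comm_monoid_add \<Rightarrow>\<^sub>0 'k::comm_ring_1) mat"
  assumes w: "\<And>m m'. w (m + m') = w m + w m'"
    and \<phi>: "graded_mat w es ms \<phi>" and M: "graded_mat w es fs M"
    and image: "\<And>j. j < length fs \<Longrightarrow> col M j \<in> (\<lambda>v. \<phi> *\<^sub>v v) ` carrier_vec (length ms)"
  shows "\<exists>X. graded_mat w ms fs X \<and> M = \<phi> * X"
proof -
  note \<phi>c = graded_mat_carrier[OF \<phi>] and Mc = graded_mat_carrier[OF M]
  obtain X where X: "X \<in> carrier_mat (length ms) (length fs)" "M = \<phi> * X"
    using lift_mat[OF \<phi>c Mc image] by blast
  define X' where "X' = mat (length ms) (length fs) (\<lambda>(b, c). filter_terms (\<lambda>m. w m + ms ! b = fs ! c) (X $$ (b, c)))"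
  have X': "X' \<in> carrier_mat (length ms) (length fs)" by (simp add: X'_def)
  have "graded_mat w ms fs X'"
    using X' by (simp add: graded_mat_def homogeneous_entry_def X'_def keys_filter_terms)
  moreover have "M = \<phi> * X'"
  proof (rule eq_matI)
    fix a c assume "a < dim_row (\<phi> * X')" "c < dim_col (\<phi> * X')"
    then have ac: "a < length es" "c < length fs" using \<phi>c X' by auto
    let ?Q = "\<lambda>m. w m + es ! a = fs ! c"
    have "M $$ (a, c) = filter_terms ?Q (M $$ (a, c))"
      using M ac by (intro filter_terms_id[symmetric]) (auto simp: graded_mat_def homogeneous_entry_def)
    also have "\<dots> = (\<Sum>b<length ms. filter_terms ?Q (\<phi> $$ (a, b) * X $$ (b, c)))"
      using mult_mat_entry[OF \<phi>c X(1) ac] X(2) by (simp add: filter_terms_sum)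
    also have "\<dots> = (\<Sum>b<length ms. \<phi> $$ (a, b) * X' $$ (b, c))"
    proof (rule sum.cong)
      fix b assume b: "b \<in> {..<length ms}"
      have "filter_terms ?Q (\<phi> $$ (a, b) * X $$ (b, c)) = 
        \<phi> $$ (a, b) * filter_terms (\<lambda>m. w m + ms ! b = fs ! c) (X $$ (b, c))"
      proof (rule filter_terms_mult)
        fix m m' assume "m \<in> Poly_Mapping.keys (\<phi> $$ (a, b))"
        then have "ms ! b = w m + es ! a"
          using \<phi> ac b by (auto simp: graded_mat_def homogeneous_entry_def)
        then show "?Q (m + m') \<longleftrightarrow> w m' + ms ! b = fs ! c" by (simp add: w ac_simps)
      qed
      then show "filter_terms ?Q (\<phi> $$ (a, b) * X $$ (b, c)) = \<phi> $$ (a, b) * X' $$ (b, c)"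
        using ac b by (simp add: X'_def)
    qed simp
    also have "\<dots> = (\<phi> * X') $$ (a, c)" by (rule mult_mat_entry[OF \<phi>c X' ac, symmetric])
    finally show "M $$ (a, c) = (\<phi> * X') $$ (a, c)" .
  qed (use \<phi>c Mc X' in simp_all)
  ultimately show ?thesis by blast
qed

lemma graded_mat_mult:
  fixes A B :: "('m::comm_monoid_add \<Rightarrow>\<^sub>0 'k::comm_ring_1) mat"
  assumes w: "\<And>m m'. w (m + m') = w m + w m'"
    and A: "graded_mat w es ms A" and B: "graded_mat w ms fs B"
  shows "graded_mat w es fs (A * B)"
proof -
  note Ac = graded_mat_carrier[OF A] and Bc = graded_mat_carrier[OF B]
  have "w m + es ! a = fs ! c"
    if ac: "a < length es" "c < length fs" and m: "m \<in> Poly_Mapping.keys ((A * B) $$ (a, c))" for a c m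
  proof -
    have "\<exists>b<length ms. m \<in> Poly_Mapping.keys (A $$ (a, b) * B $$ (b, c))"
    proof (rule ccontr)
      assume "\<not> ?thesis"
      then have "Poly_Mapping.lookup (\<Sum>b<length ms. A $$ (a, b) * B $$ (b, c)) m = 0"
        unfolding lookup_sum by (intro sum.neutral) (auto simp: in_keys_iff)
      then show False using m by (simp add: mult_mat_entry[OF Ac Bc ac] in_keys_iff del: index_mult_mat)
    qed
    then obtain b where b: "b < length ms" "m \<in> Poly_Mapping.keys (A $$ (a, b) * B $$ (b, c))" by blast
    then obtain m1 m2 where m12: "m = m1 + m2" "m1 \<in> Poly_Mapping.keys (A $$ (a, b))" "m2 \<in> Poly_Mapping.keys (B $$ (b, c))"
      using keys_mult by blast
    then have "w m1 + es ! a = ms ! b" "w m2 + ms ! b = fs ! c"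
      using A B ac b by (auto simp: graded_mat_def homogeneous_entry_def)
    then show ?thesis using m12 by (metis w add.assoc add.commute)
  qed
  then show ?thesis using Ac Bc by (simp add: graded_mat_def homogeneous_entry_def del: index_mult_mat)
qed

section \<open>Exact complexes, chain maps and homotopies\<close>

text \<open>
  In position 0 a prescribed set \<open>Z\<close> replaces the kernel. It will be the kernel of the augmentation
  to \<open>S/I\<close>, so that exactness takes the same form in every position.
\<close>

definition cycles :: "'r::comm_ring_1 vec set \<Rightarrow> (nat \<Rightarrow> 'r mat) \<Rightarrow> nat \<Rightarrow> 'r vec set" where
  "cycles Z \<phi> i = (case i of 0 \<Rightarrow> Z | Suc j \<Rightarrow> mat_kernel (\<phi> j))"

definition exact_complex :: "('m \<Rightarrow> 'g::cancel_comm_monoid_add) \<Rightarrow> ('m::comm_monoid_add \<Rightarrow>\<^sub>0 'k::comm_ring_1) vec set \<Rightarrow>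
    (nat \<Rightarrow> 'g list) \<Rightarrow> (nat \<Rightarrow> ('m \<Rightarrow>\<^sub>0 'k) mat) \<Rightarrow> bool" where
  "exact_complex w Z d \<phi> \<longleftrightarrow> (\<forall>i. graded_mat w (d i) (d (Suc i)) (\<phi> i)) \<and>
     (\<forall>i. cycles Z \<phi> i = (\<lambda>v. \<phi> i *\<^sub>v v) ` carrier_vec (length (d (Suc i))))"

lemma exact_complexD:
  assumes "exact_complex w Z d \<phi>"
  shows "graded_mat w (d i) (d (Suc i)) (\<phi> i)"
    and "\<phi> i \<in> carrier_mat (length (d i)) (length (d (Suc i)))"
    and "cycles Z \<phi> i = (\<lambda>v. \<phi> i *\<^sub>v v) ` carrier_vec (length (d (Suc i)))"
  using assms by (auto simp: exact_complex_def intro: graded_mat_carrier)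

lemma exact_complex_comp_zero:
  assumes "exact_complex w Z d \<phi>" "v \<in> carrier_vec (length (d (Suc (Suc i))))"
  shows "\<phi> i *\<^sub>v (\<phi> (Suc i) *\<^sub>v v) = 0\<^sub>v (length (d i))"
proof -
  have "\<phi> (Suc i) *\<^sub>v v \<in> mat_kernel (\<phi> i)"
    using exact_complexD(3)[OF assms(1), of "Suc i"] assms(2) by (simp add: cycles_def)
  then show ?thesis using mat_kernelD[OF exact_complexD(2)[OF assms(1)]] by blast
qed

text \<open>
  The comparison theorem. Each \<open>A i\<close> maps cycles to cycles, so the columns of \<open>A i * \<phi> i\<close> are cycles
  of the target, hence boundaries, and lift to \<open>A (Suc i)\<close>.
\<close>

lemma chain_map_exists:
  fixes \<phi> \<psi> :: "nat \<Rightarrow> ('m::comm_monoid_add \<Rightarrow>\<^sub>0 'k::comm_ring_1) mat"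
  assumes w: "\<And>m m'. w (m + m') = w m + w m'"
    and ex: "exact_complex w Z d \<phi>" and ex': "exact_complex w Z' d' \<psi>"
    and A0: "graded_mat w (d' 0) (d 0) A0" and Z: "\<And>v. v \<in> Z \<Longrightarrow> A0 *\<^sub>v v \<in> Z'"
  shows "\<exists>A. A 0 = A0 \<and> (\<forall>i. graded_mat w (d' i) (d i) (A i)) \<and> (\<forall>i. \<psi> i * A (Suc i) = A i * \<phi> i)"
proof -
  define P where "P i B \<longleftrightarrow> (i = 0 \<longrightarrow> B = A0) \<and> graded_mat w (d' i) (d i) B \<and> (\<forall>v\<in>cycles Z \<phi> i. B *\<^sub>v v \<in> cycles Z' \<psi> i)" for i B
  have "\<exists>A. \<forall>i. P i (A i) \<and> \<psi> i * A (Suc i) = A i * \<phi> i"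
  proof (rule dependent_nat_choice)
    show "\<exists>B. P 0 B" using A0 Z by (auto simp: P_def cycles_def)
    fix B i assume P: "P i B"
    then have B: "graded_mat w (d' i) (d i) B" by (simp add: P_def)
    note Bc = graded_mat_carrier[OF B] and \<phi>c = exact_complexD(2)[OF ex] and \<psi>c = exact_complexD(2)[OF ex']
    have "\<exists>X. graded_mat w (d' (Suc i)) (d (Suc i)) X \<and> B * \<phi> i = \<psi> i * X"
    proof (rule lift_graded_mat[OF w])
      show "graded_mat w (d' i) (d (Suc i)) (B * \<phi> i)"
        by (rule graded_mat_mult[OF w B exact_complexD(1)[OF ex]])
      fix j assume j: "j < length (d (Suc i))"
      have "col (B * \<phi> i) j = B *\<^sub>v col (\<phi> i) j" by (rule col_mult2[OF Bc \<phi>c j])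
      also have "col (\<phi> i) j = \<phi> i *\<^sub>v unit_vec (length (d (Suc i))) j"
        using mat_unit_vec_col[OF \<phi>c j] by simp
      also have "\<phi> i *\<^sub>v unit_vec (length (d (Suc i))) j \<in> cycles Z \<phi> i"
        unfolding exact_complexD(3)[OF ex] by simp
      then have "B *\<^sub>v (\<phi> i *\<^sub>v unit_vec (length (d (Suc i))) j) \<in> cycles Z' \<psi> i"
        using P by (simp add: P_def)
      finally show "col (B * \<phi> i) j \<in> (\<lambda>v. \<psi> i *\<^sub>v v) ` carrier_vec (length (d' (Suc i)))"
        unfolding exact_complexD(3)[OF ex'] .
    qed (rule exact_complexD(1)[OF ex'])
    then obtain X where X: "graded_mat w (d' (Suc i)) (d (Suc i)) X" "B * \<phi> i = \<psi> i * X" by blast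
    note Xc = graded_mat_carrier[OF X(1)]
    have "X *\<^sub>v v \<in> mat_kernel (\<psi> i)" if v: "v \<in> mat_kernel (\<phi> i)" for v
    proof (rule mat_kernelI[OF \<psi>c])
      have vc: "v \<in> carrier_vec (length (d (Suc i)))" and v0: "\<phi> i *\<^sub>v v = 0\<^sub>v (length (d i))"
        using mat_kernelD[OF \<phi>c v] by auto
      show "X *\<^sub>v v \<in> carrier_vec (length (d' (Suc i)))" using Xc vc by simp
      have "\<psi> i *\<^sub>v (X *\<^sub>v v) = (\<psi> i * X) *\<^sub>v v" by (rule assoc_mult_mat_vec[OF \<psi>c Xc vc, symmetric])
      also have "\<dots> = B *\<^sub>v (\<phi> i *\<^sub>v v)" using assoc_mult_mat_vec[OF Bc \<phi>c vc] X(2) by simp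
      also have "\<dots> = 0\<^sub>v (length (d' i))" using Bc v0 by auto
      finally show "\<psi> i *\<^sub>v (X *\<^sub>v v) = 0\<^sub>v (length (d' i))" .
    qed
    then have "P (Suc i) X" using X by (simp add: P_def cycles_def)
    then show "\<exists>X. P (Suc i) X \<and> \<psi> i * X = B * \<phi> i" using X by metis
  qed
  then obtain A where A: "\<And>i. P i (A i)" "\<And>i. \<psi> i * A (Suc i) = A i * \<phi> i" by blast
  then show ?thesis by (intro exI[of _ A]) (auto simp: P_def)
qed

lemma exact_complex_mult_zero:
  assumes ex: "exact_complex w Z d \<phi>"
  shows "\<phi> i * \<phi> (Suc i) = 0\<^sub>m (length (d i)) (length (d (Suc (Suc i))))"
proof (rule mat_col_eqI)
  note \<phi>c = exact_complexD(2)[OF ex]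
  fix j assume "j < dim_col (0\<^sub>m (length (d i)) (length (d (Suc (Suc i)))))"
  then have j: "j < length (d (Suc (Suc i)))" by simp
  have "col (\<phi> i * \<phi> (Suc i)) j = \<phi> i *\<^sub>v (\<phi> (Suc i) *\<^sub>v unit_vec (length (d (Suc (Suc i)))) j)"
    using col_mult2[OF \<phi>c \<phi>c j] mat_unit_vec_col[OF \<phi>c j] by simp
  also have "\<dots> = 0\<^sub>v (length (d i))" by (rule exact_complex_comp_zero[OF ex]) simp
  finally show "col (\<phi> i * \<phi> (Suc i)) j = col (0\<^sub>m (length (d i)) (length (d (Suc (Suc i))))) j"
    using j by simp
qed (use exact_complexD(2)[OF ex] in auto)

text \<open>
  The homotopy \<open>h\<close> is built by lifting \<open>C (Suc i) - h i * \<phi> i\<close> through \<open>\<phi> (Suc i)\<close>, which is possible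
  because \<open>\<phi> i\<close> kills it.
\<close>

lemma null_homotopy_exists:
  fixes \<phi> C :: "nat \<Rightarrow> ('m::comm_monoid_add \<Rightarrow>\<^sub>0 'k::comm_ring_1) mat"
  assumes ex: "exact_complex w Z d \<phi>"
    and C: "\<And>i. C i \<in> carrier_mat (length (d i)) (length (d i))"
    and comm: "\<And>i. \<phi> i * C (Suc i) = C i * \<phi> i"
    and C0: "\<And>j. j < length (d 0) \<Longrightarrow> col (C 0) j \<in> Z"
  shows "\<exists>h. (\<forall>i. h i \<in> carrier_mat (length (d (Suc i))) (length (d i))) \<and> C 0 = \<phi> 0 * h 0 \<and>
    (\<forall>i. C (Suc i) = \<phi> (Suc i) * h (Suc i) + h i * \<phi> i)"
proof -
  note \<phi>c = exact_complexD(2)[OF ex]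
  let ?n = "\<lambda>i. length (d i)"
  define P where "P i h \<longleftrightarrow> h \<in> carrier_mat (?n (Suc i)) (?n i) \<and> (i = 0 \<longrightarrow> C 0 = \<phi> 0 * h) \<and>
    \<phi> i * (h * \<phi> i) = C i * \<phi> i" for i h
  have "\<exists>h. \<forall>i. P i (h i) \<and> C (Suc i) = \<phi> (Suc i) * h (Suc i) + h i * \<phi> i"
  proof (rule dependent_nat_choice)
    have "\<exists>X\<in>carrier_mat (?n (Suc 0)) (?n 0). C 0 = \<phi> 0 * X"
      using C0 exact_complexD(3)[OF ex, of 0] by (intro lift_mat[OF \<phi>c C]) (simp add: cycles_def)
    then obtain X where X: "X \<in> carrier_mat (?n (Suc 0)) (?n 0)" "C 0 = \<phi> 0 * X" by blast
    then show "\<exists>h. P 0 h" using assoc_mult_mat[OF \<phi>c X(1) \<phi>c] by (auto simp: P_def)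
    fix h i assume P: "P i h"
    then have h: "h \<in> carrier_mat (?n (Suc i)) (?n i)" and eq: "\<phi> i * (h * \<phi> i) = C i * \<phi> i"
      by (auto simp: P_def)
    have h\<phi>: "h * \<phi> i \<in> carrier_mat (?n (Suc i)) (?n (Suc i))" using h \<phi>c by (rule mult_carrier_mat)
    let ?D = "C (Suc i) - h * \<phi> i"
    have Dc: "?D \<in> carrier_mat (?n (Suc i)) (?n (Suc i))" using h\<phi> by (rule minus_carrier_mat)
    have D0: "\<phi> i * ?D = 0\<^sub>m (?n i) (?n (Suc i))"
    proof -
      have "\<phi> i * ?D = C i * \<phi> i - C i * \<phi> i"
        using mult_minus_distrib_mat[OF \<phi>c C h\<phi>] comm[of i] eq by simp
      also have "\<dots> = 0\<^sub>m (?n i) (?n (Suc i))"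
        using mult_carrier_mat[OF C[of i] \<phi>c[of i]] by (rule minus_r_inv_mat)
      finally show ?thesis .
    qed
    have "\<exists>X\<in>carrier_mat (?n (Suc (Suc i))) (?n (Suc i)). ?D = \<phi> (Suc i) * X"
    proof (rule lift_mat[OF \<phi>c Dc])
      fix j assume j: "j < ?n (Suc i)"
      have "col ?D j \<in> mat_kernel (\<phi> i)"
      proof (rule mat_kernelI[OF \<phi>c])
        show "col ?D j \<in> carrier_vec (?n (Suc i))" using Dc j by auto
        show "\<phi> i *\<^sub>v col ?D j = 0\<^sub>v (?n i)"
          using col_mult2[OF \<phi>c Dc j] D0 j by simp
      qed
      then show "col ?D j \<in> (\<lambda>v. \<phi> (Suc i) *\<^sub>v v) ` carrier_vec (?n (Suc (Suc i)))"
        using exact_complexD(3)[OF ex, of "Suc i"] by (simp add: cycles_def)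
    qed
    then obtain X where X: "X \<in> carrier_mat (?n (Suc (Suc i))) (?n (Suc i))" "?D = \<phi> (Suc i) * X" by blast
    have \<phi>X: "\<phi> (Suc i) * X \<in> carrier_mat (?n (Suc i)) (?n (Suc i))" using \<phi>c X(1) by (rule mult_carrier_mat)
    have Ceq: "C (Suc i) = \<phi> (Suc i) * X + h * \<phi> i"
    proof -
      have "C (Suc i) = ?D + h * \<phi> i" using C[of "Suc i"] h\<phi> by (intro eq_matI) auto
      then show ?thesis using X(2) by simp
    qed
    have "\<phi> (Suc i) * (X * \<phi> (Suc i)) = C (Suc i) * \<phi> (Suc i)"
    proof -
      have "h * \<phi> i * \<phi> (Suc i) = h * 0\<^sub>m (?n i) (?n (Suc (Suc i)))"
        using assoc_mult_mat[OF h \<phi>c \<phi>c] exact_complex_mult_zero[OF ex] by simp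
      also have "\<dots> = 0\<^sub>m (?n (Suc i)) (?n (Suc (Suc i)))" using h by simp
      finally have z: "h * \<phi> i * \<phi> (Suc i) = 0\<^sub>m (?n (Suc i)) (?n (Suc (Suc i)))" .
      have "C (Suc i) * \<phi> (Suc i) = \<phi> (Suc i) * X * \<phi> (Suc i) + h * \<phi> i * \<phi> (Suc i)"
        unfolding Ceq by (rule add_mult_distrib_mat[OF \<phi>X h\<phi> \<phi>c])
      also have "\<dots> = \<phi> (Suc i) * X * \<phi> (Suc i)"
        unfolding z using mult_carrier_mat[OF \<phi>X \<phi>c] by (rule right_add_zero_mat)
      finally show ?thesis using assoc_mult_mat[OF \<phi>c X(1) \<phi>c] by simp
    qed
    then have "P (Suc i) X" using X by (simp add: P_def)
    then show "\<exists>X. P (Suc i) X \<and> C (Suc i) = \<phi> (Suc i) * X + h * \<phi> i" using Ceq by blast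
  qed
  then obtain h where "\<And>i. P i (h i)" "\<And>i. C (Suc i) = \<phi> (Suc i) * h (Suc i) + h i * \<phi> i" by blast
  then show ?thesis by (intro exI[of _ h]) (auto simp: P_def)
qed

section \<open>Uniqueness of graded Betti numbers\<close>

abbreviation tdeg :: "('v::finite \<Rightarrow>\<^sub>0 nat) \<Rightarrow> int" where "tdeg m \<equiv> int (monomial_degree m)"

lemma monomial_degree_add: "monomial_degree (m + m') = monomial_degree m + monomial_degree m'"
  by (simp add: monomial_degree_def lookup_add sum.distrib)

lemma tdeg_add: "tdeg (m + m') = tdeg m + tdeg m'"
  by (simp add: monomial_degree_add)

lemma lookup_zero_mult:
  fixes p q :: "('v, 'k::field) mpoly"
  shows "Poly_Mapping.lookup (p * q) 0 = Poly_Mapping.lookup p 0 * Poly_Mapping.lookup q 0"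
proof -
  let ?r = "filter_terms (\<lambda>m. m \<noteq> 0) p"
  have "p = filter_terms (\<lambda>m. m = 0) p + ?r" by (rule filter_terms_split)
  also have "filter_terms (\<lambda>m. m = 0) p = Poly_Mapping.single 0 (Poly_Mapping.lookup p 0)"
    by (rule poly_mapping_eqI) (simp add: lookup_filter_terms lookup_single when_def)
  finally have "p * q = Poly_Mapping.single 0 (Poly_Mapping.lookup p 0) * q + ?r * q"
    by (metis distrib_right)
  moreover have "0 \<notin> Poly_Mapping.keys (?r * q)"
  proof
    assume "0 \<in> Poly_Mapping.keys (?r * q)"
    then obtain m m' where "m + m' = 0" "m \<in> Poly_Mapping.keys ?r" using keys_mult[of ?r q] by force
    then show False
      using keys_add_nat[of m m'] by (auto simp: keys_filter_terms)
  qed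
  ultimately show ?thesis by (simp add: lookup_add lookup_const_mult in_keys_iff)
qed

lemma card_index_eq_count_list: "card {a. a < length xs \<and> xs ! a = j} = count_list xs j"
  by (simp add: count_list_eq_length_filter length_filter_conv_card eq_commute)

text \<open>
  The constant coefficients of \<open>A\<close> and \<open>B\<close> connect only basis elements of equal degree. In degree \<open>j\<close> they
  form matrices over the field whose product is the identity, so the size of the identity matrix is at most the
  inner dimension.
\<close>

lemma graded_retract_count_le:
  fixes A B :: "('v::finite, 'k::field) mpoly mat" and d d' :: "int list"
  assumes A: "graded_mat tdeg d' d A" and B: "graded_mat tdeg d d' B"
    and id: "\<And>a b. a < length d \<Longrightarrow> b < length d \<Longrightarrow>
      Poly_Mapping.lookup ((B * A) $$ (a, b)) 0 = (if a = b then 1 else 0)"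
  shows "count_list d j \<le> count_list d' j"
proof (rule ccontr)
  let ?S = "{a. a < length d \<and> d ! a = j}" and ?S' = "{b. b < length d' \<and> d' ! b = j}"
  let ?A = "\<lambda>b a. Poly_Mapping.lookup (A $$ (b, a)) 0" and ?B = "\<lambda>a b. Poly_Mapping.lookup (B $$ (a, b)) 0"
  note Ac = graded_mat_carrier[OF A] and Bc = graded_mat_carrier[OF B]
  assume "\<not> count_list d j \<le> count_list d' j"
  then have "card ?S' < card ?S" by (simp add: card_index_eq_count_list)
  then obtain c where c: "\<exists>a\<in>?S. c a \<noteq> 0" "\<And>b. b \<in> ?S' \<Longrightarrow> (\<Sum>a\<in>?S. c a * ?A b a) = 0"
    using exists_nontrivial_relation[of ?S' ?S "\<lambda>a b. ?A b a"] by auto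
  have A0: "?A b a = 0" if "a \<in> ?S" "b < length d'" "b \<notin> ?S'" for a b
  proof (rule ccontr)
    assume "?A b a \<noteq> 0"
    then have "0 \<in> Poly_Mapping.keys (A $$ (b, a))" by (simp add: in_keys_iff)
    then have "tdeg (0 :: 'v \<Rightarrow>\<^sub>0 nat) + d' ! b = d ! a"
      using A that unfolding graded_mat_def homogeneous_entry_def by blast
    then show False using that by (simp add: monomial_degree_def)
  qed
  have "c a = 0" if a: "a \<in> ?S" for a
  proof -
    have "c a = (\<Sum>a'\<in>?S. c a' * (if a = a' then 1 else 0))"
      using a by (simp add: if_distrib sum.delta cong: if_cong)
    also have "\<dots> = (\<Sum>a'\<in>?S. c a' * (\<Sum>b<length d'. ?B a b * ?A b a'))"
    proof (rule sum.cong)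
      fix a' assume a': "a' \<in> ?S"
      have "(if a = a' then 1 else 0) = Poly_Mapping.lookup ((B * A) $$ (a, a')) 0"
        using id[of a a'] a a' by simp
      also have "\<dots> = (\<Sum>b<length d'. ?B a b * ?A b a')"
        using a a' by (simp add: mult_mat_entry[OF Bc Ac] lookup_sum lookup_zero_mult del: index_mult_mat)
      finally show "c a' * (if a = a' then 1 else 0) = c a' * (\<Sum>b<length d'. ?B a b * ?A b a')" by simp
    qed simp
    also have "\<dots> = (\<Sum>b<length d'. ?B a b * (\<Sum>a'\<in>?S. c a' * ?A b a'))"
      unfolding sum_distrib_left by (subst sum.swap) (simp add: mult_ac)
    also have "\<dots> = 0"
    proof (rule sum.neutral, rule ballI)
      fix b assume b: "b \<in> {..<length d'}"
      have "(\<Sum>a'\<in>?S. c a' * ?A b a') = 0"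
      proof (cases "b \<in> ?S'")
        case False
        then show ?thesis using A0 b by (intro sum.neutral) simp
      qed (rule c(2))
      then show "?B a b * (\<Sum>a'\<in>?S. c a' * ?A b a') = 0" by simp
    qed
    finally show ?thesis .
  qed
  then show False using c(1) by blast
qed

definition homogeneous_ideal :: "('v::finite, 'k::field) mpoly set \<Rightarrow> bool" where
  "homogeneous_ideal I \<longleftrightarrow> is_ideal I \<and> (\<forall>p\<in>I. \<forall>j. filter_terms (\<lambda>m. tdeg m = j) p \<in> I)"

definition augmentation_kernel :: "'a::comm_ring_1 set \<Rightarrow> nat \<Rightarrow> 'a vec \<Rightarrow> 'a vec set" where
  "augmentation_kernel I n \<epsilon> = {v \<in> carrier_vec n. \<epsilon> \<bullet> v \<in> I}"

lemma homogeneous_of_degree_iff: "homogeneous_of_degree (f - e) p \<longleftrightarrow> homogeneous_entry tdeg e f p"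
  by (auto simp: homogeneous_of_degree_def homogeneous_entry_def)

lemma graded_free_resolution_iff:
  "graded_free_resolution I d \<epsilon> \<phi> \<longleftrightarrow>
     \<epsilon> \<in> carrier_vec (length (d 0)) \<and>
     (\<forall>a<length (d 0). homogeneous_of_degree (d 0 ! a) (\<epsilon> $ a)) \<and>
     (\<forall>p. \<exists>v\<in>carrier_vec (length (d 0)). p - \<epsilon> \<bullet> v \<in> I) \<and>
     exact_complex tdeg (augmentation_kernel I (length (d 0)) \<epsilon>) d \<phi>"
proof -
  have split: "(\<forall>i. Q i) \<longleftrightarrow> Q 0 \<and> (\<forall>i. Q (Suc i))" for Q :: "nat \<Rightarrow> bool" 
    by (metis not0_implies_Suc)
  have "(\<forall>i. cycles (augmentation_kernel I (length (d 0)) \<epsilon>) \<phi> i = (\<lambda>v. \<phi> i *\<^sub>v v) ` carrier_vec (length (d (Suc i)))) \<longleftrightarrow>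
    {v \<in> carrier_vec (length (d 0)). \<epsilon> \<bullet> v \<in> I} = (\<lambda>w. \<phi> 0 *\<^sub>v w) ` carrier_vec (length (d 1)) \<and>
     (\<forall>i. mat_kernel (\<phi> i) = (\<lambda>w. \<phi> (Suc i) *\<^sub>v w) ` carrier_vec (length (d (Suc (Suc i)))))"
    by (subst split) (simp add: cycles_def augmentation_kernel_def)
  then show ?thesis
    unfolding graded_free_resolution_def exact_complex_def graded_mat_def homogeneous_of_degree_iff
    by (simp only: all_conj_distrib conj_assoc) argo
qed

lemma scalar_prod_mult_mat_vec:
  fixes \<epsilon> v :: "'r::comm_ring_1 vec"
  assumes "\<epsilon> \<in> carrier_vec n" "A \<in> carrier_mat n k" "v \<in> carrier_vec k"
  shows "\<epsilon> \<bullet> (A *\<^sub>v v) = (\<Sum>a<k. v $ a * (\<epsilon> \<bullet> col A a))"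
proof -
  have "\<epsilon> \<bullet> (A *\<^sub>v v) = (\<Sum>b<n. \<epsilon> $ b * (\<Sum>a<k. A $$ (b, a) * v $ a))"
    using assms by (simp add: scalar_prod_def atLeast0LessThan)
  also have "\<dots> = (\<Sum>a<k. \<Sum>b<n. v $ a * (\<epsilon> $ b * A $$ (b, a)))"
    unfolding sum_distrib_left by (subst sum.swap) (simp add: mult_ac)
  also have "\<dots> = (\<Sum>a<k. v $ a * (\<epsilon> \<bullet> col A a))"
    using assms by (simp add: scalar_prod_def atLeast0LessThan sum_distrib_left)
  finally show ?thesis .
qed

text \<open>
  Lift each basis element along the augmentation and keep the component of its degree; since \<open>I\<close> is
  homogeneous, the congruence modulo \<open>I\<close> survives.
\<close>

lemma augmented_lift_exists:
  fixes I :: "('v::finite, 'k::field) mpoly set" and d d' :: "int list"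
  assumes I: "homogeneous_ideal I"
    and \<epsilon>: "\<epsilon> \<in> carrier_vec (length d)" "\<And>a. a < length d \<Longrightarrow> homogeneous_of_degree (d ! a) (\<epsilon> $ a)"
    and \<epsilon>': "\<epsilon>' \<in> carrier_vec (length d')" "\<And>a. a < length d' \<Longrightarrow> homogeneous_of_degree (d' ! a) (\<epsilon>' $ a)"
    and surj: "\<And>p. \<exists>v\<in>carrier_vec (length d'). p - \<epsilon>' \<bullet> v \<in> I"
  shows "\<exists>A. graded_mat tdeg d' d A \<and> (\<forall>v\<in>carrier_vec (length d). \<epsilon>' \<bullet> (A *\<^sub>v v) - \<epsilon> \<bullet> v \<in> I)"
proof -
  have ideal: "is_ideal I" using I by (simp add: homogeneous_ideal_def)
  obtain u where u: "\<And>a. u a \<in> carrier_vec (length d')" "\<And>a. \<epsilon> $ a - \<epsilon>' \<bullet> u a \<in> I"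
  proof -
    have "\<forall>a. \<exists>v. v \<in> carrier_vec (length d') \<and> \<epsilon> $ a - \<epsilon>' \<bullet> v \<in> I" using surj by blast
    then show ?thesis using that by (metis (no_types, lifting))
  qed
  define A where "A = mat (length d') (length d) (\<lambda>(b, a). filter_terms (\<lambda>m. tdeg m + d' ! b = d ! a) (u a $ b))"
  have Ac: "A \<in> carrier_mat (length d') (length d)" by (simp add: A_def)
  have "graded_mat tdeg d' d A"
    using Ac by (simp add: graded_mat_def homogeneous_entry_def A_def keys_filter_terms)
  moreover have col: "\<epsilon> $ a - \<epsilon>' \<bullet> col A a \<in> I" if a: "a < length d" for a
  proof -
    let ?Q = "\<lambda>m :: 'v \<Rightarrow>\<^sub>0 nat. tdeg m = d ! a"
    have "filter_terms ?Q (\<epsilon>' \<bullet> u a) = (\<Sum>b<length d'. filter_terms ?Q (\<epsilon>' $ b * u a $ b))"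
      using u(1)[of a] by (simp add: scalar_prod_def filter_terms_sum atLeast0LessThan)
    also have "\<dots> = (\<Sum>b<length d'. \<epsilon>' $ b * A $$ (b, a))"
    proof (rule sum.cong)
      fix b assume b: "b \<in> {..<length d'}"
      have "filter_terms ?Q (\<epsilon>' $ b * u a $ b) = \<epsilon>' $ b * filter_terms (\<lambda>m. tdeg m + d' ! b = d ! a) (u a $ b)"
      proof (rule filter_terms_mult)
        fix m m' assume "m \<in> Poly_Mapping.keys (\<epsilon>' $ b)"
        then have "tdeg m = d' ! b" using \<epsilon>'(2)[of b] b by (simp add: homogeneous_of_degree_def)
        then show "?Q (m + m') \<longleftrightarrow> tdeg m' + d' ! b = d ! a" by (auto simp: tdeg_add)
      qed
      then show "filter_terms ?Q (\<epsilon>' $ b * u a $ b) = \<epsilon>' $ b * A $$ (b, a)" using a b by (simp add: A_def)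
    qed simp
    also have "\<dots> = \<epsilon>' \<bullet> col A a" using Ac a by (simp add: scalar_prod_def atLeast0LessThan)
    finally have "filter_terms ?Q (\<epsilon>' \<bullet> u a) = \<epsilon>' \<bullet> col A a" .
    moreover have "filter_terms ?Q (\<epsilon> $ a) = \<epsilon> $ a"
      using \<epsilon>(2)[OF a] by (intro filter_terms_id) (simp add: homogeneous_of_degree_def)
    moreover have "filter_terms ?Q (\<epsilon> $ a) = filter_terms ?Q (\<epsilon> $ a - \<epsilon>' \<bullet> u a) + filter_terms ?Q (\<epsilon>' \<bullet> u a)"
      by (simp flip: filter_terms_add)
    ultimately have "\<epsilon> $ a = filter_terms ?Q (\<epsilon> $ a - \<epsilon>' \<bullet> u a) + \<epsilon>' \<bullet> col A a" by simp
    then have "\<epsilon> $ a - \<epsilon>' \<bullet> col A a = filter_terms ?Q (\<epsilon> $ a - \<epsilon>' \<bullet> u a)" by (rule diff_eq_eq[THEN iffD2])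
    then show ?thesis using I u(2)[of a] by (simp add: homogeneous_ideal_def)
  qed
  moreover have "\<epsilon>' \<bullet> (A *\<^sub>v v) - \<epsilon> \<bullet> v \<in> I" if v: "v \<in> carrier_vec (length d)" for v
  proof -
    have "\<epsilon>' \<bullet> (A *\<^sub>v v) - \<epsilon> \<bullet> v = (\<Sum>a<length d. - v $ a * (\<epsilon> $ a - \<epsilon>' \<bullet> col A a))"
      unfolding scalar_prod_mult_mat_vec[OF \<epsilon>'(1) Ac v]
      using v by (simp add: scalar_prod_def[of \<epsilon>] atLeast0LessThan sum_subtractf right_diff_distrib mult.commute sum_negf)
    also have "\<dots> \<in> I" using col by (intro is_ideal_sum is_ideal_mult ideal) auto
    finally show ?thesis .
  qed
  ultimately show ?thesis by blast
qed

text \<open>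
  Comparison maps \<open>A\<close> and \<open>B\<close> between the two resolutions compose to a map that is homotopic to the identity.
  The homotopy formula has a factor \<open>\<phi>\<close> in each term, and the entries of \<open>\<phi>\<close> have no constant term by
  minimality. Hence \<open>B * A\<close> is the identity up to entries without constant term.
\<close>

lemma betti_le:
  fixes I :: "('v::finite, 'k::field) mpoly set"
  assumes I: "homogeneous_ideal I"
    and min: "minimal_graded_free_resolution I d \<epsilon> \<phi>" and res': "graded_free_resolution I d' \<epsilon>' \<phi>'"
  shows "count_list (d i) j \<le> count_list (d' i) j"
proof -
  let ?Z = "augmentation_kernel I (length (d 0)) \<epsilon>" and ?Z' = "augmentation_kernel I (length (d' 0)) \<epsilon>'"
  let ?n = "\<lambda>i. length (d i)" and ?n' = "\<lambda>i. length (d' i)"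
  have ideal: "is_ideal I" using I by (simp add: homogeneous_ideal_def)
  have res: "graded_free_resolution I d \<epsilon> \<phi>" using min by (simp add: minimal_graded_free_resolution_def)
  note r = res[unfolded graded_free_resolution_iff] and r' = res'[unfolded graded_free_resolution_iff]
  have ex: "exact_complex tdeg ?Z d \<phi>" and ex': "exact_complex tdeg ?Z' d' \<phi>'" using r r' by auto
  note \<phi>c = exact_complexD(2)[OF ex] and \<phi>'c = exact_complexD(2)[OF ex']
  obtain A0 where A0: "graded_mat tdeg (d' 0) (d 0) A0"
    "\<And>v. v \<in> carrier_vec (?n 0) \<Longrightarrow> \<epsilon>' \<bullet> (A0 *\<^sub>v v) - \<epsilon> \<bullet> v \<in> I"
    using augmented_lift_exists[OF I, of \<epsilon> "d 0" \<epsilon>' "d' 0"] r r' by auto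
  obtain B0 where B0: "graded_mat tdeg (d 0) (d' 0) B0"
    "\<And>v. v \<in> carrier_vec (?n' 0) \<Longrightarrow> \<epsilon> \<bullet> (B0 *\<^sub>v v) - \<epsilon>' \<bullet> v \<in> I"
    using augmented_lift_exists[OF I, of \<epsilon>' "d' 0" \<epsilon> "d 0"] r r' by auto
  have A0Z: "A0 *\<^sub>v v \<in> ?Z'" if "v \<in> ?Z" for v
    using that A0(2)[of v] is_ideal_add[OF ideal, of "\<epsilon>' \<bullet> (A0 *\<^sub>v v) - \<epsilon> \<bullet> v" "\<epsilon> \<bullet> v"] graded_mat_carrier[OF A0(1)]
    by (auto simp: augmentation_kernel_def)
  have B0Z: "B0 *\<^sub>v v \<in> ?Z" if "v \<in> ?Z'" for v
    using that B0(2)[of v] is_ideal_add[OF ideal, of "\<epsilon> \<bullet> (B0 *\<^sub>v v) - \<epsilon>' \<bullet> v" "\<epsilon>' \<bullet> v"] graded_mat_carrier[OF B0(1)]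
    by (auto simp: augmentation_kernel_def)
  obtain A where A: "A 0 = A0" "\<And>i. graded_mat tdeg (d' i) (d i) (A i)" "\<And>i. \<phi>' i * A (Suc i) = A i * \<phi> i"
    using chain_map_exists[OF tdeg_add ex ex' A0(1) A0Z] by blast
  obtain B where B: "B 0 = B0" "\<And>i. graded_mat tdeg (d i) (d' i) (B i)" "\<And>i. \<phi> i * B (Suc i) = B i * \<phi>' i"
    using chain_map_exists[OF tdeg_add ex' ex B0(1) B0Z] by blast
  note Ac = graded_mat_carrier[OF A(2)] and Bc = graded_mat_carrier[OF B(2)]
  have BAc: "B i * A i \<in> carrier_mat (?n i) (?n i)" for i using Bc Ac by (rule mult_carrier_mat)
  define C where "C i = B i * A i - 1\<^sub>m (?n i)" for i
  have Cc: "C i \<in> carrier_mat (?n i) (?n i)" for i unfolding C_def by (rule minus_carrier_mat) simp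
  have comm: "\<phi> i * C (Suc i) = C i * \<phi> i" for i
  proof -
    have "\<phi> i * (B (Suc i) * A (Suc i)) = B i * \<phi>' i * A (Suc i)"
      using assoc_mult_mat[OF \<phi>c Bc Ac] B(3) by simp
    also have "\<dots> = B i * A i * \<phi> i"
      using assoc_mult_mat[OF Bc \<phi>'c Ac] assoc_mult_mat[OF Bc Ac \<phi>c] A(3) by simp
    finally have "\<phi> i * (B (Suc i) * A (Suc i)) = B i * A i * \<phi> i" .
    then show ?thesis
      unfolding C_def mult_minus_distrib_mat[OF \<phi>c BAc one_carrier_mat]
        minus_mult_distrib_mat[OF BAc one_carrier_mat \<phi>c] using \<phi>c[of i] by simp
  qed
  have C0: "col (C 0) j \<in> ?Z" if j: "j < ?n 0" for j
  proof -
    let ?e = "unit_vec (?n 0) j :: ('v, 'k) mpoly vec"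
    have e: "?e \<in> carrier_vec (?n 0)" by simp
    have Ae: "A0 *\<^sub>v ?e \<in> carrier_vec (?n' 0)" using graded_mat_carrier[OF A0(1)] by simp
    have BAe: "B0 *\<^sub>v (A0 *\<^sub>v ?e) \<in> carrier_vec (?n 0)" using graded_mat_carrier[OF B0(1)] Ae by simp
    have "col (C 0) j = C 0 *\<^sub>v ?e" by (rule mat_unit_vec_col[OF Cc j, symmetric])
    also have "\<dots> = B0 *\<^sub>v (A0 *\<^sub>v ?e) - ?e"
      unfolding C_def minus_mult_distrib_mat_vec[OF BAc one_carrier_mat e]
      using assoc_mult_mat_vec[OF Bc Ac e] A(1) B(1) by simp
    finally have col: "col (C 0) j = B0 *\<^sub>v (A0 *\<^sub>v ?e) - ?e" .
    have "\<epsilon> \<bullet> (B0 *\<^sub>v (A0 *\<^sub>v ?e) - ?e) = 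
      (\<epsilon> \<bullet> (B0 *\<^sub>v (A0 *\<^sub>v ?e)) - \<epsilon>' \<bullet> (A0 *\<^sub>v ?e)) + (\<epsilon>' \<bullet> (A0 *\<^sub>v ?e) - \<epsilon> \<bullet> ?e)"
      using r by (simp add: scalar_prod_minus_distrib[OF _ BAe e])
    also have "\<dots> \<in> I" using A0(2)[OF e] B0(2)[OF Ae] by (rule is_ideal_add[OF ideal, rotated])
    finally show ?thesis using BAe by (simp add: col augmentation_kernel_def)
  qed
  obtain h where h: "\<And>i. h i \<in> carrier_mat (?n (Suc i)) (?n i)" "C 0 = \<phi> 0 * h 0"
    "\<And>i. C (Suc i) = \<phi> (Suc i) * h (Suc i) + h i * \<phi> i"
    using null_homotopy_exists[OF ex Cc comm C0] by blast
  have \<phi>0: "Poly_Mapping.lookup (\<phi> i $$ (a, b)) 0 = 0" if "a < ?n i" "b < ?n (Suc i)" for i a b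
    using min that by (simp add: minimal_graded_free_resolution_def graded_maximal_ideal_iff)
  have \<phi>h: "Poly_Mapping.lookup ((\<phi> i * h i) $$ (a, b)) 0 = 0" if "a < ?n i" "b < ?n i" for i a b
    using that by (simp add: mult_mat_entry[OF \<phi>c h(1)] lookup_sum lookup_zero_mult \<phi>0 del: index_mult_mat)
  have h\<phi>: "Poly_Mapping.lookup ((h i * \<phi> i) $$ (a, b)) 0 = 0" if "a < ?n (Suc i)" "b < ?n (Suc i)" for i a b
    using that by (simp add: mult_mat_entry[OF h(1) \<phi>c] lookup_sum lookup_zero_mult \<phi>0 del: index_mult_mat)
  have CK: "Poly_Mapping.lookup (C i $$ (a, b)) 0 = 0" if ab: "a < ?n i" "b < ?n i" for a b
  proof (cases i)
    case 0 then show ?thesis using \<phi>h ab h(2) by simp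
  next
    case (Suc k)
    have "C i $$ (a, b) = (\<phi> (Suc k) * h (Suc k)) $$ (a, b) + (h k * \<phi> k) $$ (a, b)"
      unfolding Suc h(3) using ab Suc mult_carrier_mat[OF h(1)[of k] \<phi>c[of k]]
      by (intro index_add_mat) auto
    then show ?thesis using \<phi>h[of a "Suc k" b] h\<phi>[of a k b] ab Suc by (simp add: lookup_add)
  qed
  show ?thesis
  proof (rule graded_retract_count_le[OF A(2) B(2)])
    fix a b assume ab: "a < ?n i" "b < ?n i"
    have "C i $$ (a, b) = (B i * A i) $$ (a, b) - (if a = b then 1 else 0)"
      unfolding C_def using ab BAc[of i] by (subst index_minus_mat) auto
    then show "Poly_Mapping.lookup ((B i * A i) $$ (a, b)) 0 = (if a = b then 1 else 0)"
      using CK[OF ab] by (auto simp: lookup_minus split: if_splits)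
  qed
qed

lemma graded_betti_eq:
  assumes "homogeneous_ideal I" "minimal_graded_free_resolution I d \<epsilon> \<phi>"
  shows "graded_betti I i j = count_list (d i) j"
  unfolding graded_betti_def
proof (rule the_equality)
  fix b assume "\<exists>d \<epsilon> \<phi>. minimal_graded_free_resolution I d \<epsilon> \<phi> \<and> count_list (d i) j = b"
  then obtain d' \<epsilon>' \<phi>' where "minimal_graded_free_resolution I d' \<epsilon>' \<phi>'" "count_list (d' i) j = b" by blast
  then show "b = count_list (d i) j"
    using assms betti_le by (metis antisym minimal_graded_free_resolution_def)
qed (use assms in blast)

section \<open>Multigraded resolutions and the mapping cone\<close>

text \<open>
  A resolution of \<open>S/I\<close> graded by monomials, with \<open>F\<^sub>0 = S\<close> and the canonical map \<open>S \<rightarrow> S/I\<close> as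
  augmentation.
\<close>

definition fine_resolution ::
  "('v::finite, 'k::field) mpoly set \<Rightarrow> (nat \<Rightarrow> ('v \<Rightarrow>\<^sub>0 nat) list) \<Rightarrow> (nat \<Rightarrow> ('v, 'k) mpoly mat) \<Rightarrow> bool" where
  "fine_resolution I d \<phi> \<longleftrightarrow> d 0 = [0] \<and> exact_complex (\<lambda>m. m) {v \<in> carrier_vec 1. v $ 0 \<in> I} d \<phi>"

definition cone_degrees ::
  "('v \<Rightarrow>\<^sub>0 nat) \<Rightarrow> (nat \<Rightarrow> ('v \<Rightarrow>\<^sub>0 nat) list) \<Rightarrow> (nat \<Rightarrow> ('v \<Rightarrow>\<^sub>0 nat) list) \<Rightarrow> nat \<Rightarrow> ('v \<Rightarrow>\<^sub>0 nat) list" where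
  "cone_degrees u d d' i = d i @ (case i of 0 \<Rightarrow> [] | Suc j \<Rightarrow> map ((+) u) (d' j))"

lemma mult_mat_uminus_vec:
  fixes A :: "'r::comm_ring_1 mat"
  assumes "A \<in> carrier_mat n k" "v \<in> carrier_vec k"
  shows "A *\<^sub>v (- v) = - (A *\<^sub>v v)"
  using assms by (intro eq_vecI) auto

text \<open>
  The cone of multiplication by the monomial \<open>x\<^sup>u\<close>, as a map from the shifted resolution of
  \<open>S/(I : x\<^sup>u)\<close> to the resolution of \<open>S/I\<close>. The comparison maps \<open>\<alpha>\<close> lift this multiplication, and the
  differentials of the cone are the block matrices \<open>\<chi> i\<close> with first row \<open>\<phi> i, \<alpha> i\<close> and second row
  \<open>0, - \<psi> (i - 1)\<close>.
\<close>

lemma mapping_cone: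
  fixes I :: "('v::finite, 'k::field) mpoly set"
  assumes I: "is_ideal I" and res: "fine_resolution I d \<phi>"
    and res': "fine_resolution (colon I (Poly_Mapping.single u 1)) d' \<psi>"
  shows "\<exists>\<chi>. fine_resolution (ideal_add I (Poly_Mapping.single u 1)) (cone_degrees u d d') \<chi>"
proof -
  let ?x = "Poly_Mapping.single u 1 :: ('v, 'k) mpoly"
  let ?n = "\<lambda>i. length (d i)" and ?n' = "\<lambda>i. length (d' i)"
  define Z where "Z = {v \<in> carrier_vec 1. v $ 0 \<in> I}"
  define Z' where "Z' = {v \<in> carrier_vec 1. v $ 0 \<in> colon I ?x}"
  define e where "e i = map ((+) u) (d' i)" for i
  have len_e: "length (e i) = ?n' i" for i by (simp add: e_def)
  have d0: "d 0 = [0]" "d' 0 = [0]" using res res' by (auto simp: fine_resolution_def)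
  have ex: "exact_complex (\<lambda>m. m) Z d \<phi>" using res by (simp add: fine_resolution_def Z_def)
  have ex0: "exact_complex (\<lambda>m. m) Z' d' \<psi>" using res' by (simp add: fine_resolution_def Z'_def)
  have shift: "graded_mat (\<lambda>m. m) (e i) (e (Suc i)) (\<psi> i)" for i
    using exact_complexD(1)[OF ex0, of i]
    by (auto simp: graded_mat_def homogeneous_entry_def e_def add.left_commute[of _ u])
  have ex': "exact_complex (\<lambda>m. m) Z' e \<psi>"
    unfolding exact_complex_def len_e using shift exact_complexD(3)[OF ex0] by blast
  note \<phi>c = exact_complexD(2)[OF ex] and \<psi>c = exact_complexD(2)[OF ex0]
  define \<alpha>0 where "\<alpha>0 = mat 1 1 (\<lambda>_. ?x)"
  have \<alpha>0_vec: "\<alpha>0 *\<^sub>v v = vec 1 (\<lambda>_. ?x * v $ 0)" if "v \<in> carrier_vec 1" for v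
    using that by (intro eq_vecI) (auto simp: \<alpha>0_def scalar_prod_def)
  have \<alpha>0: "graded_mat (\<lambda>m. m) (d 0) (e 0) \<alpha>0"
    by (simp add: graded_mat_def homogeneous_entry_def \<alpha>0_def d0 e_def)
  have "\<alpha>0 *\<^sub>v v \<in> Z" if "v \<in> Z'" for v
    using that \<alpha>0_vec[of v] by (simp add: Z_def Z'_def colon_def)
  then obtain \<alpha> where \<alpha>: "\<alpha> 0 = \<alpha>0" "\<And>i. graded_mat (\<lambda>m. m) (d i) (e i) (\<alpha> i)"
    "\<And>i. \<phi> i * \<alpha> (Suc i) = \<alpha> i * \<psi> i"
    using chain_map_exists[OF _ ex' ex \<alpha>0] by blast
  have \<alpha>c: "\<alpha> i \<in> carrier_mat (?n i) (?n' i)" for i using graded_mat_carrier[OF \<alpha>(2)] by (simp add: len_e)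
  define r where "r i = (case i of 0 \<Rightarrow> 0 | Suc j \<Rightarrow> ?n' j)" for i
  \<comment> \<open>The lower right block; for \<open>i = 0\<close> it has no rows.\<close>
  define L where "L i = (case i of 0 \<Rightarrow> 0\<^sub>m 0 (?n' 0) | Suc j \<Rightarrow> - \<psi> j)" for i
  have Lc: "L i \<in> carrier_mat (r i) (?n' i)" for i
    using \<psi>c by (auto simp: L_def r_def split: nat.split)
  define \<chi> where "\<chi> i = four_block_mat (\<phi> i) (\<alpha> i) (0\<^sub>m (r i) (?n (Suc i))) (L i)" for i
  let ?c = "cone_degrees u d d'"
  have len_c: "length (?c i) = ?n i + r i" for i
    by (auto simp: cone_degrees_def r_def split: nat.split)
  have r_Suc: "r (Suc i) = ?n' i" for i by (simp add: r_def)
  have \<chi>c: "\<chi> i \<in> carrier_mat (?n i + r i) (?n (Suc i) + ?n' i)" for i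
    unfolding \<chi>_def using \<phi>c Lc by (rule four_block_carrier_mat)
  have \<chi>_vec: "\<chi> i *\<^sub>v (x @\<^sub>v y) = (\<phi> i *\<^sub>v x + \<alpha> i *\<^sub>v y) @\<^sub>v (L i *\<^sub>v y)"
    if "x \<in> carrier_vec (?n (Suc i))" "y \<in> carrier_vec (?n' i)" for i x y
  proof -
    have "0\<^sub>m (r i) (?n (Suc i)) *\<^sub>v x + L i *\<^sub>v y = L i *\<^sub>v y"
      using that Lc[of i] by (intro eq_vecI) (auto simp: scalar_prod_def)
    then show ?thesis
      unfolding \<chi>_def using four_block_mat_mult_vec[OF \<phi>c \<alpha>c zero_carrier_mat Lc that] by simp
  qed
  have graded: "graded_mat (\<lambda>m. m) (?c i) (?c (Suc i)) (\<chi> i)" for i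
  proof -
    have "homogeneous_entry (\<lambda>m. m) (?c i ! a) (?c (Suc i) ! b) (\<chi> i $$ (a, b))"
      if a: "a < ?n i + r i" and b: "b < ?n (Suc i) + ?n' i" for a b
    proof -
      have entry: "\<chi> i $$ (a, b) = (if a < ?n i then if b < ?n (Suc i) then \<phi> i $$ (a, b) else \<alpha> i $$ (a, b - ?n (Suc i))
        else if b < ?n (Suc i) then 0 else L i $$ (a - ?n i, b - ?n (Suc i)))"
        unfolding \<chi>_def using a b \<phi>c[of i] Lc[of i] by auto
      have cb: "?c (Suc i) ! b = (if b < ?n (Suc i) then d (Suc i) ! b else e i ! (b - ?n (Suc i)))"
        by (simp add: cone_degrees_def nth_append e_def)
      show ?thesis
      proof (cases "a < ?n i")
        case True
        then have ca: "?c i ! a = d i ! a" by (simp add: cone_degrees_def nth_append)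
        show ?thesis
          using True b exact_complexD(1)[OF ex, of i] \<alpha>(2)[of i] unfolding entry ca cb
          by (auto simp: graded_mat_def len_e)
      next
        case False
        then obtain j where i: "i = Suc j" using a by (cases i) (auto simp: r_def)
        then have ca: "?c i ! a = e j ! (a - ?n i)"
          using False by (simp add: cone_degrees_def nth_append e_def)
        have lt: "a - ?n i < ?n' j" using a False i by (simp add: r_def)
        show ?thesis
        proof (cases "b < ?n (Suc i)")
          case True then show ?thesis using False by (simp add: entry homogeneous_entry_def)
        next
          case b': False
          then have lt': "b - ?n (Suc i) < ?n' (Suc j)" using b i by simp
          have "homogeneous_entry (\<lambda>m. m) (e j ! (a - ?n i)) (e (Suc j) ! (b - ?n (Suc i))) (\<psi> j $$ (a - ?n i, b - ?n (Suc i)))"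
            using shift[of j] lt lt' by (simp add: graded_mat_def len_e)
          moreover have "L i $$ (a - ?n i, b - ?n (Suc i)) = - \<psi> j $$ (a - ?n i, b - ?n (Suc i))"
            using lt lt' \<psi>c[of j] i by (simp add: L_def)
          ultimately show ?thesis
            unfolding entry ca cb using False b' arg_cong[OF i, of e]
            by (simp add: homogeneous_entry_def in_keys_iff)
        qed
      qed
    qed
    then show ?thesis using \<chi>c[of i] by (simp add: graded_mat_def len_c r_Suc)
  qed
  \<comment> \<open>For \<open>i = 0\<close> the block \<open>L\<close> imposes nothing; that the second component is a cycle then
    comes from the first row.\<close>
  have cycle_iff: "L i *\<^sub>v y = 0\<^sub>v (r i) \<and> (i = 0 \<longrightarrow> y $ 0 \<in> colon I ?x) \<longleftrightarrow> y \<in> cycles Z' \<psi> i"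
    if y: "y \<in> carrier_vec (?n' i)" for i y
  proof (cases i)
    case 0 
    have "L 0 *\<^sub>v y = 0\<^sub>v (r 0)" by (intro eq_vecI) (auto simp: L_def r_def)
    then show ?thesis using y 0 by (simp add: cycles_def Z'_def d0)
  next
    case (Suc j)
    have "- (\<psi> j *\<^sub>v y) = 0\<^sub>v (?n' j) \<longleftrightarrow> \<psi> j *\<^sub>v y = 0\<^sub>v (?n' j)"
      using \<psi>c[of j] by (metis carrier_matD(1) uminus_uminus_vec uminus_zero_vec)
    moreover have "L i *\<^sub>v y = - (\<psi> j *\<^sub>v y)" using y Suc \<psi>c[of j] by (simp add: L_def)
    ultimately show ?thesis
      using y Suc by (simp add: cycles_def mat_kernel[OF \<psi>c] r_def)
  qed
  have image: "(\<lambda>v. \<chi> i *\<^sub>v v) ` carrier_vec (length (?c (Suc i))) =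
    {\<chi> i *\<^sub>v (x @\<^sub>v y) | x y. x \<in> carrier_vec (?n (Suc i)) \<and> y \<in> carrier_vec (?n' i)}" for i
  proof -
    have "carrier_vec (?n (Suc i) + ?n' i) = {x @\<^sub>v y | x y. x \<in> carrier_vec (?n (Suc i)) \<and> (y :: ('v, 'k) mpoly vec) \<in> carrier_vec (?n' i)}"
      (is "?A = ?B")
    proof
      show "?A \<subseteq> ?B"
      proof
        fix v :: "('v, 'k) mpoly vec" assume v: "v \<in> ?A"
        show "v \<in> ?B"
          using vec_first_last_append[OF v, symmetric] vec_first_carrier vec_last_carrier by blast
      qed
      show "?B \<subseteq> ?A" by auto
    qed
    then show ?thesis unfolding len_c r_Suc by auto
  qed
  have exact: "cycles {v \<in> carrier_vec 1. v $ 0 \<in> ideal_add I ?x} \<chi> i = (\<lambda>v. \<chi> i *\<^sub>v v) ` carrier_vec (length (?c (Suc i)))" for i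
  proof (cases i)
    case 0
    have n0: "?n 0 = 1" "?n' 0 = 1" "r 0 = 0" by (simp_all add: d0 r_def)
    have "v \<in> (\<lambda>v. \<chi> 0 *\<^sub>v v) ` carrier_vec (length (?c (Suc 0)))"
      if v: "v \<in> carrier_vec 1" "v $ 0 \<in> ideal_add I ?x" for v
    proof -
      obtain a g where ag: "v $ 0 = a + ?x * g" "a \<in> I" using v(2) by (auto simp: ideal_add_def)
      have "vec 1 (\<lambda>_. a) \<in> cycles Z \<phi> 0" using ag by (simp add: cycles_def Z_def)
      then obtain x where x: "x \<in> carrier_vec (?n (Suc 0))" "vec 1 (\<lambda>_. a) = \<phi> 0 *\<^sub>v x"
        unfolding exact_complexD(3)[OF ex] by blast
      let ?y = "vec 1 (\<lambda>_. g)"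
      have y: "?y \<in> carrier_vec (?n' 0)" by (simp add: n0)
      have "\<chi> 0 *\<^sub>v (x @\<^sub>v ?y) = v"
        unfolding \<chi>_vec[OF x(1) y] \<alpha>(1) x(2)[symmetric]
        using v(1) Lc[of 0] ag(1) by (intro eq_vecI) (auto simp: n0 \<alpha>0_def scalar_prod_def)
      then show ?thesis unfolding image using x(1) y by blast
    qed
    moreover have "\<chi> 0 *\<^sub>v (x @\<^sub>v y) \<in> carrier_vec 1 \<and> (\<chi> 0 *\<^sub>v (x @\<^sub>v y)) $ 0 \<in> ideal_add I ?x"
      if x: "x \<in> carrier_vec (?n (Suc 0))" and y: "y \<in> carrier_vec (?n' 0)" for x y
    proof -
      have "\<phi> 0 *\<^sub>v x \<in> cycles Z \<phi> 0" unfolding exact_complexD(3)[OF ex] using x by blast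
      then have "\<phi> 0 *\<^sub>v x \<in> carrier_vec 1" "(\<phi> 0 *\<^sub>v x) $ 0 \<in> I" by (auto simp: cycles_def Z_def)
      moreover have "\<alpha> 0 *\<^sub>v y = vec 1 (\<lambda>_. ?x * y $ 0)" using y \<alpha>0_vec by (simp add: \<alpha>(1) n0)
      moreover have "dim_vec (L 0 *\<^sub>v y) = 0" using Lc[of 0] n0 by simp
      ultimately show ?thesis
        unfolding \<chi>_vec[OF x y] by (auto simp: ideal_add_def intro!: carrier_vecI)
    qed
    ultimately have "{v \<in> carrier_vec 1. v $ 0 \<in> ideal_add I ?x} = (\<lambda>v. \<chi> 0 *\<^sub>v v) ` carrier_vec (length (?c (Suc 0)))"
      unfolding image by blast
    then show ?thesis by (simp add: 0 cycles_def)
  next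
    case (Suc k)
    have "mat_kernel (\<chi> k) = (\<lambda>v. \<chi> (Suc k) *\<^sub>v v) ` carrier_vec (length (?c (Suc (Suc k))))"
    proof
      show "mat_kernel (\<chi> k) \<subseteq> (\<lambda>v. \<chi> (Suc k) *\<^sub>v v) ` carrier_vec (length (?c (Suc (Suc k))))"
      proof
        fix v assume v: "v \<in> mat_kernel (\<chi> k)"
        have vc: "v \<in> carrier_vec (?n (Suc k) + ?n' k)" and v0: "\<chi> k *\<^sub>v v = 0\<^sub>v (?n k + r k)"
          using mat_kernelD[OF \<chi>c v] by auto
        define x y where "x = vec_first v (?n (Suc k))" and "y = vec_last v (?n' k)"
        have xy: "x \<in> carrier_vec (?n (Suc k))" "y \<in> carrier_vec (?n' k)" "v = x @\<^sub>v y"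
          using vec_first_last_append[OF vc] by (simp_all add: x_def y_def)
        have c1: "\<phi> k *\<^sub>v x + \<alpha> k *\<^sub>v y \<in> carrier_vec (?n k)"
          using \<phi>c[of k] \<alpha>c[of k] xy by simp
        have "0\<^sub>v (?n k + r k) = 0\<^sub>v (?n k) @\<^sub>v (0\<^sub>v (r k) :: ('v, 'k) mpoly vec)" by (intro eq_vecI) auto
        then have "(\<phi> k *\<^sub>v x + \<alpha> k *\<^sub>v y) @\<^sub>v (L k *\<^sub>v y) = 0\<^sub>v (?n k) @\<^sub>v 0\<^sub>v (r k)"
          using v0 unfolding xy(3) \<chi>_vec[OF xy(1,2)] by simp
        then have eqs: "\<phi> k *\<^sub>v x + \<alpha> k *\<^sub>v y = 0\<^sub>v (?n k)" "L k *\<^sub>v y = 0\<^sub>v (r k)"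
          using append_vec_eq[OF c1 zero_carrier_vec] by auto
        have "y $ 0 \<in> colon I ?x" if "k = 0"
        proof -
          have "\<phi> 0 *\<^sub>v x \<in> cycles Z \<phi> 0" unfolding exact_complexD(3)[OF ex] using xy that by blast
          then have px: "\<phi> 0 *\<^sub>v x \<in> carrier_vec 1" "(\<phi> 0 *\<^sub>v x) $ 0 \<in> I" by (auto simp: cycles_def Z_def)
          have ay: "\<alpha> 0 *\<^sub>v y = vec 1 (\<lambda>_. ?x * y $ 0)" using xy that \<alpha>0_vec by (simp add: \<alpha>(1) d0)
          have "(\<phi> 0 *\<^sub>v x + \<alpha> 0 *\<^sub>v y) $ 0 = 0" using eqs(1) that by (simp add: d0)
          then have "(\<phi> 0 *\<^sub>v x) $ 0 + ?x * y $ 0 = 0" using px ay by simp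
          then have "?x * y $ 0 = - (\<phi> 0 *\<^sub>v x) $ 0" by (simp add: eq_neg_iff_add_eq_0 add.commute)
          then show ?thesis using is_ideal_uminus[OF I px(2)] by (simp add: colon_def)
        qed
        then have "y \<in> cycles Z' \<psi> k" using cycle_iff[OF xy(2)] eqs(2) by blast
        then obtain z where z: "z \<in> carrier_vec (?n' (Suc k))" "y = \<psi> k *\<^sub>v z"
          unfolding exact_complexD(3)[OF ex0] by blast
        have \<alpha>z: "\<alpha> (Suc k) *\<^sub>v z \<in> carrier_vec (?n (Suc k))" using \<alpha>c[of "Suc k"] z by simp
        have "\<alpha> k *\<^sub>v y = \<phi> k *\<^sub>v (\<alpha> (Suc k) *\<^sub>v z)"
          unfolding z(2) using assoc_mult_mat_vec[OF \<alpha>c \<psi>c z(1)] assoc_mult_mat_vec[OF \<phi>c \<alpha>c z(1)] \<alpha>(3) by simp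
        then have "\<phi> k *\<^sub>v (x + \<alpha> (Suc k) *\<^sub>v z) = 0\<^sub>v (?n k)"
          using eqs(1) mult_add_distrib_mat_vec[OF \<phi>c xy(1) \<alpha>z] by simp
        then have "x + \<alpha> (Suc k) *\<^sub>v z \<in> mat_kernel (\<phi> k)"
          using xy(1) \<alpha>z by (intro mat_kernelI[OF \<phi>c]) auto
        then obtain t where t: "t \<in> carrier_vec (?n (Suc (Suc k)))" "x + \<alpha> (Suc k) *\<^sub>v z = \<phi> (Suc k) *\<^sub>v t"
          using exact_complexD(3)[OF ex, of "Suc k"] by (auto simp: cycles_def)
        have mz: "- z \<in> carrier_vec (?n' (Suc k))" using z(1) by simp
        have "\<phi> (Suc k) *\<^sub>v t + \<alpha> (Suc k) *\<^sub>v (- z) = x"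
          unfolding t(2)[symmetric] mult_mat_uminus_vec[OF \<alpha>c z(1)] using xy(1) \<alpha>z
          by (intro eq_vecI) auto
        moreover have "L (Suc k) *\<^sub>v (- z) = y"
          unfolding mult_mat_uminus_vec[OF Lc z(1)] using \<psi>c[of k] z by (simp add: L_def)
        ultimately have "\<chi> (Suc k) *\<^sub>v (t @\<^sub>v - z) = v" unfolding \<chi>_vec[OF t(1) mz] xy(3) by simp
        then show "v \<in> (\<lambda>v. \<chi> (Suc k) *\<^sub>v v) ` carrier_vec (length (?c (Suc (Suc k))))"
          unfolding image using t(1) mz by blast
      qed
      show "(\<lambda>v. \<chi> (Suc k) *\<^sub>v v) ` carrier_vec (length (?c (Suc (Suc k)))) \<subseteq> mat_kernel (\<chi> k)"
        unfolding image
      proof safe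
        fix t z :: "('v, 'k) mpoly vec"
        assume t: "t \<in> carrier_vec (?n (Suc (Suc k)))" and z: "z \<in> carrier_vec (?n' (Suc k))"
        define x y where "x = \<phi> (Suc k) *\<^sub>v t + \<alpha> (Suc k) *\<^sub>v z" and "y = L (Suc k) *\<^sub>v z"
        have \<phi>t: "\<phi> (Suc k) *\<^sub>v t \<in> carrier_vec (?n (Suc k))" and \<alpha>z: "\<alpha> (Suc k) *\<^sub>v z \<in> carrier_vec (?n (Suc k))"
          and \<psi>z: "\<psi> k *\<^sub>v z \<in> carrier_vec (?n' k)"
          using \<phi>c[of "Suc k"] \<alpha>c[of "Suc k"] \<psi>c[of k] t z by simp_all
        have y_eq: "y = - (\<psi> k *\<^sub>v z)" using \<psi>c[of k] z by (simp add: y_def L_def)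
        have x: "x \<in> carrier_vec (?n (Suc k))" using \<phi>t \<alpha>z by (simp add: x_def)
        have y: "y \<in> carrier_vec (?n' k)" using \<psi>z by (simp add: y_eq)
        have "\<phi> k *\<^sub>v x = \<phi> k *\<^sub>v (\<phi> (Suc k) *\<^sub>v t) + \<phi> k *\<^sub>v (\<alpha> (Suc k) *\<^sub>v z)"
          unfolding x_def by (rule mult_add_distrib_mat_vec[OF \<phi>c \<phi>t \<alpha>z])
        also have "\<dots> = \<phi> k *\<^sub>v (\<alpha> (Suc k) *\<^sub>v z)"
          unfolding exact_complex_comp_zero[OF ex t] using \<phi>c[of k] \<alpha>z by simp
        also have "\<dots> = \<alpha> k *\<^sub>v (\<psi> k *\<^sub>v z)"
          using assoc_mult_mat_vec[OF \<alpha>c \<psi>c z] assoc_mult_mat_vec[OF \<phi>c \<alpha>c z] \<alpha>(3) by simp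
        finally have "\<phi> k *\<^sub>v x + \<alpha> k *\<^sub>v y = 0\<^sub>v (?n k)"
          unfolding y_eq mult_mat_uminus_vec[OF \<alpha>c \<psi>z] using \<alpha>c[of k] \<psi>z by simp
        moreover have "y = \<psi> k *\<^sub>v (- z)" using mult_mat_uminus_vec[OF \<psi>c z] by (simp add: y_eq)
        then have "y \<in> cycles Z' \<psi> k" unfolding exact_complexD(3)[OF ex0] using z by auto
        then have "L k *\<^sub>v y = 0\<^sub>v (r k)" using cycle_iff[OF y] by blast
        ultimately have "\<chi> k *\<^sub>v (x @\<^sub>v y) = 0\<^sub>v (?n k) @\<^sub>v 0\<^sub>v (r k)" by (simp add: \<chi>_vec[OF x y])
        also have "\<dots> = 0\<^sub>v (?n k + r k)" by (intro eq_vecI) auto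
        finally have "x @\<^sub>v y \<in> mat_kernel (\<chi> k)" using x y by (intro mat_kernelI[OF \<chi>c]) auto
        then show "\<chi> (Suc k) *\<^sub>v (t @\<^sub>v z) \<in> mat_kernel (\<chi> k)"
          unfolding \<chi>_vec[OF t z] x_def y_def .
      qed
    qed
    then show ?thesis unfolding Suc cycles_def by simp
  qed
  have "fine_resolution (ideal_add I ?x) ?c \<chi>"
    unfolding fine_resolution_def exact_complex_def using graded exact by (simp add: cone_degrees_def d0)
  then show ?thesis by (intro exI[of _ \<chi>])
qed

section \<open>Resolving skeleta of simplices and their joins\<close>

text \<open>
  All multidegrees \<open>m\<close> of the resolution have support in \<open>S\<close> and occur only in homological degree \<open>h m\<close>,
  and for some generator the total degree exceeds the homological degree by \<open>e\<close>. The first argument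
  fixes the field.
\<close>

definition resolvable ::
  "'k::field itself \<Rightarrow> 'v::finite set set \<Rightarrow> (('v \<Rightarrow>\<^sub>0 nat) \<Rightarrow> nat) \<Rightarrow> 'v set \<Rightarrow> nat \<Rightarrow> bool" where
  "resolvable T \<Delta> h S e \<longleftrightarrow> (\<exists>d (\<phi> :: nat \<Rightarrow> ('v, 'k) mpoly mat).
     fine_resolution (stanley_reisner \<Delta>) d \<phi> \<and>
     (\<forall>i. \<forall>m\<in>set (d i). h m = i \<and> Poly_Mapping.keys m \<subseteq> S) \<and>
     (\<exists>i. \<exists>m\<in>set (d i). monomial_degree m = i + e))"

lemma resolvable_cong:
  fixes T :: "'k::field itself" and \<Delta> :: "'v::finite set set"
  assumes "resolvable T \<Delta> h S e" "\<And>m. Poly_Mapping.keys m \<subseteq> S \<Longrightarrow> h m = h' m" "S \<subseteq> S'"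
  shows "resolvable T \<Delta> h' S' e"
proof -
  obtain d and \<phi> :: "nat \<Rightarrow> ('v, 'k) mpoly mat" where d: "fine_resolution (stanley_reisner \<Delta>) d \<phi>"
     "\<And>i m. m \<in> set (d i) \<Longrightarrow> h m = i \<and> Poly_Mapping.keys m \<subseteq> S"
     "\<exists>i. \<exists>m\<in>set (d i). monomial_degree m = i + e"
    using assms(1) unfolding resolvable_def by blast
  have "h' m = i \<and> Poly_Mapping.keys m \<subseteq> S'" if "m \<in> set (d i)" for i m
    using d(2)[OF that] assms(2)[of m] assms(3) by auto
  then show ?thesis unfolding resolvable_def using d by blast
qed

lemma sum_lookup_sqfree: "(\<Sum>v\<in>C. Poly_Mapping.lookup (sqfree U) v) = card (U \<inter> C)"
  by (simp add: lookup_sqfree sum.If_cases Int_commute)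

lemma monomial_degree_sqfree: "monomial_degree (sqfree U) = card U"
  using sum_lookup_sqfree[of U UNIV] by (simp add: monomial_degree_def)

text \<open>
  The mapping cone for adding the monomial of \<open>U\<close>: its generators are those of \<open>\<Delta>\<close>, and those of
  the star of \<open>U\<close> with multidegree shifted by \<open>U\<close> and homological degree shifted by 1. The excess \<open>e\<close> can be
  inherited from either side.
\<close>

lemma resolvable_add_nonface:
  fixes T :: "'k::field itself" and \<Delta> :: "'v::finite set set"
  assumes dc: "down_closed \<Delta>" and res: "resolvable T \<Delta> h S e" and res': "resolvable T {F. F \<union> U \<in> \<Delta>} h' S' e'"
    and h: "\<And>m. Poly_Mapping.keys m \<subseteq> S' \<Longrightarrow> h (sqfree U + m) = Suc (h' m)" and S: "U \<union> S' \<subseteq> S"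
  shows "resolvable T {F \<in> \<Delta>. \<not> U \<subseteq> F} h S e" (is ?A)
    and "e' + card U = Suc e'' \<Longrightarrow> resolvable T {F \<in> \<Delta>. \<not> U \<subseteq> F} h S e''" (is "_ \<Longrightarrow> ?B")
proof -
  obtain d and \<phi> :: "nat \<Rightarrow> ('v, 'k) mpoly mat" where d: "fine_resolution (stanley_reisner \<Delta>) d \<phi>"
     "\<And>i m. m \<in> set (d i) \<Longrightarrow> h m = i \<and> Poly_Mapping.keys m \<subseteq> S"
     "\<exists>i. \<exists>m\<in>set (d i). monomial_degree m = i + e"
    using res unfolding resolvable_def by blast
  obtain d' and \<psi> :: "nat \<Rightarrow> ('v, 'k) mpoly mat" where d': "fine_resolution (stanley_reisner {F. F \<union> U \<in> \<Delta>}) d' \<psi>"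
     "\<And>i m. m \<in> set (d' i) \<Longrightarrow> h' m = i \<and> Poly_Mapping.keys m \<subseteq> S'"
     "\<exists>i. \<exists>m\<in>set (d' i). monomial_degree m = i + e'"
    using res' unfolding resolvable_def by blast
  let ?c = "cone_degrees (sqfree U) d d'"
  obtain \<chi> :: "nat \<Rightarrow> ('v, 'k) mpoly mat" where
    \<chi>: "fine_resolution (stanley_reisner {F \<in> \<Delta>. \<not> U \<subseteq> F}) ?c \<chi>"
    using mapping_cone[OF is_ideal_stanley_reisner[OF dc] d(1), of "sqfree U" d' \<psi>] d'(1)
    unfolding colon_stanley_reisner ideal_add_stanley_reisner[OF dc] by blast
  have c: "h m = i \<and> Poly_Mapping.keys m \<subseteq> S" if m: "m \<in> set (?c i)" for m i
  proof (cases "m \<in> set (d i)")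
    case True then show ?thesis by (rule d(2))
  next
    case False
    then obtain j m' where j: "i = Suc j" "m' \<in> set (d' j)" "m = sqfree U + m'"
      using m by (cases i) (auto simp: cone_degrees_def)
    then show ?thesis using d'(2)[OF j(2)] h[of m'] S by (auto simp: keys_add_nat keys_sqfree)
  qed
  have "\<exists>i. \<exists>m\<in>set (?c i). monomial_degree m = i + e"
    using d(3) by (auto simp: cone_degrees_def)
  then show ?A unfolding resolvable_def using \<chi> c by blast
  show ?B if e: "e' + card U = Suc e''"
  proof -
    obtain i m where im: "m \<in> set (d' i)" "monomial_degree m = i + e'" using d'(3) by blast
    have "sqfree U + m \<in> set (?c (Suc i))" using im by (simp add: cone_degrees_def)
    moreover have "monomial_degree (sqfree U + m) = Suc i + e''"
      using im e by (simp add: monomial_degree_add monomial_degree_sqfree)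
    ultimately show ?B unfolding resolvable_def using \<chi> c by blast
  qed
qed

text \<open>
  The ideal is 0, and the resolution is \<open>S\<close> in position 0.
\<close>

lemma resolvable_full:
  fixes T :: "'k::field itself"
  shows "resolvable T (UNIV :: 'v::finite set set) (\<lambda>_. 0) {} 0"
proof -
  define d :: "nat \<Rightarrow> ('v \<Rightarrow>\<^sub>0 nat) list" where "d i = (if i = 0 then [0] else [])" for i
  define \<phi> :: "nat \<Rightarrow> ('v, 'k) mpoly mat" where "\<phi> i = 0\<^sub>m (length (d i)) 0" for i
  have SR: "stanley_reisner UNIV = {0 :: ('v, 'k) mpoly}"
    by (auto simp: stanley_reisner_def)
  have "cycles {v \<in> carrier_vec 1. v $ 0 \<in> (stanley_reisner UNIV :: ('v, 'k) mpoly set)} \<phi> i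
    = {0\<^sub>v (length (d i))}" for i
  proof (cases i)
    case 0
    have "v = 0\<^sub>v 1" if "v \<in> carrier_vec 1" "v $ 0 = 0" for v :: "('v, 'k) mpoly vec"
      using that by (intro eq_vecI) auto
    then show ?thesis using 0 by (auto simp: cycles_def SR d_def)
  next
    case (Suc j)
    have "v = 0\<^sub>v 0" if "v \<in> carrier_vec 0" for v :: "('v, 'k) mpoly vec"
      using that by (intro eq_vecI) auto
    then show ?thesis using Suc by (auto simp: cycles_def mat_kernel_def \<phi>_def d_def)
  qed
  moreover have "(\<lambda>v. \<phi> i *\<^sub>v v) ` carrier_vec (length (d (Suc i))) = {0\<^sub>v (length (d i))}" for i
  proof -
    have z: "\<phi> i *\<^sub>v v = 0\<^sub>v (length (d i))" if "v \<in> carrier_vec 0" for v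
      using that by (intro eq_vecI) (auto simp: \<phi>_def scalar_prod_def)
    have "\<phi> i *\<^sub>v 0\<^sub>v 0 = 0\<^sub>v (length (d i))" by (rule z) simp
    then have "0\<^sub>v (length (d i)) \<in> (\<lambda>v. \<phi> i *\<^sub>v v) ` carrier_vec 0"
      by (intro image_eqI[of _ _ "0\<^sub>v 0"]) simp_all
    then have "(\<lambda>v. \<phi> i *\<^sub>v v) ` carrier_vec 0 = {0\<^sub>v (length (d i))}" using z by auto
    then show ?thesis by (simp add: d_def)
  qed
  ultimately have "fine_resolution (stanley_reisner UNIV) d \<phi>"
    by (simp add: fine_resolution_def exact_complex_def graded_mat_def d_def \<phi>_def)
  then show ?thesis unfolding resolvable_def
    by (intro exI[of _ d] exI[of _ \<phi>]) (auto simp: d_def monomial_degree_def)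
qed

definition degree_in :: "'v set \<Rightarrow> ('v \<Rightarrow>\<^sub>0 nat) \<Rightarrow> nat" where
  "degree_in C m = (\<Sum>v\<in>C. Poly_Mapping.lookup m v)"

lemma degree_in_add: "degree_in C (m + m') = degree_in C m + degree_in C m'"
  by (simp add: degree_in_def lookup_add sum.distrib)

lemma degree_in_sqfree: "degree_in C (sqfree U) = card (U \<inter> C)"
  by (simp add: degree_in_def sum_lookup_sqfree)

lemma degree_in_disjoint: "Poly_Mapping.keys m \<inter> C = {} \<Longrightarrow> degree_in C m = 0"
  unfolding degree_in_def by (intro sum.neutral) (auto simp: in_keys_iff)

text \<open>
  In this context \<open>\<Gamma>\<close> imposes no condition on the vertices in \<open>C\<close>, and its resolution does not involve
  their variables.
\<close>

context
  fixes T :: "'k::field itself" and \<Gamma> :: "'v::finite set set" and C S :: "'v set" and h :: "('v \<Rightarrow>\<^sub>0 nat) \<Rightarrow> nat" and e :: nat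
  assumes dc: "down_closed \<Gamma>" and free: "\<And>F. F \<in> \<Gamma> \<longleftrightarrow> F - C \<in> \<Gamma>"
    and res: "resolvable T \<Gamma> h S e" and disj: "S \<inter> C = {}"
    and h_add: "\<And>u m. Poly_Mapping.keys u \<subseteq> C \<Longrightarrow> h (u + m) = h m"
begin

text \<open>
  A variable of \<open>C\<close> that has not been added is a nonzerodivisor, i.e. the star of its vertex is the
  whole complex; the mapping cones are those of the Koszul complex, in which the degree in the
  variables equals the homological degree.
\<close>

lemma resolvable_variables:
  assumes "Y \<subseteq> C"
  shows "resolvable T {F \<in> \<Gamma>. F \<inter> Y = {}} (\<lambda>m. h m + degree_in C m) (S \<union> C) e"
  using finite[of Y] assms
proof (induction Y rule: finite_induct)
  case empty
  have "h m = h m + degree_in C m" if "Poly_Mapping.keys m \<subseteq> S" for m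
  proof -
    have "Poly_Mapping.keys m \<inter> C = {}" using that disj by blast
    then show ?thesis by (simp add: degree_in_disjoint)
  qed
  then show ?case using resolvable_cong[OF res, of "\<lambda>m. h m + degree_in C m" "S \<union> C"] by simp
next
  case (insert v Y)
  let ?D = "{F \<in> \<Gamma>. F \<inter> Y = {}}"
  have dcD: "down_closed ?D" using dc unfolding down_closed_def by blast
  have IH: "resolvable T ?D (\<lambda>m. h m + degree_in C m) (S \<union> C) e" using insert by simp
  have "F \<union> {v} \<in> \<Gamma> \<longleftrightarrow> F \<in> \<Gamma>" for F
    using free[of "F \<union> {v}"] free[of F] insert.prems by (simp add: Un_Diff)
  then have star: "{F. F \<union> {v} \<in> ?D} = ?D" using insert.hyps by auto
  have "resolvable T {F \<in> ?D. \<not> {v} \<subseteq> F} (\<lambda>m. h m + degree_in C m) (S \<union> C) e"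
  proof (rule resolvable_add_nonface(1)[OF dcD IH])
    show "resolvable T {F. F \<union> {v} \<in> ?D} (\<lambda>m. h m + degree_in C m) (S \<union> C) e" unfolding star by (rule IH)
    show "{v} \<union> (S \<union> C) \<subseteq> S \<union> C" using insert.prems by blast
    fix m
    show "h (sqfree {v} + m) + degree_in C (sqfree {v} + m) = Suc (h m + degree_in C m)"
      using insert.prems h_add[of "sqfree {v}" m] by (simp add: keys_sqfree degree_in_add degree_in_sqfree)
  qed
  also have "{F \<in> ?D. \<not> {v} \<subseteq> F} = {F \<in> \<Gamma>. F \<inter> insert v Y = {}}" by blast
  finally show ?case .
qed

text \<open>
  The nonfaces of size \<open>q + 1\<close> in \<open>insert v D\<close> are those in \<open>D\<close> and the sets \<open>insert v W\<close> with \<open>W\<close> a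
  \<open>q\<close>-subset of \<open>D\<close>. When all of the former and some of the latter have been added, the colon ideal by
  \<open>insert v W\<close> is the ideal of \<open>\<Gamma>\<close> plus the variables in \<open>D - W\<close>: these are linear quotients,
  relative to \<open>\<Gamma>\<close>. A generator thus obtained has degree at least \<open>q + 1\<close> in \<open>C\<close>, and its homological degree
  exceeds that of its part outside \<open>C\<close> by the degree in \<open>C\<close> minus \<open>q\<close>.
\<close>

lemma resolvable_skeleton:
  assumes "D \<subseteq> C"
  shows "resolvable T {F \<in> \<Gamma>. card (F \<inter> D) \<le> q} (\<lambda>m. h m + (degree_in C m - q)) (S \<union> C) e \<and>
    (q < card D \<longrightarrow> resolvable T {F \<in> \<Gamma>. card (F \<inter> D) \<le> q} (\<lambda>m. h m + (degree_in C m - q)) (S \<union> C) (e + q))"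
  using finite[of D] assms
proof (induction D rule: finite_induct)
  case empty
  have "h m = h m + (degree_in C m - q)" if "Poly_Mapping.keys m \<subseteq> S" for m
  proof -
    have "Poly_Mapping.keys m \<inter> C = {}" using that disj by blast
    then show ?thesis by (simp add: degree_in_disjoint)
  qed
  then show ?case using resolvable_cong[OF res, of "\<lambda>m. h m + (degree_in C m - q)" "S \<union> C"] by simp
next
  case (insert v D)
  let ?h = "\<lambda>m. h m + (degree_in C m - q)"
  \<comment> \<open>The complex after the nonfaces \<open>insert v W\<close> with \<open>W \<in> \<U>\<close> have been added.\<close>
  define \<Delta> where "\<Delta> \<U> = {F \<in> \<Gamma>. card (F \<inter> D) \<le> q \<and> (\<forall>W\<in>\<U>. \<not> insert v W \<subseteq> F)}" for \<U>
  have dc\<Delta>: "down_closed (\<Delta> \<U>)" for \<U>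
    unfolding down_closed_def
  proof (intro ballI allI impI)
    fix F G assume F: "F \<in> \<Delta> \<U>" and GF: "G \<subseteq> F"
    have "G \<in> \<Gamma>" using F GF dc unfolding \<Delta>_def down_closed_def by blast
    moreover have "card (G \<inter> D) \<le> card (F \<inter> D)" using GF by (intro card_mono) auto
    moreover have "\<not> insert v W \<subseteq> G" if "W \<in> \<U>" for W
      using that F GF unfolding \<Delta>_def by blast
    ultimately show "G \<in> \<Delta> \<U>" using F unfolding \<Delta>_def by simp
  qed
  have step: "resolvable T (\<Delta> \<U>) ?h (S \<union> C) e \<and> (\<U> \<noteq> {} \<longrightarrow> resolvable T (\<Delta> \<U>) ?h (S \<union> C) (e + q))"
    if "\<U> \<subseteq> {W. W \<subseteq> D \<and> card W = q}" for \<U>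
    using finite[of \<U>] that
  proof (induction \<U> rule: finite_induct)
    case empty
    have "\<Delta> {} = {F \<in> \<Gamma>. card (F \<inter> D) \<le> q}" by (simp add: \<Delta>_def)
    then show ?case using insert.IH insert.prems by simp
  next
    case (insert W \<U>)
    have IH: "resolvable T (\<Delta> \<U>) ?h (S \<union> C) e" using insert by simp
    have W: "W \<subseteq> D" "card W = q" "v \<notin> W" "insert v W \<subseteq> C"
      using insert.prems \<open>v \<notin> D\<close> \<open>insert v D \<subseteq> C\<close> by auto
    have star: "{F. F \<union> insert v W \<in> \<Delta> \<U>} = {F \<in> \<Gamma>. F \<inter> (D - W) = {}}"
    proof (rule Set.set_eqI)
      fix F
      have \<Gamma>: "F \<union> insert v W \<in> \<Gamma> \<longleftrightarrow> F \<in> \<Gamma>"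
      proof -
        have "(F \<union> insert v W) - C = F - C" using W by blast
        then show ?thesis using free[of "F \<union> insert v W"] free[of F] by simp
      qed
      have int: "(F \<union> insert v W) \<inter> D = (F \<inter> D) \<union> W" using W \<open>v \<notin> D\<close> by blast
      have card: "card ((F \<inter> D) \<union> W) \<le> q \<longleftrightarrow> F \<inter> (D - W) = {}"
      proof
        assume "card ((F \<inter> D) \<union> W) \<le> q"
        then have "W = (F \<inter> D) \<union> W" using W by (intro card_seteq) auto
        then show "F \<inter> (D - W) = {}" by blast
      next
        assume "F \<inter> (D - W) = {}"
        then have "(F \<inter> D) \<union> W = W" by blast
        then show "card ((F \<inter> D) \<union> W) \<le> q" using W by simp
      qed
      have "\<not> insert v W' \<subseteq> F \<union> insert v W" if "W' \<in> \<U>" "F \<inter> (D - W) = {}" for W'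
      proof
        assume "insert v W' \<subseteq> F \<union> insert v W"
        moreover have "W' \<subseteq> D" "card W' = card W" using that insert.prems W by auto
        ultimately have "W' \<subseteq> W" using that(2) \<open>v \<notin> D\<close> by blast
        then have "W' = W" using \<open>card W' = card W\<close> by (intro card_subset_eq) auto
        then show False using that insert.hyps by blast
      qed
      then show "F \<in> {F. F \<union> insert v W \<in> \<Delta> \<U>} \<longleftrightarrow> F \<in> {F \<in> \<Gamma>. F \<inter> (D - W) = {}}"
        unfolding \<Delta>_def by (auto simp only: mem_Collect_eq int card \<Gamma>)
    qed
    have res': "resolvable T {F. F \<union> insert v W \<in> \<Delta> \<U>} (\<lambda>m. h m + degree_in C m) (S \<union> C) e"
      unfolding star using \<open>insert v D \<subseteq> C\<close> by (intro resolvable_variables) blast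
    have "card (insert v W) = Suc q" using W by simp
    moreover have "insert v W \<inter> C = insert v W" using W by blast
    ultimately have shift: "?h (sqfree (insert v W) + m) = Suc (h m + degree_in C m)" for m
      using h_add[of "sqfree (insert v W)" m] W by (simp add: keys_sqfree degree_in_add degree_in_sqfree)
    have eq: "{F \<in> \<Delta> \<U>. \<not> insert v W \<subseteq> F} = \<Delta> (insert W \<U>)" by (auto simp: \<Delta>_def)
    have sub: "insert v W \<union> (S \<union> C) \<subseteq> S \<union> C" using W by blast
    show ?case
      using resolvable_add_nonface(1)[OF dc\<Delta> IH res' shift sub]
        resolvable_add_nonface(2)[OF dc\<Delta> IH res' shift sub, of "e + q"] \<open>card (insert v W) = Suc q\<close>
      unfolding eq by simp
  qed
  let ?U = "{W. W \<subseteq> D \<and> card W = q}"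
  have "\<Delta> ?U = {F \<in> \<Gamma>. card (F \<inter> insert v D) \<le> q}"
  proof (rule Set.set_eqI)
    fix F
    have "card (F \<inter> D) \<le> q \<and> (\<forall>W\<in>?U. \<not> insert v W \<subseteq> F) \<longleftrightarrow> card (F \<inter> insert v D) \<le> q"
    proof (cases "v \<in> F")
      case False
      then have "F \<inter> insert v D = F \<inter> D" by blast
      then show ?thesis using False by auto
    next
      case True
      then have "F \<inter> insert v D = insert v (F \<inter> D)" by blast
      then have card: "card (F \<inter> insert v D) = Suc (card (F \<inter> D))" using \<open>v \<notin> D\<close> by simp
      have "(\<exists>W\<in>?U. insert v W \<subseteq> F) \<longleftrightarrow> q \<le> card (F \<inter> D)"
      proof
        assume "\<exists>W\<in>?U. insert v W \<subseteq> F"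
        then obtain W where "W \<subseteq> F \<inter> D" "card W = q" by blast
        then show "q \<le> card (F \<inter> D)" using card_mono[of "F \<inter> D" W] by simp
      next
        assume "q \<le> card (F \<inter> D)"
        then obtain W where "W \<subseteq> F \<inter> D" "card W = q" by (meson obtain_subset_with_card_n)
        then show "\<exists>W\<in>?U. insert v W \<subseteq> F" using True by blast
      qed
      then show ?thesis unfolding card by auto
    qed
    then show "F \<in> \<Delta> ?U \<longleftrightarrow> F \<in> {F \<in> \<Gamma>. card (F \<inter> insert v D) \<le> q}" unfolding \<Delta>_def by blast
  qed
  moreover have "?U \<noteq> {}" if "q < card (insert v D)"
  proof -
    have "q \<le> card D" using that insert.hyps by simp
    then obtain W where "W \<subseteq> D" "card W = q" by (meson obtain_subset_with_card_n)
    then show ?thesis by blast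
  qed
  ultimately show ?case using step[of ?U] by simp
qed

end

definition partition_complex :: "'v set set \<Rightarrow> ('v set \<Rightarrow> nat) \<Rightarrow> 'v set set" where
  "partition_complex \<C> q = {F. \<forall>C\<in>\<C>. card (F \<inter> C) \<le> q C}"

lemma down_closed_partition_complex: "down_closed (partition_complex \<C> q :: 'v::finite set set)"
  unfolding down_closed_def partition_complex_def
proof (intro ballI allI impI CollectI)
  fix F G :: "'v set" and C
  assume "F \<in> {F. \<forall>C\<in>\<C>. card (F \<inter> C) \<le> q C}" "G \<subseteq> F" "C \<in> \<C>"
  moreover from this have "card (G \<inter> C) \<le> card (F \<inter> C)" by (intro card_mono) auto
  ultimately show "card (G \<inter> C) \<le> q C" by force
qed

lemma resolvable_partition_complex:
  fixes \<C> :: "'v::finite set set"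
  assumes "disjoint \<C>" "\<And>C. C \<in> \<C> \<Longrightarrow> q C < card C"
  shows "resolvable T (partition_complex \<C> q) (\<lambda>m. \<Sum>C\<in>\<C>. degree_in C m - q C) (\<Union>\<C>) (\<Sum>C\<in>\<C>. q C)"
  using finite[of \<C>] assms
proof (induction \<C> rule: finite_induct)
  case empty
  then show ?case using resolvable_full by (simp add: partition_complex_def)
next
  case (insert C \<C>)
  have disj: "C' \<inter> C = {}" if "C' \<in> \<C>" for C'
    using disjointD[OF insert.prems(1), of C' C] insert.hyps(2) that by blast
  let ?h = "\<lambda>m. \<Sum>C\<in>\<C>. degree_in C m - q C"
  have IH: "resolvable T (partition_complex \<C> q) ?h (\<Union>\<C>) (\<Sum>C\<in>\<C>. q C)"
  proof (rule insert.IH)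
    show "disjoint \<C>" using insert.prems(1) unfolding disjoint_def by blast
    show "q C' < card C'" if "C' \<in> \<C>" for C' using insert.prems(2) that by blast
  qed
  have free: "F \<in> partition_complex \<C> q \<longleftrightarrow> F - C \<in> partition_complex \<C> q" for F
  proof -
    have "(F - C) \<inter> C' = F \<inter> C'" if "C' \<in> \<C>" for C' using disj[OF that] by blast
    then show ?thesis by (simp add: partition_complex_def)
  qed
  have h_add: "?h (u + m) = ?h m" if u: "Poly_Mapping.keys u \<subseteq> C" for u m
  proof -
    have "degree_in C' u = 0" if "C' \<in> \<C>" for C'
      using disj[OF that] u by (intro degree_in_disjoint) blast
    then show ?thesis by (simp add: degree_in_add)
  qed
  have "\<Union>\<C> \<inter> C = {}" using disj by blast
  from resolvable_skeleton[OF down_closed_partition_complex free IH this h_add order_refl, of "q C"]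
  have "resolvable T {F \<in> partition_complex \<C> q. card (F \<inter> C) \<le> q C}
    (\<lambda>m. ?h m + (degree_in C m - q C)) (\<Union>\<C> \<union> C) ((\<Sum>C\<in>\<C>. q C) + q C)"
    using insert.prems(2)[of C] by simp
  moreover have "{F \<in> partition_complex \<C> q. card (F \<inter> C) \<le> q C} = partition_complex (insert C \<C>) q"
    by (auto simp: partition_complex_def)
  ultimately show ?case using insert.hyps by (simp add: Un_commute add.commute)
qed

section \<open>Regularity\<close>

lemma homogeneous_ideal_stanley_reisner: "down_closed \<Delta> \<Longrightarrow> homogeneous_ideal (stanley_reisner \<Delta>)"
  unfolding homogeneous_ideal_def
  by (simp add: is_ideal_stanley_reisner) (simp add: stanley_reisner_def keys_filter_terms)

text \<open>
  A constant term in an entry of \<open>\<phi> i\<close> would force equal multidegrees of two generators in the homological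
  degrees \<open>i\<close> and \<open>Suc i\<close>, which \<open>h\<close> excludes.
\<close>

lemma minimal_resolution_of_fine:
  fixes I :: "('v::finite, 'k::field) mpoly set"
  assumes I: "is_ideal I" and res: "fine_resolution I d \<phi>" and h: "\<And>i m. m \<in> set (d i) \<Longrightarrow> h m = i"
  shows "minimal_graded_free_resolution I (\<lambda>i. map tdeg (d i)) (vec 1 (\<lambda>_. 1)) \<phi>"
proof -
  let ?d = "\<lambda>i. map tdeg (d i)" and ?\<epsilon> = "vec 1 (\<lambda>_. 1) :: ('v, 'k) mpoly vec"
  have d0: "d 0 = [0]" using res by (simp add: fine_resolution_def)
  have ex: "exact_complex (\<lambda>m. m) {v \<in> carrier_vec 1. v $ 0 \<in> I} d \<phi>" using res by (simp add: fine_resolution_def)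
  have \<epsilon>: "?\<epsilon> \<bullet> v = v $ 0" if "v \<in> carrier_vec 1" for v
    using that by (simp add: scalar_prod_def)
  have aug: "augmentation_kernel I (length (?d 0)) ?\<epsilon> = {v \<in> carrier_vec 1. v $ 0 \<in> I}"
    using \<epsilon> by (auto simp: augmentation_kernel_def d0)
  have "graded_mat tdeg (?d i) (?d (Suc i)) (\<phi> i)" for i
    using exact_complexD(1)[OF ex, of i]
    by (auto simp: graded_mat_def homogeneous_entry_def simp flip: tdeg_add)
  then have ex': "exact_complex tdeg (augmentation_kernel I (length (?d 0)) ?\<epsilon>) ?d \<phi>"
    unfolding aug exact_complex_def using exact_complexD(3)[OF ex] by simp
  have "p - ?\<epsilon> \<bullet> vec 1 (\<lambda>_. p) \<in> I" for p
    using is_ideal_zero[OF I] \<epsilon>[OF vec_carrier[of 1 "\<lambda>_. p"]] by simp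
  then have "\<exists>v\<in>carrier_vec (length (?d 0)). p - ?\<epsilon> \<bullet> v \<in> I" for p
    unfolding d0 by (intro bexI[of _ "vec 1 (\<lambda>_. p)"]) simp_all
  then have "graded_free_resolution I ?d ?\<epsilon> \<phi>"
    unfolding graded_free_resolution_iff using ex'
    by (simp add: d0 homogeneous_of_degree_def monomial_degree_def)
  moreover have "\<phi> i $$ (a, b) \<in> graded_maximal_ideal" if ab: "a < length (d i)" "b < length (d (Suc i))" for i a b
  proof (rule ccontr)
    assume "\<phi> i $$ (a, b) \<notin> graded_maximal_ideal"
    then have "0 \<in> Poly_Mapping.keys (\<phi> i $$ (a, b))" by (simp add: graded_maximal_ideal_iff in_keys_iff)
    then have "0 + d i ! a = d (Suc i) ! b"
      using exact_complexD(1)[OF ex, of i] ab unfolding graded_mat_def homogeneous_entry_def by blast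
    then have "h (d i ! a) = h (d (Suc i) ! b)" by simp
    then show False using h[of "d i ! a" i] h[of "d (Suc i) ! b" "Suc i"] ab by simp
  qed
  ultimately show ?thesis by (simp add: minimal_graded_free_resolution_def)
qed

lemma regularity_of_resolvable:
  fixes \<Delta> :: "'v::finite set set"
  assumes dc: "down_closed \<Delta>" and res: "resolvable TYPE('k::field) \<Delta> h S e"
    and h: "\<And>m. h m \<le> monomial_degree m" "\<And>m. Poly_Mapping.keys m \<subseteq> S \<Longrightarrow> monomial_degree m \<le> h m + e"
  shows "regularity_quotient (stanley_reisner \<Delta> :: ('v, 'k) mpoly set) = int e"
proof -
  let ?I = "stanley_reisner \<Delta> :: ('v, 'k) mpoly set"
  obtain d and \<phi> :: "nat \<Rightarrow> ('v, 'k) mpoly mat" where d: "fine_resolution ?I d \<phi>"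
     "\<And>i m. m \<in> set (d i) \<Longrightarrow> h m = i \<and> Poly_Mapping.keys m \<subseteq> S"
     "\<exists>i. \<exists>m\<in>set (d i). monomial_degree m = i + e"
    using res unfolding resolvable_def by blast
  have "minimal_graded_free_resolution ?I (\<lambda>i. map tdeg (d i)) (vec 1 (\<lambda>_. 1)) \<phi>"
    using d(2) by (intro minimal_resolution_of_fine[OF is_ideal_stanley_reisner[OF dc] d(1), of h]) auto
  then have betti: "graded_betti ?I i j = count_list (map tdeg (d i)) j" for i j
    by (rule graded_betti_eq[OF homogeneous_ideal_stanley_reisner[OF dc]])
  have nonzero: "graded_betti ?I i j \<noteq> 0 \<longleftrightarrow> (\<exists>m\<in>set (d i). j = tdeg m)" for i j
    unfolding betti count_list_0_iff by auto
  have "{j - int i | i j. graded_betti ?I i j \<noteq> 0} = {tdeg m - int i | i m. m \<in> set (d i)}" (is "?A = ?B")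
    unfolding nonzero by blast
  moreover have "Max ?B = int e"
  proof (rule Max_eqI)
    have bounds: "0 \<le> x \<and> x \<le> int e" if x: "x \<in> ?B" for x
    proof -
      obtain i m where "x = tdeg m - int i" "m \<in> set (d i)" using x by blast
      then show ?thesis using d(2)[of m i] h(1)[of m] h(2)[of m] by auto
    qed
    then have "?B \<subseteq> {0..int e}" by (meson atLeastAtMost_iff subsetI)
    then show "finite ?B" by (rule finite_subset) simp
    show "x \<le> int e" if "x \<in> ?B" for x using bounds[OF that] by blast
    obtain i m where "m \<in> set (d i)" "monomial_degree m = i + e" using d(3) by blast
    then show "int e \<in> ?B" by (intro CollectI exI[of _ i] exI[of _ m]) simp
  qed
  ultimately show ?thesis unfolding regularity_quotient_def by simp
qed

lemma regularity_partition_complex: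
  fixes \<C> :: "'v::finite set set"
  assumes "disjoint \<C>" "\<And>C. C \<in> \<C> \<Longrightarrow> q C < card C"
  shows "regularity_quotient (stanley_reisner (partition_complex \<C> q) :: ('v, 'k::field) mpoly set) = int (\<Sum>C\<in>\<C>. q C)"
proof (rule regularity_of_resolvable[OF down_closed_partition_complex resolvable_partition_complex[OF assms]])
  have sum: "(\<Sum>C\<in>\<C>. degree_in C m) = (\<Sum>v\<in>\<Union>\<C>. Poly_Mapping.lookup m v)" for m
    unfolding degree_in_def using assms(1) by (intro sum.Union_disjoint[symmetric, unfolded o_def]) (auto simp: disjoint_def)
  fix m :: "'v \<Rightarrow>\<^sub>0 nat"
  have "(\<Sum>C\<in>\<C>. degree_in C m - q C) \<le> (\<Sum>C\<in>\<C>. degree_in C m)" by (intro sum_mono) simp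
  also have "\<dots> \<le> monomial_degree m"
    unfolding sum monomial_degree_def by (intro sum_mono2) auto
  finally show "(\<Sum>C\<in>\<C>. degree_in C m - q C) \<le> monomial_degree m" .
  assume "Poly_Mapping.keys m \<subseteq> \<Union>\<C>"
  then have "monomial_degree m = (\<Sum>C\<in>\<C>. degree_in C m)"
    unfolding sum monomial_degree_def by (intro sum.mono_neutral_right) (auto simp: in_keys_iff)
  also have "\<dots> \<le> (\<Sum>C\<in>\<C>. (degree_in C m - q C) + q C)" by (intro sum_mono) simp
  finally show "monomial_degree m \<le> (\<Sum>C\<in>\<C>. degree_in C m - q C) + (\<Sum>C\<in>\<C>. q C)"
    by (simp add: sum.distrib)
qed

section \<open>Partition matroids\<close>

lemma card_eq_sum_blocks:
  fixes \<C> :: "'v::finite set set"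
  assumes "partition_on UNIV \<C>"
  shows "card F = (\<Sum>C\<in>\<C>. card (F \<inter> C))"
proof -
  have "F = (\<Union>C\<in>\<C>. F \<inter> C)" using partition_onD1[OF assms] by blast
  moreover have "card (\<Union>C\<in>\<C>. F \<inter> C) = (\<Sum>C\<in>\<C>. card (F \<inter> C))"
    using partition_onD2[OF assms] by (intro card_UN_disjoint) (auto simp: disjoint_def)
  ultimately show ?thesis by simp
qed

text \<open>
  Some block contains more elements of \<open>G\<close> than of \<open>F\<close>; there is room for one of them.
\<close>

lemma partition_complex_augment:
  fixes \<C> :: "'v::finite set set"
  assumes part: "partition_on UNIV \<C>" and F: "F \<in> partition_complex \<C> q" and G: "G \<in> partition_complex \<C> q"
    and less: "card F < card G"
  shows "\<exists>v\<in>G - F. insert v F \<in> partition_complex \<C> q"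
proof -
  have "\<exists>C\<in>\<C>. card (F \<inter> C) < card (G \<inter> C)"
    using less unfolding card_eq_sum_blocks[OF part, of F] card_eq_sum_blocks[OF part, of G]
    by (meson not_le sum_mono)
  then obtain C where C: "C \<in> \<C>" "card (F \<inter> C) < card (G \<inter> C)" by blast
  then have "\<not> G \<inter> C \<subseteq> F \<inter> C" using card_mono[of "F \<inter> C" "G \<inter> C"] by auto
  then obtain v where v: "v \<in> G" "v \<in> C" "v \<notin> F" by blast
  have "card (insert v F \<inter> C') \<le> q C'" if C': "C' \<in> \<C>" for C'
  proof (cases "C' = C")
    case True
    have "insert v F \<inter> C = insert v (F \<inter> C)" using v by blast
    then have "card (insert v F \<inter> C) \<le> card (G \<inter> C)" using C v by simp
    also have "\<dots> \<le> q C" using G C by (simp add: partition_complex_def)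
    finally show ?thesis using True by simp
  next
    case False
    then have "v \<notin> C'" using disjointD[OF partition_onD2[OF part] C' C(1)] v by blast
    then have "insert v F \<inter> C' = F \<inter> C'" by blast
    then show ?thesis using F C' by (simp add: partition_complex_def)
  qed
  then show ?thesis using v by (auto simp: partition_complex_def)
qed

lemma matroid_partition_complex:
  fixes \<C> :: "'v::finite set set"
  assumes "partition_on UNIV \<C>"
  shows "matroid_complex (partition_complex \<C> q)"
  unfolding matroid_complex_def
  using down_closed_partition_complex partition_complex_augment[OF assms] by blast

lemma partition_complex_facet:
  fixes \<C> :: "'v::finite set set"
  assumes part: "partition_on UNIV \<C>" and q: "\<And>C. C \<in> \<C> \<Longrightarrow> q C \<le> card C"
  shows "\<exists>P\<in>partition_complex \<C> q. card P = (\<Sum>C\<in>\<C>. q C)"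
proof -
  have "\<exists>P. P \<subseteq> C \<and> card P = q C" if "C \<in> \<C>" for C
    using obtain_subset_with_card_n[OF q[OF that]] by metis
  then obtain P where P: "\<And>C. C \<in> \<C> \<Longrightarrow> P C \<subseteq> C \<and> card (P C) = q C" by metis
  define Q where "Q = (\<Union>C\<in>\<C>. P C)"
  have "Q \<inter> C = P C" if C: "C \<in> \<C>" for C
  proof
    show "P C \<subseteq> Q \<inter> C" using P C by (auto simp: Q_def)
    show "Q \<inter> C \<subseteq> P C"
    proof
      fix v assume "v \<in> Q \<inter> C"
      then obtain C' where C': "C' \<in> \<C>" "v \<in> P C'" "v \<in> C" by (auto simp: Q_def)
      then have "v \<in> C'" using P by blast
      then have "C' = C" using disjointD[OF partition_onD2[OF part] C'(1) C] C' by blast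
      then show "v \<in> P C" using C' by simp
    qed
  qed
  then have card: "card (Q \<inter> C) = q C" if "C \<in> \<C>" for C using P that by simp
  then have "card Q = (\<Sum>C\<in>\<C>. q C)" by (simp add: card_eq_sum_blocks[OF part, of Q])
  moreover have "Q \<in> partition_complex \<C> q" using card by (simp add: partition_complex_def)
  ultimately show ?thesis by blast
qed

lemma cohen_macaulay_partition_complex:
  fixes \<C> :: "'v::finite set set"
  assumes part: "partition_on UNIV \<C>" and q: "\<And>C. C \<in> \<C> \<Longrightarrow> q C \<le> card C"
  shows "cohen_macaulay_quotient (stanley_reisner (partition_complex \<C> q) :: ('v, 'k::field) mpoly set)"
proof -
  obtain P where P: "P \<in> partition_complex \<C> q" "card P = (\<Sum>C\<in>\<C>. q C)"
    using partition_complex_facet[of \<C> q] part q by blast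
  have "card F \<le> (\<Sum>C\<in>\<C>. q C)" if "F \<in> partition_complex \<C> q" for F
    unfolding card_eq_sum_blocks[OF part, of F] using that by (intro sum_mono) (simp add: partition_complex_def)
  then show ?thesis
    using matroid_cohen_macaulay[OF matroid_partition_complex[OF part] _ P] by blast
qed

section \<open>Graphs covered by disjoint cliques with free vertices\<close>

lemma clique_extends_to_maximal:
  fixes E :: "'v::finite \<Rightarrow> 'v \<Rightarrow> bool"
  assumes "clique E K"
  shows "\<exists>C. maximal_clique E C \<and> K \<subseteq> C"
proof -
  obtain C where "C \<in> {C. clique E C}" "K \<subseteq> C" "\<forall>C'\<in>{C. clique E C}. C \<subseteq> C' \<longrightarrow> C = C'"
    using finite_has_maximal2[of "{C. clique E C}" K] assms by auto
  then show ?thesis unfolding maximal_clique_def by blast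
qed

lemma clique_subset_neighborhood:
  assumes "clique E C" "i \<in> C" shows "C \<subseteq> closed_neighborhood E i"
  using assms by (auto simp: clique_def closed_neighborhood_def)

text \<open>
  Each edge at \<open>f\<close> extends to a maximal clique, which must be \<open>C\<close>.
\<close>

lemma closed_neighborhood_free_vertex:
  fixes E :: "'v::finite \<Rightarrow> 'v \<Rightarrow> bool"
  assumes graph: "simple_graph E" and C: "maximal_clique E C" "f \<in> C" and free: "free_vertex E f"
  shows "closed_neighborhood E f = C"
proof
  show "C \<subseteq> closed_neighborhood E f"
    using C by (intro clique_subset_neighborhood) (simp_all add: maximal_clique_def)
  show "closed_neighborhood E f \<subseteq> C"
  proof
    fix j assume "j \<in> closed_neighborhood E f"
    then have "clique E {f, j}"
      using graph by (auto simp: closed_neighborhood_def clique_def simple_graph_def dest: sympD)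
    then obtain C' where "maximal_clique E C'" "{f, j} \<subseteq> C'" using clique_extends_to_maximal by blast
    then show "j \<in> C" using free C unfolding free_vertex_def by blast
  qed
qed

lemma card_closed_neighborhood:
  fixes E :: "'v::finite \<Rightarrow> 'v \<Rightarrow> bool"
  assumes "simple_graph E"
  shows "card (closed_neighborhood E i) = Suc (vertex_degree E i)"
proof -
  have "i \<notin> {j. E i j}" using assms by (auto simp: simple_graph_def irreflp_def)
  then show ?thesis by (simp add: closed_neighborhood_def vertex_degree_def)
qed

lemma min_degree_le: "min_degree E \<le> vertex_degree E i"
  unfolding min_degree_def by (rule Min_le) auto

context
  fixes E :: "'v::finite \<Rightarrow> 'v \<Rightarrow> bool" and \<C> :: "'v set set" and l :: nat
  assumes graph: "simple_graph E"
    and part: "partition_on UNIV (maximal_cliques_with_free_vertex E)"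
    and \<C>: "\<C> = maximal_cliques_with_free_vertex E"
    and l: "l \<le> min_degree E"
begin

lemma block_is_neighborhood:
  assumes "C \<in> \<C>" shows "\<exists>f. closed_neighborhood E f = C"
proof -
  obtain f where "maximal_clique E C" "f \<in> C" "free_vertex E f"
    using assms unfolding \<C> maximal_cliques_with_free_vertex_def by blast
  then show ?thesis using closed_neighborhood_free_vertex[OF graph] by blast
qed

lemma block_subset_neighborhood: "C \<in> \<C> \<Longrightarrow> i \<in> C \<Longrightarrow> C \<subseteq> closed_neighborhood E i"
  by (rule clique_subset_neighborhood) (auto simp: \<C> maximal_cliques_with_free_vertex_def maximal_clique_def)

lemma block_exists: "\<exists>C\<in>\<C>. i \<in> C"
  using partition_onD1[OF part] unfolding \<C> by blast

lemma card_block: "C \<in> \<C> \<Longrightarrow> Suc l \<le> card C"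
proof -
  assume "C \<in> \<C>"
  then obtain f where "closed_neighborhood E f = C" using block_is_neighborhood by blast
  then have "card C = Suc (vertex_degree E f)" using card_closed_neighborhood[OF graph, of f] by simp
  then show "Suc l \<le> card C" using min_degree_le[of E f] l by linarith
qed

text \<open>
  A set \<open>W \<subseteq> N[i]\<close> with \<open>|N[i]| - l\<close> elements contains at least \<open>|C| - l\<close> elements of the block \<open>C\<close> of \<open>i\<close>,
  which is too many for a face. Conversely a nonface contains \<open>|C| - l\<close> elements of some \<open>C = N[f]\<close>, and
  these form a generator that belongs to \<open>f\<close>.
\<close>

lemma neighborhood_ideal_eq:
  assumes k: "\<And>i. k i = vertex_degree E i + 1 - l"
  shows "neighborhood_ideal E k = (stanley_reisner (partition_complex \<C> (\<lambda>C. card C - Suc l)) :: ('v, 'k::field) mpoly set)"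
    (is "_ = ?I")
proof
  let ?B = "\<Union>i. {\<Prod>j\<in>W. var j | W. W \<subseteq> closed_neighborhood E i \<and> card W = k i} :: ('v, 'k) mpoly set"
  have kN: "k i = card (closed_neighborhood E i) - l" for i
    by (simp add: k card_closed_neighborhood[OF graph])
  have gen: "xmon W \<in> ?I" if W: "W \<subseteq> closed_neighborhood E i" "card W = k i" for W i
  proof -
    obtain C where C: "C \<in> \<C>" "i \<in> C" using block_exists by blast
    let ?N = "closed_neighborhood E i"
    have sub: "C \<subseteq> ?N" using block_subset_neighborhood C by blast
    have "card ?N - l = card W" using W kN by simp
    also have "card W = card (W \<inter> C) + card (W - C)" by (simp add: card_Int_Diff)
    also have "card (W - C) \<le> card (?N - C)" using W by (intro card_mono) auto
    also have "card (?N - C) = card ?N - card C" using sub by (simp add: card_Diff_subset)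
    finally have "card ?N - l \<le> card (W \<inter> C) + (card ?N - card C)" by simp
    moreover have "card C \<le> card ?N" using sub by (intro card_mono) auto
    ultimately have "card C - Suc l < card (W \<inter> C)" using card_block[OF C(1)] by linarith
    then show ?thesis
      using C by (auto simp: stanley_reisner_def partition_complex_def keys_sqfree not_le)
  qed
  then have "?B \<subseteq> ?I" by (auto simp: prod_var_eq)
  then show "neighborhood_ideal E k \<subseteq> ?I"
    unfolding neighborhood_ideal_def
    by (intro ideal_generated_least is_ideal_stanley_reisner down_closed_partition_complex)
  show "?I \<subseteq> neighborhood_ideal E k"
  proof
    fix p :: "('v, 'k) mpoly" assume p: "p \<in> ?I"
    have "Poly_Mapping.single m c \<in> ideal_generated ?B" if m: "m \<in> Poly_Mapping.keys p" for m c
    proof -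
      obtain C where C: "C \<in> \<C>" "card C - Suc l < card (Poly_Mapping.keys m \<inter> C)"
        using p m by (auto simp: stanley_reisner_def partition_complex_def not_le)
      then have "card C - l \<le> card (Poly_Mapping.keys m \<inter> C)" by linarith
      then obtain W where W: "W \<subseteq> Poly_Mapping.keys m \<inter> C" "card W = card C - l"
        by (meson obtain_subset_with_card_n)
      obtain f where f: "closed_neighborhood E f = C" using block_is_neighborhood C(1) by blast
      have "W \<subseteq> closed_neighborhood E f" "card W = k f" using W f kN[of f] by auto
      then have "(\<Prod>j\<in>W. var j) \<in> ?B" by (intro UN_I[of f] CollectI exI[of _ W] conjI refl) simp_all
      then have "xmon W \<in> ?B" by (simp only: prod_var_eq)
      then have "xmon W \<in> ideal_generated ?B" by (rule subsetD[OF ideal_generated_superset])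
      moreover obtain m' where "m = sqfree W + m'" using sqfree_divides[of W m] W by blast
      then have "Poly_Mapping.single m c = Poly_Mapping.single m' c * xmon W"
        by (simp add: mult_single add.commute)
      ultimately show ?thesis using is_ideal_mult[OF is_ideal_generated] by simp
    qed
    then have "(\<Sum>m\<in>Poly_Mapping.keys p. Poly_Mapping.single m (Poly_Mapping.lookup p m)) \<in> ideal_generated ?B"
      by (intro is_ideal_sum is_ideal_generated)
    then show "p \<in> neighborhood_ideal E k" by (simp add: sum_single_lookup neighborhood_ideal_def)
  qed
qed

lemma tuple_dominating_iff:
  "tuple_dominating E h D \<longleftrightarrow> (\<forall>C\<in>\<C>. h \<le> card (D \<inter> C))"
proof
  assume "tuple_dominating E h D"
  then have dom: "h \<le> card (closed_neighborhood E f \<inter> D)" for f by (simp add: tuple_dominating_def)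
  show "\<forall>C\<in>\<C>. h \<le> card (D \<inter> C)"
  proof
    fix C assume "C \<in> \<C>"
    then obtain f where "closed_neighborhood E f = C" using block_is_neighborhood by blast
    then show "h \<le> card (D \<inter> C)" using dom[of f] by (simp add: Int_commute)
  qed
next
  assume D: "\<forall>C\<in>\<C>. h \<le> card (D \<inter> C)"
  have "h \<le> card (closed_neighborhood E i \<inter> D)" for i
  proof -
    obtain C where C: "C \<in> \<C>" "i \<in> C" using block_exists by blast
    then have "card (D \<inter> C) \<le> card (closed_neighborhood E i \<inter> D)"
      using block_subset_neighborhood by (intro card_mono) auto
    then show ?thesis using D C by (meson order_trans)
  qed
  then show "tuple_dominating E h D" by (simp add: tuple_dominating_def)
qed

text \<open>
  Domination is a separate condition on each block, so a block with more than \<open>h\<close> elements of \<open>D\<close> can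
  give one up.
\<close>

lemma card_minimal_tuple_dominating:
  assumes min: "minimal_tuple_dominating E h D"
  shows "card D = card \<C> * h"
proof -
  have dom: "h \<le> card (D \<inter> C)" if "C \<in> \<C>" for C
    using min that unfolding minimal_tuple_dominating_def tuple_dominating_iff by blast
  have "card (D \<inter> C) = h" if C: "C \<in> \<C>" for C
  proof (rule ccontr)
    assume "card (D \<inter> C) \<noteq> h"
    then have gt: "h < card (D \<inter> C)" using dom[OF C] by simp
    then have "D \<inter> C \<noteq> {}" by auto
    then obtain v where v: "v \<in> D" "v \<in> C" by blast
    have "h \<le> card ((D - {v}) \<inter> C')" if C': "C' \<in> \<C>" for C'
    proof (cases "C' = C")
      case True
      have "(D - {v}) \<inter> C = (D \<inter> C) - {v}" by blast
      then show ?thesis using True gt v by simp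
    next
      case False
      then have "v \<notin> C'" using disjointD[OF partition_onD2[OF part], of C' C] C C' v unfolding \<C> by blast
      then have "(D - {v}) \<inter> C' = D \<inter> C'" by blast
      then show ?thesis using dom[OF C'] by simp
    qed
    then have "tuple_dominating E h (D - {v})" by (simp add: tuple_dominating_iff)
    moreover have "D - {v} \<subset> D" using v by blast
    ultimately show False using min unfolding minimal_tuple_dominating_def by blast
  qed
  then show ?thesis using card_eq_sum_blocks[OF part, of D] by (simp add: \<C>)
qed

lemma sum_block_capacities:
  "int (\<Sum>C\<in>\<C>. card C - Suc l) = int CARD('v) - int (card \<C>) * (int l + 1)"
proof -
  have "int (\<Sum>C\<in>\<C>. card C - Suc l) = (\<Sum>C\<in>\<C>. int (card C) - (int l + 1))"
    unfolding of_nat_sum using card_block by (intro sum.cong) (auto simp: of_nat_diff)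
  also have "\<dots> = int (\<Sum>C\<in>\<C>. card C) - int (card \<C>) * (int l + 1)"
    by (simp add: sum_subtractf)
  also have "(\<Sum>C\<in>\<C>. card C) = CARD('v)"
    using card_eq_sum_blocks[OF part, of UNIV] by (simp add: \<C>)
  finally show ?thesis .
qed

end

theorem theorem3p7:
  fixes E :: "'v::finite \<Rightarrow> 'v \<Rightarrow> bool"
    and NI :: "('v \<Rightarrow> nat) \<Rightarrow> ('v, 'k::field) mpoly set"
    and r :: nat
  assumes graph: "simple_graph E"
    and no_isolated: "no_isolated_vertices E"
    and cliques: "partition_on (UNIV :: 'v set) (maximal_cliques_with_free_vertex E)"
    and NI: "NI = neighborhood_ideal E"
    and r: "r = card (maximal_cliques_with_free_vertex E)"
  shows
    "(\<forall>(l::nat) k. 1 \<le> l \<and> l \<le> min_degree E \<and> (\<forall>i. k i = vertex_degree E i + 1 - l) \<longrightarrow>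
        cohen_macaulay_quotient (NI k) \<and>
        regularity_quotient (NI k) = int CARD('v) - int r * (int l + 1) \<and>
        (\<forall>D D'. minimal_tuple_dominating E (l + 1) D \<and> minimal_tuple_dominating E (l + 1) D' \<longrightarrow>
           card D = card D')) \<and>
     (\<forall>k. (\<forall>i. k i = vertex_degree E i) \<longrightarrow>
        cohen_macaulay_quotient (NI k) \<and>
        regularity_quotient (NI k) = int CARD('v) - 2 * int r)"
proof -
  let ?\<C> = "maximal_cliques_with_free_vertex E"
  have main: "cohen_macaulay_quotient (NI k)" "regularity_quotient (NI k) = int CARD('v) - int r * (int l + 1)"
    if l: "l \<le> min_degree E" and k: "\<And>i. k i = vertex_degree E i + 1 - l" for l k
  proof -
    note card = card_block[OF graph cliques refl l]
    have eq: "NI k = stanley_reisner (partition_complex ?\<C> (\<lambda>C. card C - Suc l))"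
      unfolding NI by (rule neighborhood_ideal_eq[OF graph cliques refl l k])
    show "cohen_macaulay_quotient (NI k)"
      unfolding eq by (rule cohen_macaulay_partition_complex[OF cliques]) simp
    have "card C - Suc l < card C" if "C \<in> ?\<C>" for C using card[OF that] by simp
    then show "regularity_quotient (NI k) = int CARD('v) - int r * (int l + 1)"
      unfolding eq r sum_block_capacities[OF graph cliques refl l, symmetric]
      by (intro regularity_partition_complex partition_onD2[OF cliques])
  qed
  have dominating: "card D = card D'"
    if "l \<le> min_degree E" "minimal_tuple_dominating E h D" "minimal_tuple_dominating E h D'" for l h D D'
    using card_minimal_tuple_dominating[OF graph cliques refl that(1)] that(2,3) by simp
  have "1 \<le> vertex_degree E i" for i
  proof -
    have "{j. E i j} \<noteq> {}" using no_isolated by (auto simp: no_isolated_vertices_def)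
    then show ?thesis by (simp add: vertex_degree_def Suc_le_eq card_gt_0_iff)
  qed
  then have one: "1 \<le> min_degree E" unfolding min_degree_def by simp
  show ?thesis
  proof (intro conjI allI impI)
    fix l k D D'
    assume "1 \<le> l \<and> l \<le> min_degree E \<and> (\<forall>i. k i = vertex_degree E i + 1 - l)"
    then have l: "l \<le> min_degree E" and k: "\<And>i. k i = vertex_degree E i + 1 - l" by auto
    show "cohen_macaulay_quotient (NI k)"
      "regularity_quotient (NI k) = int CARD('v) - int r * (int l + 1)"
      by (rule main[OF l k])+
    assume "minimal_tuple_dominating E (l + 1) D \<and> minimal_tuple_dominating E (l + 1) D'"
    then show "card D = card D'" using dominating[OF l] by blast
  next
    fix k assume "\<forall>i. k i = vertex_degree E i"
    then have k: "k i = vertex_degree E i + 1 - 1" for i by simp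
    show "cohen_macaulay_quotient (NI k)" by (rule main(1)[OF one k])
    show "regularity_quotient (NI k) = int CARD('v) - 2 * int r" using main(2)[OF one k] by simp
  qed
qed

end
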